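(* \textsc{Biclique Contraction} and \textsc{Balanced Biclique Contraction} can each be solved in time $\mathcal{O}^*(25.904^k)$.
   Context: All graphs are finite, simple and undirected. Contracting an edge $uv$ of $G$ replaces $u$ and $v$ by a single new vertex adjacent to every vertex of $(N_G(u)\cup N_G(v))\setminus\{u,v\}$; for $F\subseteq E(G)$, $G/F$ is the graph obtained by contracting all edges of $F$. A biclique is a bipartite graph with a bipartition $\langle X,Y\rangle$ such that every vertex of $X$ is adjacent to every vertex of $Y$ (edgeless graphs included); it is balanced if $|X|=|Y|$. \textsc{Biclique Contraction}: given a graph $G$ and an integer $k$, decide whether there is $F\subseteq E(G)$ with $|F|\le k$ such that $G/F$ is a biclique. \textsc{Balanced Biclique Contraction}: the same with $G/F$ a balanced biclique. The notation $\mathcal{O}^*(f(k))$ means $f(k)\cdot n^{\mathcal{O}(1)}$ where $n$ is the input size. *)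

theory Defs
  imports Complex_Main "HOL-Library.Log_Nat"
begin

section \<open>Graphs, contractions and bicliques\<close>

type_synonym 'a graph = "'a set \<times> 'a set set"

abbreviation verts :: "'a graph \<Rightarrow> 'a set" where "verts \<equiv> fst"
abbreviation edges :: "'a graph \<Rightarrow> 'a set set" where "edges \<equiv> snd"

definition simple_graph :: "'a graph \<Rightarrow> bool" where
  "simple_graph G \<longleftrightarrow> finite (verts G) \<and> (\<forall>e\<in>edges G. e \<subseteq> verts G \<and> card e = 2)"

definition nbrs :: "'a set set \<Rightarrow> 'a \<Rightarrow> 'a set" where
  "nbrs E u = {x. {u, x} \<in> E}"

text \<open>The effect on a set of edges of contracting the edge \<open>uv\<close> into a new vertex \<open>w\<close>.
  It is used both for the edges of the graph and for the edges that are still to be contracted.\<close>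

definition contract_edges :: "'a \<Rightarrow> 'a \<Rightarrow> 'a \<Rightarrow> 'a set set \<Rightarrow> 'a set set" where
  "contract_edges u v w E =
     {e \<in> E. u \<notin> e \<and> v \<notin> e} \<union> {{w, x} | x. x \<in> (nbrs E u \<union> nbrs E v) - {u, v}}"

definition contract_edge :: "'a \<Rightarrow> 'a \<Rightarrow> 'a \<Rightarrow> 'a graph \<Rightarrow> 'a graph" where
  "contract_edge u v w G =
     (insert w (verts G - {u, v}), contract_edges u v w (edges G))"

text \<open>\<open>contracts_to G F H\<close>: the graph \<open>H\<close> is (a copy of) \<open>G/F\<close>, obtained by contracting the
  edges of \<open>F\<close> one at a time.  After each step the remaining edges of \<open>F\<close> are replaced by their
  images in the contracted graph; edges of \<open>F\<close> whose two ends have already been identified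
  disappear.  The copy depends on the contraction order and on the names \<open>w\<close> of the new
  vertices, but its isomorphism type does not.\<close>

inductive contracts_to :: "'a graph \<Rightarrow> 'a set set \<Rightarrow> 'a graph \<Rightarrow> bool" where
  none: "contracts_to G {} G"
| step: "{u, v} \<in> F \<Longrightarrow> u \<noteq> v \<Longrightarrow> w \<notin> verts G \<Longrightarrow>
    contracts_to (contract_edge u v w G) (contract_edges u v w F) H \<Longrightarrow> contracts_to G F H"

text \<open>A part may be empty, so edgeless graphs are bicliques (with \<open>Y = {}\<close>).\<close>

definition biclique_parts :: "'a graph \<Rightarrow> 'a set \<Rightarrow> 'a set \<Rightarrow> bool" where
  "biclique_parts G X Y \<longleftrightarrow>
     X \<union> Y = verts G \<and> X \<inter> Y = {} \<and>
     (\<forall>e\<in>edges G. \<exists>x\<in>X. \<exists>y\<in>Y. e = {x, y}) \<and>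
     (\<forall>x\<in>X. \<forall>y\<in>Y. {x, y} \<in> edges G)"

definition biclique :: "'a graph \<Rightarrow> bool" where
  "biclique G \<longleftrightarrow> (\<exists>X Y. biclique_parts G X Y)"

definition balanced_biclique :: "'a graph \<Rightarrow> bool" where
  "balanced_biclique G \<longleftrightarrow> (\<exists>X Y. biclique_parts G X Y \<and> card X = card Y)"

definition biclique_contraction :: "nat graph \<Rightarrow> nat \<Rightarrow> bool" where
  "biclique_contraction G k \<longleftrightarrow>
     (\<exists>F H. F \<subseteq> edges G \<and> card F \<le> k \<and> contracts_to G F H \<and> biclique H)"

definition balanced_biclique_contraction :: "nat graph \<Rightarrow> nat \<Rightarrow> bool" where
  "balanced_biclique_contraction G k \<longleftrightarrow>
     (\<exists>F H. F \<subseteq> edges G \<and> card F \<le> k \<and> contracts_to G F H \<and> balanced_biclique H)"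

lemma simple_graph_contract_edge:
  assumes "simple_graph G" "w \<notin> verts G"
  shows "simple_graph (contract_edge u v w G)"
  unfolding simple_graph_def
proof (intro conjI ballI)
  show "finite (verts (contract_edge u v w G))"
    using assms by (simp add: contract_edge_def simple_graph_def)
next
  fix e assume "e \<in> edges (contract_edge u v w G)"
  then have "e \<in> edges G \<and> u \<notin> e \<and> v \<notin> e \<or>
      (\<exists>x. e = {w, x} \<and> ({u, x} \<in> edges G \<or> {v, x} \<in> edges G) \<and> x \<noteq> u \<and> x \<noteq> v)"
    by (simp add: contract_edge_def contract_edges_def nbrs_def)
  then consider "e \<in> edges G" "u \<notin> e" "v \<notin> e"
    | x where "e = {w, x}" "{u, x} \<in> edges G \<or> {v, x} \<in> edges G" "x \<noteq> u" "x \<noteq> v"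
    by blast
  then have "e \<subseteq> verts (contract_edge u v w G) \<and> card e = 2"
  proof cases
    case 1
    then show ?thesis
      using assms by (auto simp: simple_graph_def contract_edge_def)
  next
    case 2
    then have "x \<in> verts G"
      using assms(1) unfolding simple_graph_def by (metis insert_subset)
    moreover from this have "x \<noteq> w"
      using assms(2) by metis
    ultimately show ?thesis
      using 2(1,3,4) by (simp add: contract_edge_def)
  qed
  then show "e \<subseteq> verts (contract_edge u v w G)" "card e = 2"
    by simp_all
qed

lemma contract_edges_mono: "F \<subseteq> E \<Longrightarrow> contract_edges u v w F \<subseteq> contract_edges u v w E"
  by (auto simp: contract_edges_def nbrs_def)

lemma contracts_to_exists:
  fixes G :: "nat graph"
  assumes "simple_graph G" "F \<subseteq> edges G"
  shows "\<exists>H. contracts_to G F H"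
  using assms
proof (induction "card (verts G)" arbitrary: G F rule: less_induct)
  case less
  show ?case
  proof (cases "F = {}")
    case True
    then show ?thesis using contracts_to.none by blast
  next
    case False
    then obtain e where e: "e \<in> F" by blast
    have "e \<in> edges G"
      using e less.prems(2) by (rule rev_subsetD)
    then have sub: "e \<subseteq> verts G" and c: "card e = 2" and fin: "finite (verts G)"
      using less.prems(1) by (simp_all add: simple_graph_def)
    from c obtain u v where uv: "e = {u, v}" "u \<noteq> v"
      unfolding card_2_iff by blast
    obtain w where w: "w \<notin> verts G"
      using fin ex_new_if_finite infinite_UNIV_nat by blast
    have "{u, v} \<subseteq> verts G" using uv sub by simp
    then have "card (verts G - {u, v}) = card (verts G) - 2" "card (verts G) \<ge> 2"
      using uv fin card_Diff_subset[of "{u, v}" "verts G"] card_mono[of "verts G" "{u, v}"] by auto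
    then have "card (verts (contract_edge u v w G)) < card (verts G)"
      using w fin by (simp add: contract_edge_def)
    moreover have "simple_graph (contract_edge u v w G)"
      using less.prems(1) w by (rule simple_graph_contract_edge)
    moreover have "contract_edges u v w F \<subseteq> edges (contract_edge u v w G)"
      using contract_edges_mono[OF less.prems(2)] by (simp add: contract_edge_def)
    ultimately obtain H where "contracts_to (contract_edge u v w G) (contract_edges u v w F) H"
      using less.hyps[of "contract_edge u v w G" "contract_edges u v w F"] by blast
    then have "contracts_to G F H"
      using e uv w by (intro contracts_to.step[of u v F w]) simp_all
    then show ?thesis ..
  qed
qed


section \<open>Machine model and running time\<close>

text \<open>A deterministic random access machine, programmed by structured programs.  The memory
  consists of named unbounded arrays of natural numbers, of which a program uses only finitely
  many; a scalar variable is an array used at index 0 only.  Every executed assignment and every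
  evaluated test costs one unit of time (the expressions in a fixed program have constant size).
  The only arithmetic operations are addition and truncated subtraction: unit-cost multiplication
  is excluded, so that the bit length of the numbers grows by at most a constant in each step and
  the model is equivalent to deterministic Turing machines up to a polynomial in the running time
  and the input size.\<close>

type_synonym mem = "string \<Rightarrow> nat \<Rightarrow> nat"

datatype aexp =
    Const nat
  | Cell string aexp
  | Plus aexp aexp
  | Monus aexp aexp

datatype bexp =
    Less aexp aexp
  | Neg bexp
  | Conj bexp bexp

datatype prog =
    Skip
  | Assign string aexp aexp
  | Seq prog prog
  | Cond bexp prog prog
  | Loop bexp prog

primrec aval :: "aexp \<Rightarrow> mem \<Rightarrow> nat" where
  "aval (Const c) s = c"
| "aval (Cell x a) s = s x (aval a s)"
| "aval (Plus a b) s = aval a s + aval b s"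
| "aval (Monus a b) s = aval a s - aval b s"

primrec bval :: "bexp \<Rightarrow> mem \<Rightarrow> bool" where
  "bval (Less a b) s \<longleftrightarrow> aval a s < aval b s"
| "bval (Neg b) s \<longleftrightarrow> \<not> bval b s"
| "bval (Conj b c) s \<longleftrightarrow> bval b s \<and> bval c s"

text \<open>\<open>exec p s t s'\<close>: started in memory \<open>s\<close>, the program \<open>p\<close> halts after exactly \<open>t\<close> units of
  time in memory \<open>s'\<close>.  \<open>Assign x a b\<close> stores the value of \<open>b\<close> in cell \<open>a\<close> of array \<open>x\<close>.\<close>

inductive exec :: "prog \<Rightarrow> mem \<Rightarrow> nat \<Rightarrow> mem \<Rightarrow> bool" where
  Skip: "exec Skip s 1 s"
| Assign: "exec (Assign x a b) s 1 (s(x := (s x)(aval a s := aval b s)))"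
| Seq: "exec p s t s' \<Longrightarrow> exec q s' t' s'' \<Longrightarrow> exec (Seq p q) s (t + t') s''"
| CondT: "bval b s \<Longrightarrow> exec p s t s' \<Longrightarrow> exec (Cond b p q) s (1 + t) s'"
| CondF: "\<not> bval b s \<Longrightarrow> exec q s t s' \<Longrightarrow> exec (Cond b p q) s (1 + t) s'"
| LoopF: "\<not> bval b s \<Longrightarrow> exec (Loop b p) s 1 s"
| LoopT: "bval b s \<Longrightarrow> exec p s t s' \<Longrightarrow> exec (Loop b p) s' t' s'' \<Longrightarrow>
    exec (Loop b p) s (1 + t + t') s''"

inductive_cases SkipE: "exec Skip s t s'"
  and AssignE: "exec (Assign x a b) s t s'"
  and SeqE: "exec (Seq p q) s t s'"
  and CondE: "exec (Cond b p q) s t s'"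
  and LoopE: "exec (Loop b p) s t s'"

lemma exec_deterministic:
  assumes "exec p s t s'" "exec p s u r"
  shows "u = t \<and> r = s'"
  using assms
proof (induction arbitrary: u r)
  case (Skip s)
  then show ?case by (auto elim: SkipE)
next
  case (Assign x a b s)
  then show ?case by (auto elim: AssignE)
next
  case (Seq p s t s' q t' s'')
  from Seq.prems show ?case by (rule SeqE) (auto dest!: Seq.IH)
next
  case (CondT b s p t s' q)
  from CondT.prems show ?case by (rule CondE) (use CondT.hyps in \<open>auto dest!: CondT.IH\<close>)
next
  case (CondF b s q t s' p)
  from CondF.prems show ?case by (rule CondE) (use CondF.hyps in \<open>auto dest!: CondF.IH\<close>)
next
  case (LoopF b s p)
  from LoopF.prems show ?case by (rule LoopE) (use LoopF.hyps in auto)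
next
  case (LoopT b s p t s' t' s'')
  from LoopT.prems show ?case by (rule LoopE) (use LoopT.hyps in \<open>auto dest!: LoopT.IH\<close>)
qed

definition input_mem :: "nat list \<Rightarrow> mem" where
  "input_mem xs = (\<lambda>x i. if x = ''in'' \<and> i < length xs then xs ! i else 0)"

text \<open>The number of vertices, the parameter and the adjacency matrix, row by row.\<close>

definition encode :: "nat \<Rightarrow> nat set set \<Rightarrow> nat \<Rightarrow> nat list" where
  "encode n E k = n # k # [of_bool ({i, j} \<in> E). i \<leftarrow> [0..<n], j \<leftarrow> [0..<n]]"

text \<open>Total length in bits, plus one separator per entry.\<close>

definition input_size :: "nat list \<Rightarrow> nat" where
  "input_size xs = (\<Sum>x\<leftarrow>xs. floorlog 2 x + 1)"

text \<open>The graph problem \<open>P\<close>, parameterized by \<open>k\<close>, can be solved in time \<open>O\<^sup>*(f k)\<close>: a single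
  program decides all instances, each within \<open>C f(k) N\<^sup>d\<close> units of time, where \<open>N\<close> is the size of
  the instance.  As usual for inputs of algorithms, the vertices are numbered \<open>0, \<dots>, n - 1\<close>.\<close>

definition solvable_in_Ostar :: "(nat graph \<Rightarrow> nat \<Rightarrow> bool) \<Rightarrow> (nat \<Rightarrow> real) \<Rightarrow> bool" where
  "solvable_in_Ostar P f \<longleftrightarrow>
     (\<exists>p (C::real) (d::nat). \<forall>n E k. simple_graph ({..<n}, E) \<longrightarrow>
        (\<exists>t s. exec p (input_mem (encode n E k)) t s \<and>
               s ''out'' 0 = of_bool (P ({..<n}, E) k) \<and>
               real t \<le> C * f k * real (input_size (encode n E k)) ^ d))"

end

theory Submission
  imports Defs
begin

text \<open>A contraction with at most \<open>k\<close> edges to a biclique is a two-colouring of the vertices such that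
  the number \<open>s\<close> of components of colour 0 and the number \<open>t\<close> of components of colour 1 satisfy
  \<open>n - s - t \<le> k\<close> and every component of colour 0 is adjacent to every component of colour 1.
  By symmetry let \<open>t \<le> s\<close>.  At most \<open>4k + 1\<close> guessed bits determine the colouring, except for
  \<open>t = 1\<close>.

  If \<open>n \<le> 4k + 1\<close>, all colours are guessed.  Otherwise \<open>s > k\<close>, so some component of colour 0 is a single
  vertex \<open>a\<close>, and all of \<open>N(a)\<close> has colour 1.  If also \<open>t > k\<close>, there is such a \<open>b\<close> of colour 1, and
  at most \<open>k\<close> vertices outside \<open>N(a) \<union> N(b)\<close> remain to be guessed.  If \<open>2 \<le> t \<le> k\<close>, branching on the
  edges outside \<open>N(a)\<close> takes at most \<open>2k\<close> bits and leaves an independent set that only sees vertices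
  of colour 1.  There are at most \<open>2k\<close> of these, so one can guess which of them lie in a fixed component
  of colour 1; then an uncoloured vertex has colour 0 iff it sees both this component and another one.

  For \<open>t = 1\<close> the colour class can be taken to be a connected vertex cover with at most \<open>k + 1\<close> vertices.
  It arises from a guessed vertex cover (\<open>k + 1\<close> bits) as a Steiner tree, found by dynamic
  programming over pairs of subsets of the cover.  Both searches take time \<open>O\<^sup>*(16\<^sup>k)\<close>.\<close>


text \<open>The constant 25.904 enters only as a number above 16. The parameter is encoded in
  binary, so a factor polynomial in \<open>k\<close> is not polynomial in the input size; it has to
  be absorbed by the exponential, and any base above 16 leaves room for that.

  The case \<open>t = 1\<close> escapes the bit count because the last colouring rule compares two
  components of colour 1. If there is only one, an uncoloured vertex sees just that component
  whichever colour it has. Such a solution is therefore replaced by another one, built on a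
  connected vertex cover.

  Guessing is made deterministic by writing the binary digits of a counter into an array before each
  search. No search needs to know whether its guesses are right: a candidate colouring is checked,
  and a tree found by dynamic programming is itself a certificate. So soundness holds for arbitrary
  guesses, and completeness asks only for one suitable bit string.\<close>

section \<open>Connectivity by a set of edges\<close>

definition conn :: "'a set set \<Rightarrow> ('a \<times> 'a) set" where
  "conn F = {(u, v). {u, v} \<in> F}\<^sup>*"

lemma conn_refl [simp]: "(x, x) \<in> conn F"
  by (simp add: conn_def)

lemma conn_edge: "{x, y} \<in> F \<Longrightarrow> (x, y) \<in> conn F"
  by (auto simp: conn_def)

lemma conn_sym: "(x, y) \<in> conn F \<Longrightarrow> (y, x) \<in> conn F"
proof -
  have "sym {(u, v). {u, v} \<in> F}" by (auto simp: sym_def insert_commute)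
  then show "(x, y) \<in> conn F \<Longrightarrow> (y, x) \<in> conn F"
    unfolding conn_def by (metis sym_rtrancl symD)
qed

lemma conn_trans: "(x, y) \<in> conn F \<Longrightarrow> (y, z) \<in> conn F \<Longrightarrow> (x, z) \<in> conn F"
  by (auto simp: conn_def)

lemma conn_induct [consumes 1, case_names refl step]:
  assumes "(x, y) \<in> conn F" "P x"
    and "\<And>y z. (x, y) \<in> conn F \<Longrightarrow> {y, z} \<in> F \<Longrightarrow> P y \<Longrightarrow> P z"
  shows "P y"
  using assms(1) unfolding conn_def
  by (induction rule: rtrancl_induct) (use assms(2,3) in \<open>auto simp: conn_def\<close>)

lemma conn_mono: "F \<subseteq> F' \<Longrightarrow> conn F \<subseteq> conn F'"
  unfolding conn_def by (rule rtrancl_mono) auto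

lemma conn_Image_eq_iff: "conn F `` {u} = conn F `` {v} \<longleftrightarrow> (u, v) \<in> conn F"
  by (auto dest: conn_sym conn_trans intro: conn_refl)

text \<open>This lets components be counted through any labelling with the same fibres: vertex sets,
  the quotient map of a contraction, or the labels that the program computes.\<close>

lemma card_image_cong:
  assumes "\<And>x y. x \<in> A \<Longrightarrow> y \<in> A \<Longrightarrow> f x = f y \<longleftrightarrow> g x = g y"
  shows "card (f ` A) = card (g ` A)"
proof -
  define h where "h = (\<lambda>z. g (inv_into A f z))"
  have h: "h (f x) = g x" if "x \<in> A" for x
    unfolding h_def using that assms f_inv_into_f[of "f x" f A] inv_into_into[of "f x" f A] by blast
  have "inj_on h (f ` A)"
    by (auto simp: inj_on_def h assms)
  moreover have "h ` f ` A = g ` A"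
    by (auto simp: h image_image)
  ultimately show ?thesis
    by (metis card_image)
qed

section \<open>Contraction as a quotient map\<close>

text \<open>Contraction takes images under \<open>c\<close>, and \<open>a \<noteq> b\<close>
  excludes the loop that \<open>uv\<close> would become. The edge set is arbitrary because the same
  description is needed for the edges of the graph and for those still to be contracted.\<close>

lemma contract_edges_iff:
  assumes "\<forall>e\<in>E. e \<subseteq> V \<and> card e = 2" "w \<notin> V" "u \<noteq> v" "u \<in> V" "v \<in> V" "a \<noteq> b"
  defines "c \<equiv> (\<lambda>x. if x = u \<or> x = v then w else x)"
  shows "{a, b} \<in> contract_edges u v w E \<longleftrightarrow> (\<exists>x\<in>V. \<exists>y\<in>V. c x = a \<and> c y = b \<and> {x, y} \<in> E)"
proof
  have inV: "x \<in> V \<and> y \<in> V" if "{x, y} \<in> E" for x y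
    using assms(1) that by blast
  {
    assume "{a, b} \<in> contract_edges u v w E"
    then consider "{a, b} \<in> E" "u \<notin> {a, b}" "v \<notin> {a, b}"
      | x where "{a, b} = {w, x}" "{u, x} \<in> E \<or> {v, x} \<in> E" "x \<noteq> u" "x \<noteq> v"
      by (auto simp: contract_edges_def nbrs_def)
    then show "\<exists>x\<in>V. \<exists>y\<in>V. c x = a \<and> c y = b \<and> {x, y} \<in> E"
    proof cases
      case 1
      then have "a \<in> V" "b \<in> V" using inV by blast+
      then show ?thesis using 1 by (intro bexI[of _ a] bexI[of _ b]) (auto simp: c_def)
    next
      case 2
      then obtain z where z: "z \<in> {u, v}" "{z, x} \<in> E" by blast
      have xV: "x \<in> V" using inV z by blast
      have c: "c z = w" "c x = x" using z 2 by (auto simp: c_def)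
      have "(a = w \<and> b = x) \<or> (a = x \<and> b = w)" using 2(1) assms(6) by (auto simp: doubleton_eq_iff)
      then show ?thesis
        using c z xV assms(4,5) by (metis empty_iff insert_commute insert_iff)
    qed
  }
  {
    assume "\<exists>x\<in>V. \<exists>y\<in>V. c x = a \<and> c y = b \<and> {x, y} \<in> E"
    then obtain x y where xy: "x \<in> V" "y \<in> V" "c x = a" "c y = b" "{x, y} \<in> E" by blast
    consider "x \<in> {u, v}" "y \<notin> {u, v}" | "x \<notin> {u, v}" "y \<in> {u, v}" | "x \<notin> {u, v}" "y \<notin> {u, v}"
      using xy assms(6) unfolding c_def by fastforce
    then show "{a, b} \<in> contract_edges u v w E"
    proof cases
      case 1
      then have "a = w" "b = y" using xy by (auto simp: c_def)
      moreover have "y \<in> nbrs E u \<union> nbrs E v - {u, v}" using 1 xy by (auto simp: nbrs_def)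
      ultimately show ?thesis by (auto simp: contract_edges_def)
    next
      case 2
      then have "b = w" "a = x" using xy by (auto simp: c_def)
      moreover have "x \<in> nbrs E u \<union> nbrs E v - {u, v}" using 2 xy by (auto simp: nbrs_def insert_commute)
      ultimately have "{b, a} \<in> contract_edges u v w E" by (auto simp: contract_edges_def)
      then show ?thesis by (simp add: insert_commute)
    next
      case 3
      then show ?thesis using xy by (auto simp: contract_edges_def c_def)
    qed
  }
qed

text \<open>This is the quotient of \<open>G\<close> by the classes of \<open>conn F\<close>, up to
  the names of its vertices. It frees the rest of the proof from the order in which edges are
  contracted and from the choice of new names.\<close>

definition contraction_map :: "('a \<Rightarrow> 'a) \<Rightarrow> 'a graph \<Rightarrow> 'a set set \<Rightarrow> 'a graph \<Rightarrow> bool" where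
  "contraction_map \<phi> G F H \<longleftrightarrow> \<phi> ` verts G = verts H
    \<and> (\<forall>x\<in>verts G. \<forall>y\<in>verts G. \<phi> x = \<phi> y \<longleftrightarrow> (x, y) \<in> conn F)
    \<and> (\<forall>x\<in>verts G. \<forall>y\<in>verts G. \<phi> x \<noteq> \<phi> y \<longrightarrow>
        ({\<phi> x, \<phi> y} \<in> edges H \<longleftrightarrow>
         (\<exists>x'\<in>verts G. \<exists>y'\<in>verts G. \<phi> x' = \<phi> x \<and> \<phi> y' = \<phi> y \<and> {x', y'} \<in> edges G)))"

lemma contraction_mapD:
  assumes "contraction_map \<phi> G F H"
  shows "\<phi> ` verts G = verts H"
    and "x \<in> verts G \<Longrightarrow> y \<in> verts G \<Longrightarrow> \<phi> x = \<phi> y \<longleftrightarrow> (x, y) \<in> conn F"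
    and "x \<in> verts G \<Longrightarrow> y \<in> verts G \<Longrightarrow> \<phi> x \<noteq> \<phi> y \<Longrightarrow> {\<phi> x, \<phi> y} \<in> edges H \<longleftrightarrow>
         (\<exists>x'\<in>verts G. \<exists>y'\<in>verts G. \<phi> x' = \<phi> x \<and> \<phi> y' = \<phi> y \<and> {x', y'} \<in> edges G)"
  using assms unfolding contraction_map_def by (elim conjE, simp)+

text \<open>Quotient maps compose: the map \<open>c\<close> of the first contraction is followed by
  the map of the remaining ones. What has to be shown is that connectivity by \<open>F\<close>
  upstairs is the same as connectivity by the image \<open>F1\<close> downstairs.\<close>

lemma contracts_to_quotient:
  assumes "contracts_to G F H" "simple_graph G" "F \<subseteq> edges G"
  shows "simple_graph H \<and> (\<exists>\<phi>. contraction_map \<phi> G F H)"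
  using assms
proof (induction rule: contracts_to.induct)
  case (none G)
  have "conn {} = (Id :: ('a \<times> 'a) set)" by (auto simp: conn_def)
  then show ?case using none by (intro conjI exI[of _ id]) (auto simp: contraction_map_def)
next
  case (step u v F w G H)
  define G1 F1 where "G1 = contract_edge u v w G" and "F1 = contract_edges u v w F"
  define c where "c = (\<lambda>x. if x = u \<or> x = v then w else x)"
  have E: "\<forall>e\<in>edges G. e \<subseteq> verts G \<and> card e = 2" using step.prems(1) by (simp add: simple_graph_def)
  then have EF: "\<forall>e\<in>F. e \<subseteq> verts G \<and> card e = 2" using step.prems(2) by blast
  have uv: "u \<in> verts G" "v \<in> verts G" using EF step.hyps(1) by blast+
  have sG1: "simple_graph G1" unfolding G1_def
    using step.prems(1) step.hyps(3) by (rule simple_graph_contract_edge)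
  have F1: "F1 \<subseteq> edges G1"
    unfolding F1_def G1_def using contract_edges_mono[OF step.prems(2)] by (simp add: contract_edge_def)
  have V1: "verts G1 = c ` verts G"
    using uv by (auto simp: G1_def contract_edge_def c_def)
  have E1: "{a, b} \<in> edges G1 \<longleftrightarrow> (\<exists>x\<in>verts G. \<exists>y\<in>verts G. c x = a \<and> c y = b \<and> {x, y} \<in> edges G)"
    if "a \<noteq> b" for a b
    unfolding G1_def contract_edge_def c_def snd_conv
    by (rule contract_edges_iff[OF E step.hyps(3,2) uv that])
  have EF1: "{a, b} \<in> F1 \<longleftrightarrow> (\<exists>x\<in>verts G. \<exists>y\<in>verts G. c x = a \<and> c y = b \<and> {x, y} \<in> F)"
    if "a \<noteq> b" for a b
    unfolding F1_def c_def by (rule contract_edges_iff[OF EF step.hyps(3,2) uv that])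
  obtain \<phi> where sH: "simple_graph H" and \<phi>: "contraction_map \<phi> G1 F1 H"
    using step.IH[folded G1_def F1_def, OF sG1 F1] by blast
  note \<phi>1 = contraction_mapD(1)[OF \<phi>] and \<phi>2 = contraction_mapD(2)[OF \<phi>]
    and \<phi>3 = contraction_mapD(3)[OF \<phi>]
  \<comment> \<open>Apart from equal vertices, \<open>c\<close> identifies only \<open>u\<close> and
    \<open>v\<close>, which are joined by an edge of \<open>F\<close>.\<close>
  have c_eq: "(x, y) \<in> conn F" if "c x = c y" "x \<in> verts G" "y \<in> verts G" for x y
  proof -
    have "x = y \<or> x \<in> {u, v} \<and> y \<in> {u, v}"
      using that step.hyps(3) by (auto simp: c_def split: if_splits)
    moreover have "(u, v) \<in> conn F" "(v, u) \<in> conn F"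
      using step.hyps(1) by (auto intro: conn_edge conn_sym)
    ultimately show ?thesis by auto
  qed
  have conn1: "(c x, c y) \<in> conn F1" if "(x, y) \<in> conn F" for x y
    using that
  proof (induction rule: conn_induct)
    case (step y z)
    have "y \<in> verts G" "z \<in> verts G" using step(2) EF by blast+
    then have "c y = c z \<or> {c y, c z} \<in> F1" using EF1 step(2) by blast
    then show ?case using step(3) by (auto intro: conn_trans conn_edge)
  qed simp
  \<comment> \<open>A walk in \<open>F1\<close> is lifted edge by edge; consecutive lifts may end
    and start at different preimages, and \<open>c_eq\<close> bridges the gap. The end of the walk
    is abstracted to \<open>b\<close> so that its preimage \<open>y\<close> can vary in the
    induction.\<close>
  have conn2: "(x, y) \<in> conn F" if "(c x, b) \<in> conn F1" "b = c y" "x \<in> verts G" "y \<in> verts G" for x y b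
    using that
  proof (induction arbitrary: y rule: conn_induct)
    case refl
    then show ?case using c_eq by auto
  next
    case (step a b)
    have "\<exists>e\<in>edges G1. e = {a, b}" using step(2) F1 by blast
    then have "a \<noteq> b" using sG1 by (auto simp: simple_graph_def)
    then obtain y1 y2 where "y1 \<in> verts G" "y2 \<in> verts G" "c y1 = a" "c y2 = b" "{y1, y2} \<in> F"
      using EF1 step(2) by blast
    then show ?case
      using step.IH[of y1] step.prems c_eq[of y2 y] by (metis conn_edge conn_trans)
  qed
  have cV: "c x \<in> verts G1" if "x \<in> verts G" for x using that V1 by simp
  have "(\<phi> (c x) = \<phi> (c y)) \<longleftrightarrow> (x, y) \<in> conn F" if "x \<in> verts G" "y \<in> verts G" for x y
    using \<phi>2[OF cV cV, OF that] conn1[of x y] conn2[of x "c y" y] that by blast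
  moreover have "{\<phi> (c x), \<phi> (c y)} \<in> edges H \<longleftrightarrow> (\<exists>x'\<in>verts G. \<exists>y'\<in>verts G.
        \<phi> (c x') = \<phi> (c x) \<and> \<phi> (c y') = \<phi> (c y) \<and> {x', y'} \<in> edges G)" (is "?L \<longleftrightarrow> ?R")
    if xy: "x \<in> verts G" "y \<in> verts G" "\<phi> (c x) \<noteq> \<phi> (c y)" for x y
  proof -
    have "?L \<longleftrightarrow> (\<exists>x'\<in>verts G1. \<exists>y'\<in>verts G1. \<phi> x' = \<phi> (c x) \<and> \<phi> y' = \<phi> (c y) \<and> {x', y'} \<in> edges G1)"
      by (rule \<phi>3[OF cV cV, OF xy])
    also have "\<dots> \<longleftrightarrow> ?R"
    proof
      assume "\<exists>x'\<in>verts G1. \<exists>y'\<in>verts G1. \<phi> x' = \<phi> (c x) \<and> \<phi> y' = \<phi> (c y) \<and> {x', y'} \<in> edges G1"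
      then obtain a b where ab: "\<phi> a = \<phi> (c x)" "\<phi> b = \<phi> (c y)" "{a, b} \<in> edges G1" by blast
      then have "a \<noteq> b" using xy(3) by auto
      then show ?R using ab E1[of a b] by metis
    next
      assume ?R
      then obtain x' y' where "x' \<in> verts G" "y' \<in> verts G" "\<phi> (c x') = \<phi> (c x)"
          "\<phi> (c y') = \<phi> (c y)" "{x', y'} \<in> edges G" by blast
      moreover from this have "c x' \<noteq> c y'" using xy(3) by auto
      ultimately show "\<exists>x'\<in>verts G1. \<exists>y'\<in>verts G1. \<phi> x' = \<phi> (c x) \<and> \<phi> y' = \<phi> (c y) \<and> {x', y'} \<in> edges G1"
        using E1[of "c x'" "c y'"] cV by metis
    qed
    finally show ?thesis .
  qed
  ultimately show ?case
    using sH \<phi>1 V1 unfolding contraction_map_def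
    by (intro conjI exI[of _ "\<phi> \<circ> c"]) (auto simp: image_comp)
qed

section \<open>Counting components\<close>

text \<open>The merge step of a union-find structure: a labelling of the components is updated by
  giving the class of \<open>v\<close> the label of \<open>u\<close>.\<close>

lemma conn_insert:
  fixes u v :: 'a
  assumes f: "\<And>x y. f x = f y \<longleftrightarrow> (x, y) \<in> conn F"
  defines "g \<equiv> (\<lambda>x. if f x = f v then f u else f x)"
  shows "g x = g y \<longleftrightarrow> (x, y) \<in> conn (insert {u, v} F)"
proof
  have sub: "(x, y) \<in> conn (insert {u, v} F)" if "f x = f y" for x y
    using that f conn_mono[of F "insert {u, v} F"] by blast
  have uv: "(u, v) \<in> conn (insert {u, v} F)" "(v, u) \<in> conn (insert {u, v} F)"
    by (auto intro: conn_edge conn_sym)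
  {
    assume "g x = g y"
    then consider "f x = f y" | "f x = f u" "f y = f v" | "f x = f v" "f y = f u"
      unfolding g_def by (metis (full_types))
    then show "(x, y) \<in> conn (insert {u, v} F)"
      by cases (metis sub uv conn_trans)+
  }
  {
    assume "(x, y) \<in> conn (insert {u, v} F)"
    then show "g x = g y"
    proof (induction rule: conn_induct)
      case (step y z)
      have "g y = g z"
      proof (cases "{y, z} \<in> F")
        case True
        then have "f y = f z" by (simp add: f conn_edge)
        then show ?thesis by (simp add: g_def)
      next
        case False
        then have "y = u \<and> z = v \<or> y = v \<and> z = u" using step(2) by (auto simp: doubleton_eq_iff)
        then show ?thesis by (auto simp: g_def)
      qed
      then show ?case using step by simp
    qed simp
  }
qed

lemma conn_insert_absorb: "(u, v) \<in> conn F \<Longrightarrow> conn (insert {u, v} F) = conn F"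
proof (intro set_eqI iffI)
  fix p assume uv: "(u, v) \<in> conn F" and "p \<in> conn (insert {u, v} F)"
  then have "(fst p, snd p) \<in> conn (insert {u, v} F)" by simp
  then have "(fst p, snd p) \<in> conn F"
  proof (induction rule: conn_induct)
    case (step y z)
    then have "{y, z} \<in> F \<or> y = u \<and> z = v \<or> y = v \<and> z = u" by (auto simp: doubleton_eq_iff)
    then show ?case using step(3) uv by (metis conn_edge conn_sym conn_trans)
  qed simp
  then show "p \<in> conn F" by simp
qed (use conn_mono[of F "insert {u, v} F"] in blast)

text \<open>Kruskal's argument: an edge is taken only if its ends lie in different classes of the
  edges treated so far, and it then lowers the number of classes by one. The labelling
  \<open>f\<close> is carried along so that the classes meeting \<open>V\<close> can be counted as
  its image on \<open>V\<close>.\<close>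

lemma spanning_forest:
  fixes V :: "'a set"
  assumes "finite M" "finite V" "\<forall>e\<in>M. \<exists>u v. e = {u, v} \<and> u \<in> V \<and> v \<in> V"
  shows "\<exists>F (f :: 'a \<Rightarrow> 'a). F \<subseteq> M \<and> conn F = conn M \<and> (\<forall>x y. f x = f y \<longleftrightarrow> (x, y) \<in> conn M)
    \<and> card F + card (f ` V) = card V"
  using assms
proof (induction M rule: finite_induct)
  case empty
  have "conn {} = (Id :: ('a \<times> 'a) set)" by (auto simp: conn_def)
  then show ?case by (intro exI[of _ "{}"] exI[of _ "\<lambda>x. x"]) simp
next
  case (insert e M)
  have "\<forall>e\<in>M. \<exists>u v. e = {u, v} \<and> u \<in> V \<and> v \<in> V" using insert.prems(2) by simp
  from insert.IH[OF insert.prems(1) this] obtain F and f :: "'a \<Rightarrow> 'a" where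
    "F \<subseteq> M \<and> conn F = conn M \<and> (\<forall>x y. f x = f y \<longleftrightarrow> (x, y) \<in> conn M) \<and> card F + card (f ` V) = card V"
    by blast
  then have IH: "F \<subseteq> M" "conn F = conn M" "\<And>x y. f x = f y \<longleftrightarrow> (x, y) \<in> conn M"
    "card F + card (f ` V) = card V" by simp_all
  obtain u v where e: "e = {u, v}" "u \<in> V" "v \<in> V" using insert.prems by blast
  show ?case
  proof (cases "(u, v) \<in> conn M")
    case True
    then show ?thesis using IH e by (intro exI[of _ F] exI[of _ f]) (auto simp: conn_insert_absorb)
  next
    case False
    define g where "g = (\<lambda>x. if f x = f v then f u else f x)"
    have g: "g x = g y \<longleftrightarrow> (x, y) \<in> conn (insert e M)" for x y
      unfolding g_def e using conn_insert[of f M] IH(3) by blast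
    have gF: "g x = g y \<longleftrightarrow> (x, y) \<in> conn (insert e F)" for x y
      unfolding g_def e using conn_insert[of f F] IH(2,3) by blast
    have "f u \<noteq> f v" using False IH(3) by simp
    then have "g ` V = f ` V - {f v}" using e by (auto simp: g_def image_iff)
    then have "card (g ` V) = card (f ` V) - 1" "card (f ` V) > 0"
      using e insert.prems(1) by (auto simp: card_gt_0_iff)
    moreover have "e \<notin> F" using IH(1) insert.hyps by blast
    then have "card (insert e F) = Suc (card F)"
      using IH(1) insert.hyps finite_subset by (metis card_insert_disjoint)
    moreover have "conn (insert e F) = conn (insert e M)" using g gF by auto
    ultimately show ?thesis
      using IH(1,4) g by (intro exI[of _ "insert e F"] exI[of _ g]) auto
  qed
qed

text \<open>The set of contracted edges may contain cycles; a spanning forest inside it gives the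
  inequality.\<close>

lemma card_le_edges_plus_components:
  assumes "finite F" "finite V" "\<forall>e\<in>F. \<exists>u v. e = {u, v} \<and> u \<in> V \<and> v \<in> V"
    and "\<And>x y. x \<in> V \<Longrightarrow> y \<in> V \<Longrightarrow> g x = g y \<longleftrightarrow> (x, y) \<in> conn F"
  shows "card V \<le> card F + card (g ` V)"
proof -
  from spanning_forest[OF assms(1-3)] obtain F' and f :: "'a \<Rightarrow> 'a" where
    "F' \<subseteq> F \<and> conn F' = conn F \<and> (\<forall>x y. f x = f y \<longleftrightarrow> (x, y) \<in> conn F) \<and> card F' + card (f ` V) = card V"
    by blast
  then have F': "F' \<subseteq> F" "\<And>x y. f x = f y \<longleftrightarrow> (x, y) \<in> conn F" "card F' + card (f ` V) = card V"
    by simp_all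
  have "card (f ` V) = card (g ` V)"
    by (intro card_image_cong) (simp add: F'(2) assms(4))
  moreover have "card F' \<le> card F" using F'(1) assms(1) by (rule card_mono[rotated])
  ultimately show ?thesis using F'(3) by simp
qed

section \<open>Bicliques as two-colourings\<close>

definition mono_edges :: "nat set set \<Rightarrow> (nat \<Rightarrow> bool) \<Rightarrow> nat set set" where
  "mono_edges E T = {e \<in> E. \<exists>u v. e = {u, v} \<and> T u = T v}"

definition component :: "nat set set \<Rightarrow> (nat \<Rightarrow> bool) \<Rightarrow> nat \<Rightarrow> nat set" where
  "component E T v = conn (mono_edges E T) `` {v}"

definition colour_class :: "nat \<Rightarrow> (nat \<Rightarrow> bool) \<Rightarrow> bool \<Rightarrow> nat set" where
  "colour_class n T b = {v. v < n \<and> T v = b}"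

definition ncomp :: "nat \<Rightarrow> nat set set \<Rightarrow> (nat \<Rightarrow> bool) \<Rightarrow> bool \<Rightarrow> nat" where
  "ncomp n E T b = card (component E T ` colour_class n T b)"

text \<open>In a contraction to a biclique with parts \<open>X\<close> and \<open>Y\<close>, the vertex sets that are contracted to
  single vertices of one part are connected and pairwise non-adjacent, hence they are the components
  of one colour class.  Each of them loses all vertices but one, which gives the bound on \<open>n\<close>.\<close>

definition sol :: "bool \<Rightarrow> nat \<Rightarrow> nat set set \<Rightarrow> nat \<Rightarrow> (nat \<Rightarrow> bool) \<Rightarrow> bool" where
  "sol bal n E k T \<longleftrightarrow> n \<le> k + ncomp n E T False + ncomp n E T True \<and>
     (\<forall>u<n. \<forall>v<n. T u \<noteq> T v \<longrightarrow> (\<exists>u'\<in>component E T u. \<exists>v'\<in>component E T v. {u', v'} \<in> E)) \<and>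
     (bal \<longrightarrow> ncomp n E T False = ncomp n E T True)"

lemma mono_edges_iff: "{u, v} \<in> mono_edges E T \<longleftrightarrow> {u, v} \<in> E \<and> T u = T v"
  by (auto simp: mono_edges_def doubleton_eq_iff)

lemma component_eq_iff: "component E T u = component E T v \<longleftrightarrow> (u, v) \<in> conn (mono_edges E T)"
  by (simp add: component_def conn_Image_eq_iff)

lemma in_component_iff: "v \<in> component E T u \<longleftrightarrow> (u, v) \<in> conn (mono_edges E T)"
  by (simp add: component_def)

lemma conn_mono_colour: "(u, v) \<in> conn (mono_edges E T) \<Longrightarrow> T u = T v"
  by (induction rule: conn_induct) (auto simp: mono_edges_iff)

lemma conn_mono_less:
  assumes "simple_graph ({..<n}, E)" "(u, v) \<in> conn (mono_edges E T)" "u < n"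
  shows "v < n"
  using assms(2,3)
  by (induction rule: conn_induct) (use assms(1) in \<open>auto simp: mono_edges_iff simple_graph_def\<close>)

lemma finite_edges: "simple_graph G \<Longrightarrow> finite (edges G)"
  unfolding simple_graph_def by (meson Pow_iff finite_Pow_iff finite_subset subsetI)

lemma simple_graph_ends:
  assumes "simple_graph G" "e \<in> edges G"
  shows "\<exists>u v. e = {u, v} \<and> u \<in> verts G \<and> v \<in> verts G \<and> u \<noteq> v"
proof -
  have "e \<subseteq> verts G" "card e = 2" using assms by (auto simp: simple_graph_def)
  then show ?thesis by (auto simp: card_2_iff)
qed

lemma biclique_sol:
  assumes G: "simple_graph ({..<n}, E)" and F: "F \<subseteq> E" "card F \<le> k" "contracts_to ({..<n}, E) F H"
    and XY: "biclique_parts H X Y" "bal \<longrightarrow> card X = card Y"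
  shows "\<exists>T. sol bal n E k T"
proof -
  let ?V = "{..<n}"
  obtain \<phi> where sH: "simple_graph H" and \<phi>: "contraction_map \<phi> (?V, E) F H"
    using contracts_to_quotient[OF F(3) G] F(1) by auto
  note \<phi>1 = contraction_mapD(1)[OF \<phi>, simplified fst_conv]
    and \<phi>2 = contraction_mapD(2)[OF \<phi>, simplified fst_conv]
    and \<phi>3 = contraction_mapD(3)[OF \<phi>, simplified fst_conv snd_conv]
  have H: "X \<union> Y = verts H" "X \<inter> Y = {}" "\<forall>e\<in>edges H. \<exists>x\<in>X. \<exists>y\<in>Y. e = {x, y}"
     "\<forall>x\<in>X. \<forall>y\<in>Y. {x, y} \<in> edges H" using XY(1) by (auto simp: biclique_parts_def)
  define T where "T = (\<lambda>v. \<phi> v \<in> Y)"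
  have inV: "x \<in> ?V \<and> y \<in> ?V" if "{x, y} \<in> E" for x y
    using simple_graph_ends[OF G, of "{x, y}"] that by (auto simp: doubleton_eq_iff)
  \<comment> \<open>Edges of \<open>H\<close> join \<open>X\<close> to \<open>Y\<close>, so an edge
    of \<open>E\<close> inside one colour cannot survive the contraction as an edge.\<close>
  have eq1: "\<phi> x = \<phi> y" if e: "{x, y} \<in> mono_edges E T" for x y
  proof (rule ccontr)
    assume ne: "\<phi> x \<noteq> \<phi> y"
    have "{x, y} \<in> E" "T x = T y" using e by (auto simp: mono_edges_iff)
    then have "{\<phi> x, \<phi> y} \<in> edges H" using \<phi>3[of x y] inV ne by blast
    then obtain a b where "a \<in> X" "b \<in> Y" "{\<phi> x, \<phi> y} = {a, b}" using H(3) by blast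
    then show False using \<open>T x = T y\<close> H(2) by (auto simp: T_def doubleton_eq_iff)
  qed
  have R1: "\<phi> x = \<phi> y" if "(x, y) \<in> conn (mono_edges E T)" for x y
    using that by (induction rule: conn_induct) (auto dest: eq1)
  have R2: "(x, y) \<in> conn (mono_edges E T)" if "(x, y) \<in> conn F" for x y
    using that
  proof (induction rule: conn_induct)
    case (step y z)
    have "{y, z} \<in> E" using step(2) F(1) by blast
    moreover have "T y = T z" using \<phi>2[of y z] inV[OF \<open>{y, z} \<in> E\<close>] conn_edge[OF step(2)] by (simp add: T_def)
    ultimately show ?case using step(3) by (metis conn_edge conn_trans mono_edges_iff)
  qed simp
  have R: "component E T x = component E T y \<longleftrightarrow> \<phi> x = \<phi> y" if "x < n" "y < n" for x y
    using R1[of x y] R2[of x y] \<phi>2[of x y] that by (auto simp: component_eq_iff)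
  have sub: "X \<subseteq> \<phi> ` ?V" "Y \<subseteq> \<phi> ` ?V" using H(1) \<phi>1 by auto
  have "\<phi> ` colour_class n T True = Y"
    unfolding colour_class_def T_def using sub(2) by force
  moreover have "\<phi> ` colour_class n T False = X"
  proof
    have "\<phi> v \<in> X" if "v < n" "\<phi> v \<notin> Y" for v
      using that \<phi>1 H(1) by (metis UnE imageI lessThan_iff)
    then show "\<phi> ` colour_class n T False \<subseteq> X" by (auto simp: colour_class_def T_def)
    show "X \<subseteq> \<phi> ` colour_class n T False"
      unfolding colour_class_def T_def using sub(1) H(2) by force
  qed
  moreover have "ncomp n E T b = card (\<phi> ` colour_class n T b)" for b
    unfolding ncomp_def by (rule card_image_cong) (auto simp: colour_class_def R)
  ultimately have nc: "ncomp n E T False = card X" "ncomp n E T True = card Y" by metis+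
  have "finite (verts H)" using sH by (simp add: simple_graph_def)
  then have "card (verts H) = card X + card Y"
    using H(1,2) by (metis card_Un_disjoint finite_Un)
  moreover have "card ?V \<le> card F + card (\<phi> ` ?V)"
  proof (rule card_le_edges_plus_components)
    show "finite F" using F(1) finite_edges[OF G] finite_subset by auto
    show "\<forall>e\<in>F. \<exists>u v. e = {u, v} \<and> u \<in> ?V \<and> v \<in> ?V" using simple_graph_ends[OF G] F(1) by fastforce
  qed (use \<phi>2 in auto)
  ultimately have "n \<le> k + card X + card Y" using \<phi>1 F(2) by simp
  moreover have "\<exists>u'\<in>component E T u. \<exists>v'\<in>component E T v. {u', v'} \<in> E" if uv: "u < n" "v < n" "T u \<noteq> T v" for u v
  proof -
    have ne: "\<phi> u \<noteq> \<phi> v" using uv(3) by (auto simp: T_def)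
    have "\<phi> u \<in> X \<and> \<phi> v \<in> Y \<or> \<phi> u \<in> Y \<and> \<phi> v \<in> X"
      using uv \<phi>1 H(1) unfolding T_def by blast
    then have "{\<phi> u, \<phi> v} \<in> edges H" using H(4) by (metis insert_commute)
    then obtain x' y' where "x' < n" "y' < n" "\<phi> x' = \<phi> u" "\<phi> y' = \<phi> v" "{x', y'} \<in> E"
      using \<phi>3[of u v] uv ne by auto
    then show ?thesis using R uv by (metis component_eq_iff in_component_iff)
  qed
  ultimately have "sol bal n E k T" using nc XY(2) by (simp add: sol_def)
  then show ?thesis by blast
qed

text \<open>The edges to contract are a spanning forest of the monochromatic edges. It has
  \<open>n\<close> minus the number of components many edges, which is exactly what
  \<open>sol\<close> bounds by \<open>k\<close>.\<close>

lemma sol_biclique: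
  assumes G: "simple_graph ({..<n}, E)" and T: "sol bal n E k T"
  shows "\<exists>F H X Y. F \<subseteq> E \<and> card F \<le> k \<and> contracts_to ({..<n}, E) F H \<and> biclique_parts H X Y \<and>
    (bal \<longrightarrow> card X = card Y)"
proof -
  let ?V = "{..<n}"
  have ends: "\<exists>u v. e = {u, v} \<and> u \<in> ?V \<and> v \<in> ?V" if "e \<in> E" for e
    using simple_graph_ends[OF G, of e] that by auto
  have "finite (mono_edges E T)" using finite_edges[OF G] by (simp add: mono_edges_def)
  moreover have "\<forall>e\<in>mono_edges E T. \<exists>u v. e = {u, v} \<and> u \<in> ?V \<and> v \<in> ?V"
    using ends by (simp add: mono_edges_def)
  ultimately have *: "finite (mono_edges E T)"
    "\<forall>e\<in>mono_edges E T. \<exists>u v. e = {u, v} \<and> u \<in> ?V \<and> v \<in> ?V" .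
  from spanning_forest[OF *(1) finite_lessThan *(2)] obtain F and f :: "nat \<Rightarrow> nat" where "F \<subseteq> mono_edges E T \<and> conn F = conn (mono_edges E T)
      \<and> (\<forall>x y. f x = f y \<longleftrightarrow> (x, y) \<in> conn (mono_edges E T)) \<and> card F + card (f ` ?V) = card ?V"
    by blast
  then have F: "F \<subseteq> mono_edges E T" "conn F = conn (mono_edges E T)"
    "\<And>x y. f x = f y \<longleftrightarrow> (x, y) \<in> conn (mono_edges E T)" "card F + card (f ` ?V) = card ?V"
    by simp_all
  have FE: "F \<subseteq> E" using F(1) by (auto simp: mono_edges_def)
  obtain H where H: "contracts_to (?V, E) F H" using contracts_to_exists[OF G, of F] FE by (metis snd_conv)
  obtain \<phi> where sH: "simple_graph H" and \<phi>: "contraction_map \<phi> (?V, E) F H"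
    using contracts_to_quotient[OF H G] FE by auto
  note \<phi>1 = contraction_mapD(1)[OF \<phi>, simplified fst_conv]
    and \<phi>2 = contraction_mapD(2)[OF \<phi>, simplified fst_conv]
    and \<phi>3 = contraction_mapD(3)[OF \<phi>, simplified fst_conv snd_conv]
  define X Y where "X = \<phi> ` colour_class n T False" and "Y = \<phi> ` colour_class n T True"
  have V: "colour_class n T False \<union> colour_class n T True = ?V" by (auto simp: colour_class_def)
  have eqT: "T u = T v" if "\<phi> u = \<phi> v" "u < n" "v < n" for u v
    using \<phi>2[of u v] F(2) that conn_mono_colour by auto
  have XY: "X \<inter> Y = {}" unfolding X_def Y_def using eqT by (auto simp: colour_class_def)
  have V2: "X \<union> Y = verts H" 
    unfolding X_def Y_def \<phi>1[symmetric] image_Un[symmetric] V ..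
  have "\<exists>x\<in>X. \<exists>y\<in>Y. e = {x, y}" if e: "e \<in> edges H" for e
  proof -
    obtain a b where ab: "e = {a, b}" "a \<in> verts H" "b \<in> verts H" "a \<noteq> b"
      using simple_graph_ends[OF sH e] by blast
    obtain u v where uv: "u < n" "v < n" "\<phi> u = a" "\<phi> v = b" using ab(2,3) unfolding \<phi>1[symmetric] by auto
    then obtain u' v' where *: "u' < n" "v' < n" "\<phi> u' = a" "\<phi> v' = b" "{u', v'} \<in> E"
      using \<phi>3[of u v] ab e by auto
    have "T u' \<noteq> T v'"
    proof
      assume "T u' = T v'"
      then have "(u', v') \<in> conn F" using *(5) F(2) by (simp add: conn_edge mono_edges_iff)
      then show False using \<phi>2[of u' v'] * ab(4) by auto
    qed
    then have "a \<in> X \<and> b \<in> Y \<or> a \<in> Y \<and> b \<in> X"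
      unfolding X_def Y_def colour_class_def using * by fastforce
    then show ?thesis using ab(1) by (metis insert_commute)
  qed
  moreover have "{x, y} \<in> edges H" if xy: "x \<in> X" "y \<in> Y" for x y
  proof -
    obtain u v where uv: "x = \<phi> u" "y = \<phi> v" "u < n" "v < n" "T u \<noteq> T v"
      using xy by (auto simp: X_def Y_def colour_class_def)
    have "\<exists>u'\<in>component E T u. \<exists>v'\<in>component E T v. {u', v'} \<in> E"
      using T uv(3-5) unfolding sol_def by simp
    then obtain u' v' where *: "(u, u') \<in> conn F" "(v, v') \<in> conn F" "{u', v'} \<in> E"
      unfolding in_component_iff F(2) Bex_def
      by (elim exE conjE) (rule that, simp_all only: F(2))
    have "u' < n" "v' < n"
      using *(1,2) uv(3,4) unfolding F(2) by (blast intro: conn_mono_less[OF G])+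
    then have "\<phi> u = \<phi> u'" "\<phi> v = \<phi> v'" using * \<phi>2 uv by auto
    moreover have "\<phi> u \<noteq> \<phi> v" using eqT uv by blast
    ultimately show ?thesis
      using \<phi>3[of u v] uv *(3) \<open>u' < n\<close> \<open>v' < n\<close> by auto
  qed
  ultimately have bp: "biclique_parts H X Y" using XY V2 by (auto simp: biclique_parts_def)
  have nc: "ncomp n E T b = card (\<phi> ` colour_class n T b)" for b
    unfolding ncomp_def by (rule card_image_cong) (auto simp: colour_class_def component_eq_iff \<phi>2 F(2))
  have "card (f ` ?V) = card (\<phi> ` ?V)"
    by (rule card_image_cong) (use \<phi>2 F(2,3) in auto)
  moreover have "card (\<phi> ` ?V) = card X + card Y"
    using V2 XY \<phi>1 sH unfolding simple_graph_def by (metis card_Un_disjoint finite_Un)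
  ultimately have "card F \<le> k" using F(4) T nc unfolding sol_def X_def Y_def by simp
  moreover have "bal \<longrightarrow> card X = card Y" using T nc unfolding sol_def X_def Y_def by simp
  ultimately show ?thesis using FE H bp by blast
qed

lemma contraction_iff_sol:
  assumes "simple_graph ({..<n}, E)"
  shows "biclique_contraction ({..<n}, E) k \<longleftrightarrow> (\<exists>T. sol False n E k T)"
    and "balanced_biclique_contraction ({..<n}, E) k \<longleftrightarrow> (\<exists>T. sol True n E k T)"
proof -
  show "biclique_contraction ({..<n}, E) k \<longleftrightarrow> (\<exists>T. sol False n E k T)"
  proof
    assume "biclique_contraction ({..<n}, E) k"
    then obtain F H X Y where "F \<subseteq> E" "card F \<le> k" "contracts_to ({..<n}, E) F H" "biclique_parts H X Y"
      by (auto simp: biclique_contraction_def biclique_def)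
    from biclique_sol[OF assms this] show "\<exists>T. sol False n E k T" by simp
  next
    assume "\<exists>T. sol False n E k T"
    then obtain T where "sol False n E k T" ..
    from sol_biclique[OF assms this] show "biclique_contraction ({..<n}, E) k"
      unfolding biclique_contraction_def biclique_def snd_conv by metis
  qed
  show "balanced_biclique_contraction ({..<n}, E) k \<longleftrightarrow> (\<exists>T. sol True n E k T)"
  proof
    assume "balanced_biclique_contraction ({..<n}, E) k"
    then obtain F H X Y where "F \<subseteq> E" "card F \<le> k" "contracts_to ({..<n}, E) F H" "biclique_parts H X Y"
        "card X = card Y"
      by (auto simp: balanced_biclique_contraction_def balanced_biclique_def)
    from biclique_sol[OF assms this(1-4)] this(5) show "\<exists>T. sol True n E k T" by simp
  next
    assume "\<exists>T. sol True n E k T"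
    then obtain T where "sol True n E k T" ..
    from sol_biclique[OF assms this] show "balanced_biclique_contraction ({..<n}, E) k"
      unfolding balanced_biclique_contraction_def balanced_biclique_def snd_conv by metis
  qed
qed

section \<open>Programs with bounded loops\<close>

text \<open>A loop runs its counter from 0 up to the value of a variable. Every program then denotes
  a total function on memories, and its cost is governed by its loop bounds.\<close>

datatype fprog =
    FSkip
  | FAssign string aexp aexp
  | FSeq fprog fprog (infixr ";;" 65)
  | FCond bexp fprog fprog
  | FFor string string fprog

abbreviation V :: "string \<Rightarrow> aexp" where "V x \<equiv> Cell x (Const 0)"

primrec compile :: "fprog \<Rightarrow> prog" where
  "compile FSkip = Skip"
| "compile (FAssign x a b) = Assign x a b"
| "compile (FSeq p q) = Seq (compile p) (compile q)"
| "compile (FCond b p q) = Cond b (compile p) (compile q)"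
| "compile (FFor x y p) = Seq (Assign x (Const 0) (Const 0))
     (Loop (Less (V x) (V y)) (Seq (compile p) (Assign x (Const 0) (Plus (V x) (Const 1)))))"

definition upd :: "mem \<Rightarrow> string \<Rightarrow> nat \<Rightarrow> nat \<Rightarrow> mem" where
  "upd s x i a = s(x := (s x)(i := a))"

lemma upd_apply [simp]: "upd s x i a z j = (if z = x \<and> j = i then a else s z j)"
  by (simp add: upd_def)

lemma upd_other: "z \<noteq> x \<Longrightarrow> upd s x i a z = s z"
  by (simp add: upd_def)

text \<open>The final update of \<open>x\<close> is the value that the compiled loop leaves in its
  counter, so that \<open>den\<close> and \<open>exec\<close> agree on the whole memory.\<close>

primrec den :: "fprog \<Rightarrow> mem \<Rightarrow> mem" where
  "den FSkip s = s"
| "den (FAssign x a b) s = upd s x (aval a s) (aval b s)"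
| "den (FSeq p q) s = den q (den p s)"
| "den (FCond b p q) s = (if bval b s then den p s else den q s)"
| "den (FFor x y p) s = upd (fold (\<lambda>i s. den p (upd s x 0 i)) [0..<s y 0] s) x 0 (s y 0)"

declare den.simps [simp del]

lemma den_simps [simp]:
  "den FSkip s = s"
  "den (FAssign x a b) s = upd s x (aval a s) (aval b s)"
  "den (FSeq p q) s = den q (den p s)"
  "den (FCond c p q) s = (if bval c s then den p s else den q s)"
  by (simp_all only: den.simps)

lemma den_For: "den (FFor x y p) s = upd (fold (\<lambda>i s. den p (upd s x 0 i)) [0..<s y 0] s) x 0 (s y 0)"
  by (simp only: den.simps)

primrec asg :: "fprog \<Rightarrow> string set" where
  "asg FSkip = {}"
| "asg (FAssign x a b) = {x}"
| "asg (FSeq p q) = asg p \<union> asg q"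
| "asg (FCond b p q) = asg p \<union> asg q"
| "asg (FFor x y p) = insert x (asg p)"

primrec bounds :: "fprog \<Rightarrow> string set" where
  "bounds FSkip = {}"
| "bounds (FAssign x a b) = {}"
| "bounds (FSeq p q) = bounds p \<union> bounds q"
| "bounds (FCond b p q) = bounds p \<union> bounds q"
| "bounds (FFor x y p) = insert y (bounds p)"

primrec wf_loops :: "fprog \<Rightarrow> bool" where
  "wf_loops FSkip = True"
| "wf_loops (FAssign x a b) = True"
| "wf_loops (FSeq p q) = (wf_loops p \<and> wf_loops q)"
| "wf_loops (FCond b p q) = (wf_loops p \<and> wf_loops q)"
| "wf_loops (FFor x y p) = (x \<notin> asg p \<and> wf_loops p)"

text \<open>The argument \<open>e\<close> supplies the values of the loop bounds. Both branches of a
  conditional are charged, which makes the cost independent of the rest of the memory.\<close>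

primrec tcost :: "fprog \<Rightarrow> (string \<Rightarrow> nat) \<Rightarrow> nat" where
  "tcost FSkip e = 1"
| "tcost (FAssign x a b) e = 1"
| "tcost (FSeq p q) e = tcost p e + tcost q e"
| "tcost (FCond b p q) e = 1 + tcost p e + tcost q e"
| "tcost (FFor x y p) e = 2 + e y * (tcost p e + 2)"

lemma fold_frame:
  assumes "\<And>i s. i \<in> set xs \<Longrightarrow> f i s z = s z"
  shows "fold f xs s z = (s z :: 'b)"
  using assms by (induction xs arbitrary: s) auto

lemma den_frame: "z \<notin> asg p \<Longrightarrow> den p s z = s z"
proof (induction p arbitrary: s)
  case (FFor x y p)
  then show ?case by (simp add: den_For upd_other fold_frame)
qed (auto simp: upd_other)

lemma exec_loop:
  assumes "i \<le> N" "s x 0 = i" "s y 0 = N" "x \<noteq> y" "x \<notin> asg p" "y \<notin> asg p" "Q s"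
    and body: "\<And>s. s y 0 = N \<Longrightarrow> Q s \<Longrightarrow> \<exists>t. exec (compile p) s t (den p s) \<and> t \<le> c"
    and Q: "\<And>s i. Q s \<Longrightarrow> Q (upd (den p s) x 0 i)"
  shows "\<exists>t. exec (Loop (Less (V x) (V y)) (Seq (compile p) (Assign x (Const 0) (Plus (V x) (Const 1))))) s t
           (upd (fold (\<lambda>i s. den p (upd s x 0 i)) [i..<N] s) x 0 N) \<and> t \<le> 1 + (N - i) * (c + 2)"
  using assms(1-3,7)
proof (induction "N - i" arbitrary: i s)
  case 0
  then have "\<not> bval (Less (V x) (V y)) s" "i = N" by auto
  moreover have "upd s x 0 N = s" using 0 by (auto simp: upd_def)
  ultimately show ?case using exec.LoopF[of "Less (V x) (V y)" s] by auto
next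
  case (Suc d)
  then have lt: "i < N" by simp
  have s_eq: "upd s x 0 i = s" using Suc.prems by (auto simp: upd_def)
  obtain t where t: "exec (compile p) s t (den p s)" "t \<le> c"
    using body Suc.prems by blast
  define s1 where "s1 = upd (den p s) x 0 (Suc i)"
  have dx: "den p s x 0 = i" using den_frame[OF assms(5)] Suc.prems by simp
  have "exec (Assign x (Const 0) (Plus (V x) (Const 1))) (den p s) 1 s1"
    using exec.Assign[of x "Const 0" "Plus (V x) (Const 1)" "den p s"] dx by (simp add: s1_def upd_def)
  then have b: "exec (Seq (compile p) (Assign x (Const 0) (Plus (V x) (Const 1)))) s (t + 1) s1"
    using t(1) by (rule exec.Seq[rotated])
  have "s1 y 0 = N" using assms(4) den_frame[OF assms(6)] Suc.prems by (simp add: s1_def)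
  moreover have "s1 x 0 = Suc i" "Q s1" using Q Suc.prems by (simp_all add: s1_def)
  moreover have "d = N - Suc i" "Suc i \<le> N" using Suc.hyps(2) lt by auto
  ultimately obtain t' where t': "exec (Loop (Less (V x) (V y)) (Seq (compile p) (Assign x (Const 0) (Plus (V x) (Const 1))))) s1 t'
           (upd (fold (\<lambda>i s. den p (upd s x 0 i)) [Suc i..<N] s1) x 0 N)" "t' \<le> 1 + (N - Suc i) * (c + 2)"
    using Suc.hyps(1)[of "Suc i" s1] by blast
  have "upd s1 x 0 j = upd (den p s) x 0 j" for j by (auto simp: s1_def upd_def)
  then have "upd (fold (\<lambda>i s. den p (upd s x 0 i)) [Suc i..<N] s1) x 0 N
     = upd (fold (\<lambda>i s. den p (upd s x 0 i)) [i..<N] s) x 0 N"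
    using lt s_eq by (cases "Suc i < N") (simp_all add: upt_conv_Cons)
  moreover have "bval (Less (V x) (V y)) s" using Suc.prems lt by simp
  ultimately have "exec (Loop (Less (V x) (V y)) (Seq (compile p) (Assign x (Const 0) (Plus (V x) (Const 1))))) s (1 + (t + 1) + t')
     (upd (fold (\<lambda>i s. den p (upd s x 0 i)) [i..<N] s) x 0 N)"
    using exec.LoopT[OF _ b t'(1)] by simp
  moreover have "1 + (t + 1) + t' \<le> 1 + (N - i) * (c + 2)"
  proof -
    have "N - i = Suc (N - Suc i)" using lt by simp
    then show ?thesis using t(2) t'(2) by simp
  qed
  ultimately show ?case by blast
qed

text \<open>The disjointness of \<open>bounds p\<close> and \<open>asg p\<close> keeps every loop
  bound at its initial value during the whole run, so \<open>tcost\<close> can be evaluated before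
  the run starts.\<close>

lemma exec_compile:
  assumes "wf_loops p" "bounds p \<inter> asg p = {}" "\<And>y. y \<in> bounds p \<Longrightarrow> s y 0 = e y"
  shows "\<exists>t. exec (compile p) s t (den p s) \<and> t \<le> tcost p e"
  using assms
proof (induction p arbitrary: s)
  case FSkip
  then show ?case using exec.Skip by auto
next
  case (FAssign x a b)
  show ?case unfolding compile.simps den_simps upd_def tcost.simps
    by (intro exI[of _ 1] conjI exec.Assign order_refl)
next
  case (FSeq p q)
  obtain t where t: "exec (compile p) s t (den p s)" "t \<le> tcost p e"
    using FSeq.IH(1)[of s] FSeq.prems by auto
  have "den p s y 0 = e y" if "y \<in> bounds q" for y
  proof -
    have "y \<notin> asg p" using FSeq.prems(2) that by auto
    then show ?thesis using FSeq.prems(3)[of y] that by (simp add: den_frame)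
  qed
  then obtain t' where "exec (compile q) (den p s) t' (den q (den p s))" "t' \<le> tcost q e"
    using FSeq.IH(2)[of "den p s"] FSeq.prems by auto
  then show ?case using t exec.Seq[OF t(1)] by (fastforce intro!: exI[of _ "t + t'"])
next
  case (FCond b p q)
  show ?case
  proof (cases "bval b s")
    case True
    obtain t where "exec (compile p) s t (den p s)" "t \<le> tcost p e"
      using FCond.IH(1)[of s] FCond.prems by auto
    then show ?thesis using True exec.CondT[of b s "compile p" t "den p s" "compile q"]
      by (fastforce intro!: exI[of _ "1 + t"])
  next
    case False
    obtain t where "exec (compile q) s t (den q s)" "t \<le> tcost q e"
      using FCond.IH(2)[of s] FCond.prems by auto
    then show ?thesis using False exec.CondF[of b s "compile q" t "den q s" "compile p"]
      by (fastforce intro!: exI[of _ "1 + t"])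
  qed
next
  case (FFor x y p)
  let ?s = "upd s x 0 0"
  let ?Q = "\<lambda>s. \<forall>z\<in>bounds p. s z 0 = e z"
  have xy: "x \<noteq> y" "x \<notin> asg p" "y \<notin> asg p" using FFor.prems by auto
  have Q: "?Q (upd (den p s) x 0 i)" if "?Q s" for s i
  proof
    fix z assume z: "z \<in> bounds p"
    then have "z \<notin> asg p" "z \<noteq> x" using FFor.prems(2) by auto
    then show "upd (den p s) x 0 i z 0 = e z" using that z by (simp add: den_frame)
  qed
  have body: "\<exists>t. exec (compile p) s t (den p s) \<and> t \<le> tcost p e" if "?Q s" for s
    using FFor.IH[of s] FFor.prems that by auto
  have s0: "?s x 0 = 0" "?s y 0 = e y" "?Q ?s"
    using xy FFor.prems by auto
  obtain t where t: "exec (Loop (Less (V x) (V y)) (Seq (compile p) (Assign x (Const 0) (Plus (V x) (Const 1))))) ?s t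
           (upd (fold (\<lambda>i s. den p (upd s x 0 i)) [0..<e y] ?s) x 0 (e y))" "t \<le> 1 + (e y - 0) * (tcost p e + 2)"
    using exec_loop[where Q = ?Q and s = ?s and i = 0 and x = x and y = y and p = p and c = "tcost p e",
        OF le0 s0(1,2) xy s0(3)] body Q by blast
  have "upd ?s x 0 j = upd s x 0 j" for j by (auto simp: upd_def)
  then have "upd (fold (\<lambda>i s. den p (upd s x 0 i)) [0..<e y] ?s) x 0 (e y) = den (FFor x y p) s"
    using FFor.prems by (cases "e y = 0") (simp_all add: den_For upt_conv_Cons)
  then have "exec (compile (FFor x y p)) s (1 + t) (den (FFor x y p) s)"
    using t(1) exec.Seq[OF exec.Assign[of x "Const 0" "Const 0" s]] by (simp add: upd_def)
  then show ?case using t(2) by (intro exI[of _ "1 + t"] conjI) simp_all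
qed

section \<open>Running times read off from the syntax of a program\<close>

primrec loop_depth :: "fprog \<Rightarrow> nat" where
  "loop_depth FSkip = 0"
| "loop_depth (FAssign x a b) = 0"
| "loop_depth (FSeq p q) = max (loop_depth p) (loop_depth q)"
| "loop_depth (FCond b p q) = max (loop_depth p) (loop_depth q)"
| "loop_depth (FFor x y p) = Suc (loop_depth p)"

text \<open>The weight of a loop bound is the exponent of the exponential factor in that bound.\<close>

primrec weight :: "(string \<Rightarrow> nat) \<Rightarrow> fprog \<Rightarrow> nat" where
  "weight w FSkip = 0"
| "weight w (FAssign x a b) = 0"
| "weight w (FSeq p q) = max (weight w p) (weight w q)"
| "weight w (FCond b p q) = max (weight w p) (weight w q)"
| "weight w (FFor x y p) = w y + weight w p"

text \<open>Nested loops multiply their bounds and everything else takes a maximum, so the nesting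
  depth becomes the degree in \<open>P\<close> and the sum of the weights along a nest the degree in
  \<open>X\<close>. With \<open>X = 2 ^ k\<close> the exponential base of the running time is a
  syntactic quantity of the program.\<close>

lemma tcost_bound:
  "\<exists>C. \<forall>P X e. P \<ge> 1 \<longrightarrow> X \<ge> 1 \<longrightarrow> (\<forall>y\<in>bounds p. e y \<le> P * X ^ w y) \<longrightarrow>
     tcost p e \<le> C * P ^ loop_depth p * X ^ weight w p"
proof (induction p)
  case (FSeq p q)
  then obtain C D where C: "\<And>P X e. P \<ge> 1 \<Longrightarrow> X \<ge> 1 \<Longrightarrow> (\<forall>y\<in>bounds p. e y \<le> P * X ^ w y) \<Longrightarrow>
     tcost p e \<le> C * P ^ loop_depth p * X ^ weight w p"
   and D: "\<And>P X e. P \<ge> 1 \<Longrightarrow> X \<ge> 1 \<Longrightarrow> (\<forall>y\<in>bounds q. e y \<le> P * X ^ w y) \<Longrightarrow>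
     tcost q e \<le> D * P ^ loop_depth q * X ^ weight w q" by metis
  have "tcost (p ;; q) e \<le> (C + D) * P ^ loop_depth (p ;; q) * X ^ weight w (p ;; q)"
    if PX: "P \<ge> 1" "X \<ge> 1" "\<forall>y\<in>bounds (p ;; q). e y \<le> P * X ^ w y" for P X e
  proof -
    have "C * P ^ loop_depth p * X ^ weight w p \<le> C * P ^ loop_depth (p ;; q) * X ^ weight w (p ;; q)"
      "D * P ^ loop_depth q * X ^ weight w q \<le> D * P ^ loop_depth (p ;; q) * X ^ weight w (p ;; q)"
      using PX by (auto intro!: mult_mono power_increasing)
    moreover have "tcost p e \<le> C * P ^ loop_depth p * X ^ weight w p" "tcost q e \<le> D * P ^ loop_depth q * X ^ weight w q"
      using C D PX by auto
    ultimately show ?thesis unfolding tcost.simps add_mult_distrib by linarith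
  qed
  then show ?case by blast
next
  case (FCond b p q)
  then obtain C D where C: "\<And>P X e. P \<ge> 1 \<Longrightarrow> X \<ge> 1 \<Longrightarrow> (\<forall>y\<in>bounds p. e y \<le> P * X ^ w y) \<Longrightarrow>
     tcost p e \<le> C * P ^ loop_depth p * X ^ weight w p"
   and D: "\<And>P X e. P \<ge> 1 \<Longrightarrow> X \<ge> 1 \<Longrightarrow> (\<forall>y\<in>bounds q. e y \<le> P * X ^ w y) \<Longrightarrow>
     tcost q e \<le> D * P ^ loop_depth q * X ^ weight w q" by metis
  let ?r = "FCond b p q"
  have "tcost ?r e \<le> (1 + C + D) * P ^ loop_depth ?r * X ^ weight w ?r"
    if PX: "P \<ge> 1" "X \<ge> 1" "\<forall>y\<in>bounds ?r. e y \<le> P * X ^ w y" for P X e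
  proof -
    have "C * P ^ loop_depth p * X ^ weight w p \<le> C * P ^ loop_depth ?r * X ^ weight w ?r"
      "D * P ^ loop_depth q * X ^ weight w q \<le> D * P ^ loop_depth ?r * X ^ weight w ?r"
      using PX by (auto intro!: mult_mono power_increasing)
    moreover have "tcost p e \<le> C * P ^ loop_depth p * X ^ weight w p" "tcost q e \<le> D * P ^ loop_depth q * X ^ weight w q"
      using C D PX by auto
    moreover have "1 \<le> 1 * P ^ loop_depth ?r * X ^ weight w ?r" using PX by simp
    ultimately show ?thesis unfolding tcost.simps add_mult_distrib by linarith
  qed
  then show ?case by blast
next
  case (FFor x y p)
  then obtain C where C: "\<And>P X e. P \<ge> 1 \<Longrightarrow> X \<ge> 1 \<Longrightarrow> (\<forall>y\<in>bounds p. e y \<le> P * X ^ w y) \<Longrightarrow>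
     tcost p e \<le> C * P ^ loop_depth p * X ^ weight w p" by metis
  let ?r = "FFor x y p"
  have "tcost ?r e \<le> (4 + C) * P ^ loop_depth ?r * X ^ weight w ?r"
    if PX: "P \<ge> 1" "X \<ge> 1" "\<forall>y\<in>bounds ?r. e y \<le> P * X ^ w y" for P X e
  proof -
    let ?A = "P ^ loop_depth p * X ^ weight w p"
    have "?A \<ge> 1" using PX by simp
    have "tcost p e \<le> C * ?A" using C[of P X e] PX by (simp add: mult.assoc)
    then have "tcost p e + 2 \<le> (C + 2) * ?A" using \<open>?A \<ge> 1\<close> unfolding add_mult_distrib by linarith
    then have "e y * (tcost p e + 2) \<le> (P * X ^ w y) * ((C + 2) * ?A)"
      using PX by (intro mult_mono) auto
    moreover have "2 \<le> 2 * ((P * X ^ w y) * ?A)" using \<open>?A \<ge> 1\<close> PX by simp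
    moreover have "(P * X ^ w y) * ((C + 2) * ?A) + 2 * ((P * X ^ w y) * ?A)
        = (4 + C) * P ^ loop_depth ?r * X ^ weight w ?r"
      by (simp add: algebra_simps power_add)
    ultimately show ?thesis unfolding tcost.simps by linarith
  qed
  then show ?case by blast
qed (auto intro!: exI[of _ 1])

section \<open>Proof rules for bounded loops\<close>

lemma den_For_induct:
  assumes "I 0 s"
    and "\<And>i s'. i < s y 0 \<Longrightarrow> I i s' \<Longrightarrow> (\<And>z. z \<notin> insert x (asg p) \<Longrightarrow> s' z = s z) \<Longrightarrow>
        I (Suc i) (den p (upd s' x 0 i))"
    and "\<And>s'. I (s y 0) s' \<Longrightarrow> (\<And>z. z \<notin> insert x (asg p) \<Longrightarrow> s' z = s z) \<Longrightarrow> Q (upd s' x 0 (s y 0))"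
  shows "Q (den (FFor x y p) s)"
proof -
  define f where "f = (\<lambda>i s. den p (upd s x 0 i))"
  have "I j (fold f [0..<j] s) \<and> (\<forall>z. z \<notin> insert x (asg p) \<longrightarrow> fold f [0..<j] s z = s z)" if "j \<le> s y 0" for j
    using that
  proof (induction j)
    case (Suc j)
    then show ?case using assms(2)[of j "fold f [0..<j] s"]
      by (auto simp: f_def den_frame upd_other)
  qed (use assms(1) in auto)
  then show ?thesis using assms(3)[of "fold f [0..<s y 0] s"] by (simp add: f_def den_For)
qed

text \<open>The shape of an exhaustive search: \<open>J\<close> survives every round, round
  \<open>i\<close> succeeds, and success \<open>G\<close> is never lost again.\<close>

lemma den_For_hit:
  assumes "J s" "i < s y 0"
    and "\<And>i s'. J s' \<Longrightarrow> (\<And>z. z \<notin> insert x (asg p) \<Longrightarrow> s' z = s z) \<Longrightarrow> J (den p (upd s' x 0 i))"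
    and "\<And>i s'. G s' \<Longrightarrow> G (den p (upd s' x 0 i))"
    and "\<And>s'. J s' \<Longrightarrow> (\<And>z. z \<notin> insert x (asg p) \<Longrightarrow> s' z = s z) \<Longrightarrow> G (den p (upd s' x 0 i))"
    and "\<And>s' j. G s' \<Longrightarrow> G (upd s' x 0 j)"
  shows "G (den (FFor x y p) s)"
proof (rule den_For_induct[where I = "\<lambda>j s'. J s' \<and> (i < j \<longrightarrow> G s')"])
  fix j s' assume *: "J s' \<and> (i < j \<longrightarrow> G s')" "\<And>z. z \<notin> insert x (asg p) \<Longrightarrow> s' z = s z"
  show "J (den p (upd s' x 0 j)) \<and> (i < Suc j \<longrightarrow> G (den p (upd s' x 0 j)))"
    using assms(3)[of s' j] assms(4)[of s' j] assms(5)[of s'] * by (cases "i = j") auto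
next
  fix s' assume "J s' \<and> (i < s y 0 \<longrightarrow> G s')"
  then show "G (upd s' x 0 (s y 0))" using assms(2) by (intro assms(6)) blast
qed (use assms(1) in simp)

lemma den_For_flag:
  assumes "\<And>i s'. i < s y 0 \<Longrightarrow> (\<And>z. z \<notin> insert x (asg p) \<Longrightarrow> s' z = s z) \<Longrightarrow>
      den p (upd s' x 0 i) f 0 = (if \<phi> i then a else s' f 0)" "x \<noteq> f"
  shows "den (FFor x y p) s f 0 = (if \<exists>i<s y 0. \<phi> i then a else s f 0)"
proof (rule den_For_induct[where I = "\<lambda>j s'. s' f 0 = (if \<exists>i<j. \<phi> i then a else s f 0)"])
  fix i s' assume "i < s y 0" "s' f 0 = (if \<exists>j<i. \<phi> j then a else s f 0)"
    "\<And>z. z \<notin> insert x (asg p) \<Longrightarrow> s' z = s z"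
  then show "den p (upd s' x 0 i) f 0 = (if \<exists>j<Suc i. \<phi> j then a else s f 0)"
    using assms(1)[of i s'] by (auto simp: less_Suc_eq)
qed (use assms(2) in auto)

definition Eq :: "aexp \<Rightarrow> aexp \<Rightarrow> bexp" where
  "Eq a b = Conj (Neg (Less a b)) (Neg (Less b a))"

lemma bval_Eq [simp]: "bval (Eq a b) s \<longleftrightarrow> aval a s = aval b s"
  by (auto simp: Eq_def)

section \<open>Checking a colouring\<close>

definition env_vars :: "string set" where
  "env_vars = {''in'', ''n'', ''n1'', ''nn'', ''k'', ''k1'', ''m'', ''L'', ''K'', ''pw'', ''mul''}"

text \<open>Row \<open>n\<close> of the adjacency matrix lies beyond the input and is therefore read as zero: it serves
  as the neighbourhood of a dummy vertex \<open>n\<close>.\<close>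

definition env :: "nat \<Rightarrow> nat set set \<Rightarrow> nat \<Rightarrow> mem \<Rightarrow> bool" where
  "env n E k s \<longleftrightarrow> simple_graph ({..<n}, E) \<and>
     s ''n'' 0 = n \<and> s ''n1'' 0 = n + 1 \<and> s ''nn'' 0 = n * n \<and> s ''k'' 0 = k \<and> s ''k1'' 0 = k + 1 \<and>
     s ''m'' 0 = 4 * k + 1 \<and> s ''L'' 0 = 2 ^ (4 * k + 1) \<and> s ''K'' 0 = 2 ^ (k + 1) \<and>
     (\<forall>i\<le>4 * k + 1. s ''pw'' i = 2 ^ i) \<and> (\<forall>i<n + 1 + 2 ^ (k + 1). s ''mul'' i = i * n) \<and>
     (\<forall>u\<le>n. \<forall>v<n. s ''in'' (2 + (u * n + v)) = of_bool ({u, v} \<in> E))"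

lemma env_frame:
  assumes "env n E k s" "\<And>z. z \<notin> A \<Longrightarrow> s' z = s z" "A \<inter> env_vars = {}"
  shows "env n E k s'"
proof -
  have "s' z = s z" if "z \<in> env_vars" for z using that assms(2,3) by blast
  then have "env n E k s' = env n E k s" by (simp add: env_def env_vars_def)
  then show ?thesis using assms(1) by simp
qed

lemma env_den: "env n E k s \<Longrightarrow> asg p \<inter> env_vars = {} \<Longrightarrow> env n E k (den p s)"
  by (rule env_frame[of n E k s "asg p"]) (auto simp: den_frame)

lemma env_upd: "env n E k s \<Longrightarrow> x \<notin> env_vars \<Longrightarrow> env n E k (upd s x i a)"
  by (rule env_frame[of n E k s "{x}"]) (auto simp: upd_other)

text \<open>The table \<open>mul\<close> stands in for the multiplication by \<open>n\<close> that
  addresses a row of the matrix; the offset 2 skips the two numbers in front of it.\<close>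

definition adj :: "aexp \<Rightarrow> aexp \<Rightarrow> bexp" where
  "adj a b = Less (Const 0) (Cell ''in'' (Plus (Const 2) (Plus (Cell ''mul'' a) b)))"

lemma bval_adj:
  assumes "env n E k s" "aval a s \<le> n" "aval b s < n"
  shows "bval (adj a b) s \<longleftrightarrow> {aval a s, aval b s} \<in> E"
proof -
  have "s ''mul'' (aval a s) = aval a s * n" using assms by (simp add: env_def)
  moreover have "s ''in'' (2 + (aval a s * n + aval b s)) = of_bool ({aval a s, aval b s} \<in> E)"
    using assms unfolding env_def by blast
  ultimately show ?thesis by (simp add: adj_def)
qed

lemma env_simple: "env n E k s \<Longrightarrow> simple_graph ({..<n}, E)"
  by (simp add: env_def)

lemma edge_less: "simple_graph ({..<n}, E) \<Longrightarrow> {u, v} \<in> E \<Longrightarrow> u < n \<and> v < n \<and> u \<noteq> v"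
  using simple_graph_ends[of "({..<n}, E)" "{u, v}"] by (auto simp: doubleton_eq_iff)

text \<open>With truncated subtraction \<open>1 - col\<close> is 1 for the value 0 and 0 for every
  positive value. Colours are thus compared as truth values, and any positive entry means colour
  1.\<close>

definition same :: "aexp \<Rightarrow> aexp \<Rightarrow> bexp" where
  "same a b = Eq (Monus (Const 1) (Cell ''col'' a)) (Monus (Const 1) (Cell ''col'' b))"

lemma bval_same: "bval (same a b) s \<longleftrightarrow> (0 < s ''col'' (aval a s)) = (0 < s ''col'' (aval b s))"
  by (auto simp: same_def)

section \<open>Components by propagation of minimum labels\<close>

definition lab_step :: fprog where
  "lab_step = FCond (Conj (adj (V ''u'') (V ''v'')) (Conj (same (V ''u'') (V ''v''))
      (Less (Cell ''lab'' (V ''u'')) (Cell ''lab'' (V ''v'')))))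
    (FAssign ''lab'' (V ''v'') (Cell ''lab'' (V ''u''))) FSkip"

definition lab_round :: fprog where
  "lab_round = FFor ''u'' ''n'' (FFor ''v'' ''n'' lab_step)"

definition label :: fprog where
  "label = FFor ''v'' ''n'' (FAssign ''lab'' (V ''v'') (V ''v'')) ;; FFor ''r'' ''nn'' lab_round"

lemma asg_lab [simp]: "asg lab_step = {''lab''}" "asg lab_round = {''u'', ''v'', ''lab''}"
  "asg label = {''u'', ''v'', ''r'', ''lab''}"
  by (auto simp: lab_step_def lab_round_def label_def)

text \<open>A label is always a vertex of the component it labels, so the smallest possible label is
  a canonical representative.\<close>

definition lab_ok :: "nat \<Rightarrow> nat set set \<Rightarrow> (nat \<Rightarrow> bool) \<Rightarrow> mem \<Rightarrow> bool" where
  "lab_ok n E T s \<longleftrightarrow> (\<forall>v<n. s ''lab'' v < n \<and> (s ''lab'' v, v) \<in> conn (mono_edges E T))"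

lemma den_lab_step:
  assumes "env n E k s" "\<And>v. (0 < s ''col'' v) = T v" "s ''u'' 0 < n" "s ''v'' 0 < n"
  shows "den lab_step s = (if {s ''u'' 0, s ''v'' 0} \<in> mono_edges E T \<and>
      s ''lab'' (s ''u'' 0) < s ''lab'' (s ''v'' 0) then upd s ''lab'' (s ''v'' 0) (s ''lab'' (s ''u'' 0)) else s)"
  using bval_adj[OF assms(1), of "V ''u''" "V ''v''"] assms(3,4)
  by (simp add: lab_step_def bval_same assms(2) mono_edges_iff)

lemma den_lab_inner:
  assumes "env n E k s" "\<And>v. (0 < s ''col'' v) = T v" "s ''u'' 0 = u" "u < n" "lab_ok n E T s"
  defines "s1 \<equiv> den (FFor ''v'' ''n'' lab_step) s"
  shows "lab_ok n E T s1 \<and> (\<forall>v. s1 ''lab'' v \<le> s ''lab'' v) \<and>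
    (\<forall>v<n. {u, v} \<in> mono_edges E T \<longrightarrow> s1 ''lab'' v \<le> s ''lab'' u)"
  unfolding s1_def
proof (rule den_For_induct[where I = "\<lambda>i s1. lab_ok n E T s1 \<and> (\<forall>v. s1 ''lab'' v \<le> s ''lab'' v) \<and>
    (\<forall>v<i. {u, v} \<in> mono_edges E T \<longrightarrow> s1 ''lab'' v \<le> s ''lab'' u)"])
  fix i s'
  assume i: "i < s ''n'' 0" and I: "lab_ok n E T s' \<and> (\<forall>v. s' ''lab'' v \<le> s ''lab'' v) \<and>
    (\<forall>v<i. {u, v} \<in> mono_edges E T \<longrightarrow> s' ''lab'' v \<le> s ''lab'' u)"
    and fr: "\<And>z. z \<notin> insert ''v'' (asg lab_step) \<Longrightarrow> s' z = s z"
  have i': "i < n" using i assms(1) by (simp add: env_def)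
  have e: "env n E k (upd s' ''v'' 0 i)"
    by (rule env_upd, rule env_frame[OF assms(1)], erule fr) (auto simp: env_vars_def)
  have c: "(0 < upd s' ''v'' 0 i ''col'' v) = T v" for v using fr[of "''col''"] assms(2) by simp
  have u: "s' ''u'' 0 = u" using fr[of "''u''"] assms(3) by simp
  have d: "den lab_step (upd s' ''v'' 0 i) = (if {u, i} \<in> mono_edges E T \<and> s' ''lab'' u < s' ''lab'' i
      then upd (upd s' ''v'' 0 i) ''lab'' i (s' ''lab'' u) else upd s' ''v'' 0 i)"
    using den_lab_step[of n E k "upd s' ''v'' 0 i", OF e c] u assms(4) i' by simp
  show "lab_ok n E T (den lab_step (upd s' ''v'' 0 i)) \<and>
      (\<forall>v. den lab_step (upd s' ''v'' 0 i) ''lab'' v \<le> s ''lab'' v) \<and>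
      (\<forall>v<Suc i. {u, v} \<in> mono_edges E T \<longrightarrow> den lab_step (upd s' ''v'' 0 i) ''lab'' v \<le> s ''lab'' u)"
  proof (cases "{u, i} \<in> mono_edges E T \<and> s' ''lab'' u < s' ''lab'' i")
    case True
    have "(s' ''lab'' u, u) \<in> conn (mono_edges E T)" using I assms(4) by (simp add: lab_ok_def)
    then have "(s' ''lab'' u, i) \<in> conn (mono_edges E T)" using True by (meson conn_edge conn_trans)
    then show ?thesis using I True d u assms(4) i'
      by (auto simp: lab_ok_def less_Suc_eq intro: order_trans less_imp_le)
  next
    case False
    have "s' ''lab'' u \<le> s ''lab'' u" using I by blast
    then have "{u, i} \<in> mono_edges E T \<Longrightarrow> s' ''lab'' i \<le> s ''lab'' u" using False by linarith
    then have "\<forall>v<Suc i. {u, v} \<in> mono_edges E T \<longrightarrow> s' ''lab'' v \<le> s ''lab'' u"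
      using I by (auto simp: less_Suc_eq)
    then show ?thesis using I False d u assms(4) i' by (auto simp: lab_ok_def)
  qed
qed (use assms(1,5) in \<open>auto simp: lab_ok_def env_def\<close>)

lemma den_lab_round:
  assumes "env n E k s" "\<And>v. (0 < s ''col'' v) = T v" "lab_ok n E T s"
  defines "s1 \<equiv> den lab_round s"
  shows "lab_ok n E T s1 \<and> (\<forall>v. s1 ''lab'' v \<le> s ''lab'' v) \<and>
    (\<forall>u<n. \<forall>v<n. {u, v} \<in> mono_edges E T \<longrightarrow> s1 ''lab'' v \<le> s ''lab'' u)"
  unfolding s1_def lab_round_def
proof (rule den_For_induct[where I = "\<lambda>i s1. lab_ok n E T s1 \<and> (\<forall>v. s1 ''lab'' v \<le> s ''lab'' v) \<and>
    (\<forall>u<i. \<forall>v<n. {u, v} \<in> mono_edges E T \<longrightarrow> s1 ''lab'' v \<le> s ''lab'' u)"])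
  fix i s'
  assume i: "i < s ''n'' 0" and I: "lab_ok n E T s' \<and> (\<forall>v. s' ''lab'' v \<le> s ''lab'' v) \<and>
    (\<forall>u<i. \<forall>v<n. {u, v} \<in> mono_edges E T \<longrightarrow> s' ''lab'' v \<le> s ''lab'' u)"
    and fr: "\<And>z. z \<notin> insert ''u'' (asg (FFor ''v'' ''n'' lab_step)) \<Longrightarrow> s' z = s z"
  have i': "i < n" using i assms(1) by (simp add: env_def)
  have e: "env n E k (upd s' ''u'' 0 i)"
    by (rule env_upd, rule env_frame[OF assms(1)], erule fr) (auto simp: env_vars_def)
  have c: "(0 < upd s' ''u'' 0 i ''col'' v) = T v" for v using fr[of "''col''"] assms(2) by simp
  define s2 where "s2 = den (FFor ''v'' ''n'' lab_step) (upd s' ''u'' 0 i)"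
  have s2: "lab_ok n E T s2" "\<And>v. s2 ''lab'' v \<le> s' ''lab'' v"
    "\<And>v. v < n \<Longrightarrow> {i, v} \<in> mono_edges E T \<Longrightarrow> s2 ''lab'' v \<le> s' ''lab'' i"
    using den_lab_inner[of n E k "upd s' ''u'' 0 i", OF e c _ i'] I unfolding s2_def by (auto simp: lab_ok_def)
  show "lab_ok n E T s2 \<and> (\<forall>v. s2 ''lab'' v \<le> s ''lab'' v) \<and>
      (\<forall>u<Suc i. \<forall>v<n. {u, v} \<in> mono_edges E T \<longrightarrow> s2 ''lab'' v \<le> s ''lab'' u)"
  proof (intro conjI allI impI)
    show le: "s2 ''lab'' v \<le> s ''lab'' v" for v using s2(2)[of v] I le_trans by blast
    fix u v assume *: "u < Suc i" "v < n" "{u, v} \<in> mono_edges E T"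
    show "s2 ''lab'' v \<le> s ''lab'' u"
    proof (cases "u = i")
      case True
      then show ?thesis using s2(3)[of v] * I le_trans by blast
    next
      case False
      then have "s' ''lab'' v \<le> s ''lab'' u" using I * by (simp add: less_Suc_eq)
      then show ?thesis using s2(2)[of v] by simp
    qed
  qed (rule s2(1))
qed (use assms(1,3) in \<open>auto simp: lab_ok_def env_def\<close>)

text \<open>After \<open>i\<close> rounds the label of \<open>v\<close> is at most every vertex from
  which a monochromatic walk of length at most \<open>i\<close> leads to \<open>v\<close>. Since
  labels also stay inside their component, they end up as the minima of the components.\<close>

lemma den_label:
  assumes "env n E k s" "\<And>v. (0 < s ''col'' v) = T v"
  defines "s1 \<equiv> den label s"
  shows "lab_ok n E T s1" "u < n \<Longrightarrow> v < n \<Longrightarrow> s1 ''lab'' u = s1 ''lab'' v \<longleftrightarrow> (u, v) \<in> conn (mono_edges E T)"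
proof -
  let ?M = "{(u, v). {u, v} \<in> mono_edges E T}"
  define s0 where "s0 = den (FFor ''v'' ''n'' (FAssign ''lab'' (V ''v'') (V ''v''))) s"
  have "\<forall>v<n. s0 ''lab'' v = v"
    unfolding s0_def
    by (rule den_For_induct[where I = "\<lambda>i s1. \<forall>v<i. s1 ''lab'' v = v"])
       (use assms(1) in \<open>auto simp: less_Suc_eq env_def\<close>)
  then have lab0: "s0 ''lab'' v = v" if "v < n" for v using that by blast
  have fr0: "s0 z = s z" if "z \<noteq> ''v''" "z \<noteq> ''lab''" for z
    unfolding s0_def by (rule den_frame) (use that in auto)
  have e0: "env n E k s0"
    by (rule env_frame[OF assms(1), of "{''v'', ''lab''}"]) (auto simp: env_vars_def fr0)
  have c0: "(0 < s0 ''col'' v) = T v" for v using fr0[of "''col''"] assms(2) by simp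
  have "finite ?M" "card ?M \<le> n * n"
  proof -
    have sub: "?M \<subseteq> {..<n} \<times> {..<n}"
      using edge_less[OF env_simple[OF assms(1)]] by (auto simp: mono_edges_iff)
    then show "finite ?M" by (rule finite_subset) simp
    show "card ?M \<le> n * n" using card_mono[OF _ sub] by (simp add: card_cartesian_product)
  qed
  \<comment> \<open>A reachable pair needs no more steps than the relation has pairs; hence the
    number \<open>nn\<close> of rounds.\<close>
  then have rel: "\<exists>j\<le>n * n. p \<in> ?M ^^ j" if "p \<in> conn (mono_edges E T)" for p
    using that rtrancl_finite_eq_relpow[of ?M] le_trans unfolding conn_def by blast
  have main: "lab_ok n E T s1 \<and> (\<forall>j\<le>n * n. \<forall>u<n. \<forall>v<n. (u, v) \<in> ?M ^^ j \<longrightarrow> s1 ''lab'' v \<le> u)"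
    unfolding s1_def label_def den_simps s0_def[symmetric]
  proof (rule den_For_induct[where I = "\<lambda>i s1. lab_ok n E T s1 \<and>
      (\<forall>j\<le>i. \<forall>u<n. \<forall>v<n. (u, v) \<in> ?M ^^ j \<longrightarrow> s1 ''lab'' v \<le> u)"])
    show "lab_ok n E T s0 \<and> (\<forall>j\<le>0. \<forall>u<n. \<forall>v<n. (u, v) \<in> ?M ^^ j \<longrightarrow> s0 ''lab'' v \<le> u)"
      by (auto simp: lab_ok_def lab0)
  next
    fix i s'
    assume I: "lab_ok n E T s' \<and> (\<forall>j\<le>i. \<forall>u<n. \<forall>v<n. (u, v) \<in> ?M ^^ j \<longrightarrow> s' ''lab'' v \<le> u)"
      and fr: "\<And>z. z \<notin> insert ''r'' (asg lab_round) \<Longrightarrow> s' z = s0 z"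
    have e: "env n E k (upd s' ''r'' 0 i)"
      by (rule env_upd, rule env_frame[OF e0], erule fr) (auto simp: env_vars_def)
    have c: "(0 < upd s' ''r'' 0 i ''col'' v) = T v" for v using fr[of "''col''"] c0 by simp
    define s2 where "s2 = den lab_round (upd s' ''r'' 0 i)"
    have s2: "lab_ok n E T s2" "\<And>v. s2 ''lab'' v \<le> s' ''lab'' v"
      "\<And>u v. u < n \<Longrightarrow> v < n \<Longrightarrow> {u, v} \<in> mono_edges E T \<Longrightarrow> s2 ''lab'' v \<le> s' ''lab'' u"
      using den_lab_round[of n E k "upd s' ''r'' 0 i", OF e c] I unfolding s2_def by (auto simp: lab_ok_def)
    have "s2 ''lab'' v \<le> u" if j: "j \<le> Suc i" "u < n" "v < n" "(u, v) \<in> ?M ^^ j" for j u v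
    proof (cases "j \<le> i")
      case True
      then show ?thesis using I j s2(2) le_trans by blast
    next
      case False
      then have "j = Suc i" using j by simp
      then obtain w where w: "(u, w) \<in> ?M ^^ i" "{w, v} \<in> mono_edges E T" using j(4) by auto
      have "w < n" using w(2) edge_less[OF env_simple[OF assms(1)]] by (auto simp: mono_edges_iff)
      then show ?thesis using s2(3)[OF _ j(3) w(2)] I w(1) j(2) le_trans by blast
    qed
    then show "lab_ok n E T s2 \<and> (\<forall>j\<le>Suc i. \<forall>u<n. \<forall>v<n. (u, v) \<in> ?M ^^ j \<longrightarrow> s2 ''lab'' v \<le> u)"
      using s2(1) by blast
  next
    fix s' assume "lab_ok n E T s' \<and> (\<forall>j\<le>s0 ''nn'' 0. \<forall>u<n. \<forall>v<n. (u, v) \<in> ?M ^^ j \<longrightarrow> s' ''lab'' v \<le> u)"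
    moreover have "s0 ''nn'' 0 = n * n" using e0 by (simp add: env_def)
    ultimately show "lab_ok n E T (upd s' ''r'' 0 (s0 ''nn'' 0)) \<and>
       (\<forall>j\<le>n * n. \<forall>u<n. \<forall>v<n. (u, v) \<in> ?M ^^ j \<longrightarrow> upd s' ''r'' 0 (s0 ''nn'' 0) ''lab'' v \<le> u)"
      by (simp add: lab_ok_def)
  qed
  then show ok: "lab_ok n E T s1" ..
  have min: "s1 ''lab'' v \<le> u" if "(u, v) \<in> conn (mono_edges E T)" "u < n" "v < n" for u v
    using main rel[OF that(1)] that(2,3) by blast
  have rep: "s1 ''lab'' v < n" "(s1 ''lab'' v, v) \<in> conn (mono_edges E T)" if "v < n" for v
    using ok that by (auto simp: lab_ok_def)
  \<comment> \<open>The label of \<open>u\<close> is itself a vertex connected to \<open>v\<close>,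
    so \<open>min\<close> applies to it; by symmetry the two labels agree.\<close>
  have le: "s1 ''lab'' v \<le> s1 ''lab'' u" if "(u, v) \<in> conn (mono_edges E T)" "u < n" "v < n" for u v
    by (rule min[OF conn_trans[OF rep(2)[OF that(2)] that(1)] rep(1)[OF that(2)] that(3)])
  assume uv: "u < n" "v < n"
  show "s1 ''lab'' u = s1 ''lab'' v \<longleftrightarrow> (u, v) \<in> conn (mono_edges E T)"
  proof
    assume "s1 ''lab'' u = s1 ''lab'' v"
    then show "(u, v) \<in> conn (mono_edges E T)"
      using conn_trans[OF conn_sym[OF rep(2)[OF uv(1)]]] rep(2)[OF uv(2)] by simp
  next
    assume *: "(u, v) \<in> conn (mono_edges E T)"
    then show "s1 ''lab'' u = s1 ''lab'' v"
      using le[of u v, OF * uv] le[of v u, OF conn_sym[OF *] uv(2,1)] by simp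
  qed
qed

section \<open>Counting components and testing their adjacency\<close>

text \<open>A component is counted at its representative, the vertex that carries its own name as
  label.\<close>

definition count :: fprog where
  "count = FAssign ''ca'' (Const 0) (Const 0) ;; FAssign ''cb'' (Const 0) (Const 0) ;;
     FFor ''v'' ''n'' (FCond (Eq (Cell ''lab'' (V ''v'')) (V ''v''))
       (FCond (Less (Const 0) (Cell ''col'' (V ''v'')))
         (FAssign ''cb'' (Const 0) (Plus (V ''cb'') (Const 1)))
         (FAssign ''ca'' (Const 0) (Plus (V ''ca'') (Const 1)))) FSkip)"

definition find_edge :: fprog where
  "find_edge = FAssign ''fd'' (Const 0) (Const 0) ;; FFor ''x'' ''n'' (FFor ''y'' ''n''
     (FCond (Conj (adj (V ''x'') (V ''y'')) (Conj (Eq (Cell ''lab'' (V ''x'')) (Cell ''lab'' (V ''u'')))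
        (Eq (Cell ''lab'' (V ''y'')) (Cell ''lab'' (V ''v''))))) (FAssign ''fd'' (Const 0) (Const 1)) FSkip))"

definition cross :: fprog where
  "cross = FAssign ''ok'' (Const 0) (Const 1) ;; FFor ''u'' ''n'' (FFor ''v'' ''n''
     (FCond (same (V ''u'') (V ''v'')) FSkip
        (find_edge ;; FCond (Less (Const 0) (V ''fd'')) FSkip (FAssign ''ok'' (Const 0) (Const 0)))))"

definition check :: "bool \<Rightarrow> fprog" where
  "check bal = label ;; count ;; cross ;;
     FCond (Conj (Less (Const 0) (V ''ok'')) (Conj (Neg (Less (Plus (V ''k'') (Plus (V ''ca'') (V ''cb''))) (V ''n'')))
       (if bal then Eq (V ''ca'') (V ''cb'') else Less (Const 0) (Const 1))))
     (FAssign ''out'' (Const 0) (Const 1)) FSkip"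

lemma asg_check [simp]: "asg count = {''ca'', ''cb'', ''v''}" "asg find_edge = {''fd'', ''x'', ''y''}"
  "asg cross = {''ok'', ''u'', ''v'', ''fd'', ''x'', ''y''}"
  "asg (check bal) = {''out'', ''ca'', ''cb'', ''ok'', ''u'', ''v'', ''fd'', ''x'', ''y'', ''r'', ''lab''}"
  by (auto simp: count_def find_edge_def cross_def check_def)

lemma Collect_less_Suc_conj:
  "{v. v < Suc i \<and> P v} = (if P i then insert i {v. v < i \<and> P v} else {v. v < i \<and> P v})"
  by (auto simp: less_Suc_eq)

lemma den_count:
  assumes "env n E k s" "\<And>v. (0 < s ''col'' v) = T v"
  defines "s1 \<equiv> den count s"
  shows "s1 ''ca'' 0 = card {v. v < n \<and> s ''lab'' v = v \<and> \<not> T v} \<and>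
         s1 ''cb'' 0 = card {v. v < n \<and> s ''lab'' v = v \<and> T v}"
  unfolding s1_def count_def den_simps
proof (rule den_For_induct[where I = "\<lambda>i s1. s1 ''ca'' 0 = card {v. v < i \<and> s ''lab'' v = v \<and> \<not> T v} \<and>
         s1 ''cb'' 0 = card {v. v < i \<and> s ''lab'' v = v \<and> T v}"])
  fix i s'
  let ?s = "upd (upd s ''ca'' (aval (Const 0) s) (aval (Const 0) s)) ''cb''
      (aval (Const 0) (upd s ''ca'' (aval (Const 0) s) (aval (Const 0) s)))
      (aval (Const 0) (upd s ''ca'' (aval (Const 0) s) (aval (Const 0) s)))"
  assume fr: "\<And>z. z \<notin> insert ''v'' (asg (FCond (Eq (Cell ''lab'' (V ''v'')) (V ''v''))
       (FCond (Less (Const 0) (Cell ''col'' (V ''v'')))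
         (FAssign ''cb'' (Const 0) (Plus (V ''cb'') (Const 1)))
         (FAssign ''ca'' (Const 0) (Plus (V ''ca'') (Const 1)))) FSkip)) \<Longrightarrow> s' z = ?s z"
   and I: "s' ''ca'' 0 = card {v. v < i \<and> s ''lab'' v = v \<and> \<not> T v} \<and>
         s' ''cb'' 0 = card {v. v < i \<and> s ''lab'' v = v \<and> T v}"
  have "s' ''lab'' = s ''lab''" "s' ''col'' = s ''col''"
    using fr[of "''lab''"] fr[of "''col''"] by (auto simp: upd_other)
  moreover have "(0 < s ''col'' i) = T i" using assms(2)[of i] by simp
  ultimately show "den (FCond (Eq (Cell ''lab'' (V ''v'')) (V ''v''))
       (FCond (Less (Const 0) (Cell ''col'' (V ''v'')))
         (FAssign ''cb'' (Const 0) (Plus (V ''cb'') (Const 1)))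
         (FAssign ''ca'' (Const 0) (Plus (V ''ca'') (Const 1)))) FSkip) (upd s' ''v'' 0 i) ''ca'' 0
          = card {v. v < Suc i \<and> s ''lab'' v = v \<and> \<not> T v} \<and>
      den (FCond (Eq (Cell ''lab'' (V ''v'')) (V ''v''))
       (FCond (Less (Const 0) (Cell ''col'' (V ''v'')))
         (FAssign ''cb'' (Const 0) (Plus (V ''cb'') (Const 1)))
         (FAssign ''ca'' (Const 0) (Plus (V ''ca'') (Const 1)))) FSkip) (upd s' ''v'' 0 i) ''cb'' 0
          = card {v. v < Suc i \<and> s ''lab'' v = v \<and> T v}"
    using I by (simp add: Collect_less_Suc_conj)
qed (use assms(1) in \<open>auto simp: env_def\<close>)

lemma den_find_edge:
  assumes "env n E k s"
  shows "den find_edge s ''fd'' 0 = (if \<exists>x<n. \<exists>y<n. {x, y} \<in> E \<and>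
      s ''lab'' x = s ''lab'' (s ''u'' 0) \<and> s ''lab'' y = s ''lab'' (s ''v'' 0) then 1 else 0)"
proof -
  define s0 where "s0 = upd s ''fd'' 0 0"
  have s0: "s0 z = s z" if "z \<noteq> ''fd''" for z using that by (simp add: s0_def upd_other)
  have e0: "env n E k s0" unfolding s0_def by (rule env_upd[OF assms]) (simp add: env_vars_def)
  let ?b = "Conj (adj (V ''x'') (V ''y'')) (Conj (Eq (Cell ''lab'' (V ''x'')) (Cell ''lab'' (V ''u'')))
        (Eq (Cell ''lab'' (V ''y'')) (Cell ''lab'' (V ''v''))))"
  let ?c = "FCond ?b (FAssign ''fd'' (Const 0) (Const 1)) FSkip"
  have n: "s0 ''n'' 0 = n" using e0 by (simp add: env_def)
  have "den (FFor ''x'' ''n'' (FFor ''y'' ''n'' ?c)) s0 ''fd'' 0 = (if \<exists>x<s0 ''n'' 0. \<exists>y<n. {x, y} \<in> E \<and>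
      s ''lab'' x = s ''lab'' (s ''u'' 0) \<and> s ''lab'' y = s ''lab'' (s ''v'' 0) then 1 else s0 ''fd'' 0)"
  proof (rule den_For_flag)
    fix i s' assume i: "i < s0 ''n'' 0" and fr: "\<And>z. z \<notin> insert ''x'' (asg (FFor ''y'' ''n'' ?c)) \<Longrightarrow> s' z = s0 z"
    define s1 where "s1 = upd s' ''x'' 0 i"
    have s1: "s1 z = s z" if "z \<notin> {''x'', ''y'', ''fd''}" for z
      using that fr[of z] s0[of z] by (simp add: s1_def upd_other)
    have n1: "s1 ''n'' 0 = n" "s1 ''x'' 0 = i" "s1 ''fd'' 0 = s' ''fd'' 0"
      using assms s1[of "''n''"] by (simp_all add: env_def s1_def)
    have "den (FFor ''y'' ''n'' ?c) s1 ''fd'' 0 = (if \<exists>y<s1 ''n'' 0. {i, y} \<in> E \<and>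
      s ''lab'' i = s ''lab'' (s ''u'' 0) \<and> s ''lab'' y = s ''lab'' (s ''v'' 0) then 1 else s1 ''fd'' 0)"
    proof (rule den_For_flag)
      fix j s' assume j: "j < s1 ''n'' 0" and fr: "\<And>z. z \<notin> insert ''y'' (asg ?c) \<Longrightarrow> s' z = s1 z"
      define s2 where "s2 = upd s' ''y'' 0 j"
      have s2: "s2 z = s1 z" if "z \<notin> {''y'', ''fd''}" for z
        using that fr[of z] by (simp add: s2_def upd_other)
      have e2: "env n E k s2"
        by (rule env_frame[OF assms, of "{''x'', ''y'', ''fd''}"]) (use s1 s2 in \<open>auto simp: env_vars_def\<close>)
      have "s2 ''x'' 0 = i" "s2 ''y'' 0 = j" "s2 ''fd'' 0 = s' ''fd'' 0"
        using s2[of "''x''"] n1 by (simp_all add: s2_def)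
      moreover have "s2 ''lab'' = s ''lab''" "s2 ''u'' = s ''u''" "s2 ''v'' = s ''v''"
        using s1 s2 by simp_all
      ultimately show "den ?c s2 ''fd'' 0 = (if {i, j} \<in> E \<and>
         s ''lab'' i = s ''lab'' (s ''u'' 0) \<and> s ''lab'' j = s ''lab'' (s ''v'' 0) then 1 else s' ''fd'' 0)"
        using bval_adj[OF e2, of "V ''x''" "V ''y''"] i j n n1 by simp
    qed simp
    then show "den (FFor ''y'' ''n'' ?c) s1 ''fd'' 0 = (if \<exists>y<n. {i, y} \<in> E \<and>
      s ''lab'' i = s ''lab'' (s ''u'' 0) \<and> s ''lab'' y = s ''lab'' (s ''v'' 0) then 1 else s' ''fd'' 0)"
      unfolding n1 .
  qed simp
  moreover have "den find_edge s = den (FFor ''x'' ''n'' (FFor ''y'' ''n'' ?c)) s0" "s0 ''fd'' 0 = 0"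
    by (simp_all add: find_edge_def s0_def)
  ultimately show ?thesis by (simp only: n)
qed

lemma den_cross:
  assumes "env n E k s" "\<And>v. (0 < s ''col'' v) = T v"
  shows "den cross s ''ok'' 0 = (if \<exists>u<n. \<exists>v<n. T u \<noteq> T v \<and> \<not> (\<exists>x<n. \<exists>y<n. {x, y} \<in> E \<and>
      s ''lab'' x = s ''lab'' u \<and> s ''lab'' y = s ''lab'' v) then 0 else 1)"
proof -
  define s0 where "s0 = upd s ''ok'' 0 1"
  have s0: "s0 z = s z" if "z \<noteq> ''ok''" for z using that by (simp add: s0_def upd_other)
  have e0: "env n E k s0" unfolding s0_def by (rule env_upd[OF assms(1)]) (simp add: env_vars_def)
  let ?c = "FCond (same (V ''u'') (V ''v'')) FSkip
        (find_edge ;; FCond (Less (Const 0) (V ''fd'')) FSkip (FAssign ''ok'' (Const 0) (Const 0)))"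
  define Q where "Q u v \<longleftrightarrow> (\<exists>x<n. \<exists>y<n. {x, y} \<in> E \<and> s ''lab'' x = s ''lab'' u \<and> s ''lab'' y = s ''lab'' v)" for u v
  let ?bad = "\<lambda>u v. T u \<noteq> T v \<and> \<not> Q u v"
  have n: "s0 ''n'' 0 = n" using e0 by (simp add: env_def)
  have "den (FFor ''u'' ''n'' (FFor ''v'' ''n'' ?c)) s0 ''ok'' 0 =
     (if \<exists>u<s0 ''n'' 0. \<exists>v<n. ?bad u v then 0 else s0 ''ok'' 0)"
  proof (rule den_For_flag)
    fix i s' assume i: "i < s0 ''n'' 0" and fr: "\<And>z. z \<notin> insert ''u'' (asg (FFor ''v'' ''n'' ?c)) \<Longrightarrow> s' z = s0 z"
    define s1 where "s1 = upd s' ''u'' 0 i"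
    have s1: "s1 z = s z" if "z \<notin> {''u'', ''v'', ''x'', ''y'', ''fd'', ''ok''}" for z
      using that fr[of z] s0[of z] by (simp add: s1_def upd_other)
    have n1: "s1 ''n'' 0 = n" "s1 ''u'' 0 = i" "s1 ''ok'' 0 = s' ''ok'' 0"
      using assms s1[of "''n''"] by (simp_all add: env_def s1_def)
    have "den (FFor ''v'' ''n'' ?c) s1 ''ok'' 0 = (if \<exists>v<s1 ''n'' 0. ?bad i v then 0 else s1 ''ok'' 0)"
    proof (rule den_For_flag)
      fix j s' assume j: "j < s1 ''n'' 0" and fr: "\<And>z. z \<notin> insert ''v'' (asg ?c) \<Longrightarrow> s' z = s1 z"
      define s2 where "s2 = upd s' ''v'' 0 j"
      have s2: "s2 z = s1 z" if "z \<notin> {''v'', ''x'', ''y'', ''fd'', ''ok''}" for z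
        using that fr[of z] by (simp add: s2_def upd_other)
      have e2: "env n E k s2"
        by (rule env_frame[OF assms(1), of "{''u'', ''v'', ''x'', ''y'', ''fd'', ''ok''}"])
           (use s1 s2 in \<open>auto simp: env_vars_def\<close>)
      have "s2 ''u'' 0 = i" "s2 ''v'' 0 = j" "s2 ''ok'' 0 = s' ''ok'' 0"
        using s2[of "''u''"] n1 by (simp_all add: s2_def)
      moreover have "s2 ''lab'' = s ''lab''" "s2 ''col'' = s ''col''"
        using s1 s2 by simp_all
      moreover have "den find_edge s2 ''ok'' = s2 ''ok''" by (rule den_frame) simp
      moreover from calculation have "den find_edge s2 ''fd'' 0 = (if Q i j then 1 else 0)"
        unfolding Q_def den_find_edge[OF e2] by (simp only:)
      ultimately show "den ?c s2 ''ok'' 0 = (if ?bad i j then 0 else s' ''ok'' 0)"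
        by (simp add: bval_same assms(2))
    qed simp
    then show "den (FFor ''v'' ''n'' ?c) s1 ''ok'' 0 = (if \<exists>v<n. ?bad i v then 0 else s' ''ok'' 0)"
      unfolding n1 .
  qed simp
  moreover have "den cross s = den (FFor ''u'' ''n'' (FFor ''v'' ''n'' ?c)) s0" "s0 ''ok'' 0 = 1"
    by (simp_all add: cross_def s0_def)
  ultimately show ?thesis by (simp only: n Q_def[symmetric])
qed

lemma den_check:
  assumes "env n E k s"
  shows "den (check bal) s ''out'' 0 = (if sol bal n E k (\<lambda>v. 0 < s ''col'' v) then 1 else s ''out'' 0)"
proof -
  define T where "T = (\<lambda>v. 0 < s ''col'' v)"
  define s1 where "s1 = den label s"
  define s2 where "s2 = den count s1"
  define s3 where "s3 = den cross s2"
  have c: "(0 < s ''col'' v) = T v" for v by (simp add: T_def)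
  have s1: "s1 z = s z" if "z \<notin> {''u'', ''v'', ''r'', ''lab''}" for z
    using that den_frame[of z label s] by (simp add: s1_def)
  have s2: "s2 z = s1 z" if "z \<notin> {''ca'', ''cb'', ''v''}" for z
    using that den_frame[of z count s1] by (simp add: s2_def)
  have s3: "s3 z = s2 z" if "z \<notin> {''ok'', ''u'', ''v'', ''fd'', ''x'', ''y''}" for z
    using that den_frame[of z cross s2] by (simp add: s3_def)
  have e1: "env n E k s1" unfolding s1_def by (rule env_den[OF assms]) (auto simp: env_vars_def)
  have e2: "env n E k s2" unfolding s2_def by (rule env_den[OF e1]) (auto simp: env_vars_def)
  have e3: "env n E k s3" unfolding s3_def by (rule env_den[OF e2]) (auto simp: env_vars_def)
  have c1: "(0 < s1 ''col'' v) = T v" and c2: "(0 < s2 ''col'' v) = T v" for v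
    using c s1[of "''col''"] s2[of "''col''"] by simp_all
  define l where "l = s1 ''lab''"
  have l: "l u = l v \<longleftrightarrow> (u, v) \<in> conn (mono_edges E T)" if "u < n" "v < n" for u v
    unfolding l_def s1_def using den_label(2)[of n E k s, OF assms c that] .
  have lok: "l v < n" "(l v, v) \<in> conn (mono_edges E T)" if "v < n" for v
    using den_label(1)[of n E k s, OF assms c] that by (auto simp: l_def s1_def lab_ok_def)
  have idem: "l (l v) = l v" if "v < n" for v
    using l[of "l v" v] lok[OF that] that by simp
  have lT: "T (l v) = T v" if "v < n" for v
    by (rule conn_mono_colour[OF lok(2)[OF that]])
  \<comment> \<open>The labelling is idempotent and keeps colours, so its fixed points of colour
    \<open>b\<close> form a transversal of the components of that colour.\<close>
  have nc: "ncomp n E T b = card {v. v < n \<and> l v = v \<and> T v = b}" for b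
  proof -
    have "ncomp n E T b = card (l ` colour_class n T b)"
      unfolding ncomp_def by (rule card_image_cong) (auto simp: colour_class_def component_eq_iff l)
    also have "l ` colour_class n T b = {v. v < n \<and> l v = v \<and> T v = b}"
    proof (intro set_eqI iffI)
      fix x assume "x \<in> l ` colour_class n T b"
      then show "x \<in> {v. v < n \<and> l v = v \<and> T v = b}"
        using lok idem lT by (auto simp: colour_class_def)
    next
      fix x assume "x \<in> {v. v < n \<and> l v = v \<and> T v = b}"
      then show "x \<in> l ` colour_class n T b" by (auto simp: colour_class_def intro!: image_eqI[of _ _ x])
    qed
    finally show ?thesis .
  qed
  have cc: "s3 ''ca'' 0 = ncomp n E T False" "s3 ''cb'' 0 = ncomp n E T True"
    using den_count[of n E k s1, OF e1 c1] s3[of "''ca''"] s3[of "''cb''"] unfolding nc s2_def[symmetric] l_def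
    by simp_all
  have "s2 ''lab'' = l" using s2[of "''lab''"] by (simp add: l_def)
  have "0 < s3 ''ok'' 0 \<longleftrightarrow> (\<forall>u<n. \<forall>v<n. T u \<noteq> T v \<longrightarrow> (\<exists>x<n. \<exists>y<n. {x, y} \<in> E \<and> l x = l u \<and> l y = l v))"
  proof -
    have if01: "0 < (if b then 0 else 1 :: nat) \<longleftrightarrow> \<not> b" for b by simp
    show ?thesis unfolding s3_def den_cross[of n E k s2, OF e2 c2] \<open>s2 ''lab'' = l\<close> if01 by blast
  qed
  also have "\<dots> \<longleftrightarrow> (\<forall>u<n. \<forall>v<n. T u \<noteq> T v \<longrightarrow> (\<exists>u'\<in>component E T u. \<exists>v'\<in>component E T v. {u', v'} \<in> E))"
  proof -
    have "(\<exists>x<n. \<exists>y<n. {x, y} \<in> E \<and> l x = l u \<and> l y = l v) \<longleftrightarrow>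
        (\<exists>u'\<in>component E T u. \<exists>v'\<in>component E T v. {u', v'} \<in> E)" if "u < n" "v < n" for u v
    proof -
      have "x < n" "y < n" if "{x, y} \<in> E" for x y using edge_less[OF env_simple[OF assms]] that by blast+
      moreover have "l x = l u \<longleftrightarrow> x \<in> component E T u" "l x = l v \<longleftrightarrow> x \<in> component E T v" if "x < n" for x
        using l \<open>u < n\<close> \<open>v < n\<close> that by (auto simp: in_component_iff dest: conn_sym)
      ultimately show ?thesis by meson
    qed
    then show ?thesis by simp
  qed
  finally have ok: "0 < s3 ''ok'' 0 \<longleftrightarrow> (\<forall>u<n. \<forall>v<n. T u \<noteq> T v \<longrightarrow>
     (\<exists>u'\<in>component E T u. \<exists>v'\<in>component E T v. {u', v'} \<in> E))" .
  define X where "X \<longleftrightarrow> 0 < s3 ''ok'' 0"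
  then have X: "0 < s3 ''ok'' 0 \<longleftrightarrow> X" by simp
  have sol: "sol bal n E k T \<longleftrightarrow> n \<le> k + ncomp n E T False + ncomp n E T True \<and> X \<and>
      (bal \<longrightarrow> ncomp n E T False = ncomp n E T True)"
    unfolding sol_def X_def ok ..
  have out: "s3 ''out'' = s ''out''" using s1[of "''out''"] s2[of "''out''"] s3[of "''out''"] by simp
  have nk: "s3 ''n'' 0 = n" "s3 ''k'' 0 = k" using e3 by (simp_all add: env_def)
  show ?thesis
    unfolding check_def den_simps s1_def[symmetric] s2_def[symmetric] s3_def[symmetric] T_def[symmetric]
    using X sol cc out nk by (auto simp: not_less add.assoc)
qed

section \<open>Guessed bits\<close>

text \<open>Only addition and subtraction are available, so the digits are peeled off from the top:
  compare with a power of two and subtract it if possible.\<close>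

definition decode :: fprog where
  "decode = FAssign ''rr'' (Const 0) (V ''c'') ;; FFor ''i'' ''m''
     (FAssign ''w'' (Const 0) (Monus (V ''m'') (Plus (V ''i'') (Const 1))) ;;
      FCond (Less (V ''rr'') (Cell ''pw'' (V ''w'')))
        (FAssign ''g'' (V ''w'') (Const 0))
        (FAssign ''g'' (V ''w'') (Const 1) ;;
         FAssign ''rr'' (Const 0) (Monus (V ''rr'') (Cell ''pw'' (V ''w'')))))"

lemma asg_decode [simp]: "asg decode = {''rr'', ''i'', ''w'', ''g''}"
  by (auto simp: decode_def)

lemma den_decode:
  assumes "env n E k s" "s ''c'' 0 < 2 ^ (4 * k + 1)" "i < 4 * k + 1"
  shows "den decode s ''g'' i = of_bool (bit (s ''c'' 0) i)"
proof -
  define m c where "m = 4 * k + 1" and "c = s ''c'' 0"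
  let ?s = "upd s ''rr'' 0 c"
  let ?p = "(FAssign ''w'' (Const 0) (Monus (V ''m'') (Plus (V ''i'') (Const 1))) ;;
      FCond (Less (V ''rr'') (Cell ''pw'' (V ''w'')))
        (FAssign ''g'' (V ''w'') (Const 0))
        (FAssign ''g'' (V ''w'') (Const 1) ;;
         FAssign ''rr'' (Const 0) (Monus (V ''rr'') (Cell ''pw'' (V ''w'')))))"
  have c: "c < 2 ^ m" using assms(2) by (simp add: c_def m_def)
  have m: "?s ''m'' 0 = m" using assms(1) by (simp add: env_def m_def)
  have "den (FFor ''i'' ''m'' ?p) ?s ''g'' i = of_bool (bit c i)"
  proof (rule den_For_induct[where I = "\<lambda>i s. s ''rr'' 0 = take_bit (m - i) c \<and>
      (\<forall>j. m - i \<le> j \<and> j < m \<longrightarrow> s ''g'' j = of_bool (bit c j))"])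
    show "?s ''rr'' 0 = take_bit (m - 0) c \<and> (\<forall>j. m - 0 \<le> j \<and> j < m \<longrightarrow> ?s ''g'' j = of_bool (bit c j))"
      using c by (simp add: take_bit_nat_eq_self)
  next
    fix i s'
    assume i: "i < ?s ''m'' 0" and I: "s' ''rr'' 0 = take_bit (m - i) c \<and>
        (\<forall>j. m - i \<le> j \<and> j < m \<longrightarrow> s' ''g'' j = of_bool (bit c j))"
      and fr: "\<And>z. z \<notin> insert ''i'' (asg ?p) \<Longrightarrow> s' z = ?s z"
    define w where "w = m - Suc i"
    have w: "m - i = Suc w" "w < m" using i m by (auto simp: w_def)
    have "s' ''m'' 0 = m" using fr[of "''m''"] m by simp
    moreover have "s' ''pw'' w = 2 ^ w"
      using fr[of "''pw''"] assms(1) w(2) by (simp add: env_def m_def upd_other)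
    moreover have "s' ''rr'' 0 = 2 ^ w * of_bool (bit c w) + take_bit w c"
      using I w(1) by (simp add: take_bit_Suc_from_most)
    moreover have "take_bit w c < 2 ^ w" by simp
    moreover have "m - Suc i = w" by (simp add: w_def)
    moreover have "\<forall>j. w < j \<and> j < m \<longrightarrow> s' ''g'' j = of_bool (bit c j)" using I w(1) by (simp add: Suc_le_eq)
    ultimately show "den ?p (upd s' ''i'' 0 i) ''rr'' 0 = take_bit (m - Suc i) c \<and>
      (\<forall>j. m - Suc i \<le> j \<and> j < m \<longrightarrow> den ?p (upd s' ''i'' 0 i) ''g'' j = of_bool (bit c j))"
      by (cases "bit c w") auto
  qed (use m assms(3) in \<open>auto simp: m_def\<close>)
  then show ?thesis by (simp add: decode_def c_def)
qed

lemma ex_bits: "\<exists>c<2 ^ m. \<forall>i<m. bit (c :: nat) i = h i"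
proof -
  define c where "c = take_bit m (horner_sum of_bool (2 :: nat) (map h [0..<m]))"
  have "c < 2 ^ m" by (simp add: c_def)
  moreover have "bit c i = h i" if "i < m" for i
    using that by (simp add: c_def bit_take_bit_iff bit_horner_sum_bit_iff)
  ultimately show ?thesis by blast
qed

text \<open>Only an initial segment of the guesses is prescribed. The bits for later parts of a
  search can be appended without disturbing what was said about the earlier parts.\<close>

definition ext :: "mem \<Rightarrow> bool list \<Rightarrow> bool" where
  "ext s bs \<longleftrightarrow> (\<forall>i<length bs. s ''g'' i = of_bool (bs ! i))"

lemma ext_append: "ext s (bs @ cs) \<Longrightarrow> ext s bs"
  unfolding ext_def by (metis length_append nth_append trans_less_add1)

lemma ext_nth: "ext s (bs @ b # cs) \<Longrightarrow> s ''g'' (length bs) = of_bool b"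
  unfolding ext_def by (metis length_Cons length_append add_Suc_right less_add_Suc1 nth_append_length)

lemma ext_cong: "s' ''g'' = s ''g'' \<Longrightarrow> ext s' bs = ext s bs"
  by (simp add: ext_def)

text \<open>The bits consumed by a loop can be chosen in advance so that all its guesses come out as intended:
  the choice for each iteration depends only on the abstract state \<open>\<sigma>\<close> reached with the bits
  chosen before, not on the memory.\<close>

lemma den_For_oracle:
  assumes frame: "\<And>s s'. Ok s \<Longrightarrow> (\<And>z. z \<notin> insert x (asg q) \<Longrightarrow> s' z = s z) \<Longrightarrow> Ok s'"
    and N: "\<And>s. Ok s \<Longrightarrow> s y 0 = N"
    and x: "x \<noteq> ''j''" "''g'' \<notin> insert x (asg q)"
    and St: "\<And>i \<sigma> s a. St i \<sigma> s \<Longrightarrow> St i \<sigma> (upd s x 0 a)"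
    and step: "\<And>i bs \<sigma>. i < N \<Longrightarrow> Inv i bs \<sigma> \<Longrightarrow> \<exists>cs \<sigma>'. Inv (Suc i) (bs @ cs) \<sigma>' \<and>
      (\<forall>s. Ok s \<and> s x 0 = i \<and> St i \<sigma> s \<and> s ''j'' 0 = length bs \<and> ext s (bs @ cs) \<longrightarrow>
        St (Suc i) \<sigma>' (den q s) \<and> den q s ''j'' 0 = length (bs @ cs))"
    and "Inv 0 bs \<sigma>"
  shows "\<exists>cs \<sigma>'. Inv N (bs @ cs) \<sigma>' \<and>
      (\<forall>s. Ok s \<and> St 0 \<sigma> s \<and> s ''j'' 0 = length bs \<and> ext s (bs @ cs) \<longrightarrow>
        St N \<sigma>' (den (FFor x y q) s) \<and> den (FFor x y q) s ''j'' 0 = length (bs @ cs))"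
proof -
  define f where "f = (\<lambda>i s. den q (upd s x 0 i))"
  have fr: "fold f [0..<i] s z = s z" if "z \<notin> insert x (asg q)" for i s z
    by (rule fold_frame) (use that in \<open>auto simp: f_def den_frame upd_other\<close>)
  have "\<exists>cs \<sigma>'. Inv i (bs @ cs) \<sigma>' \<and>
      (\<forall>s. Ok s \<and> St 0 \<sigma> s \<and> s ''j'' 0 = length bs \<and> ext s (bs @ cs) \<longrightarrow>
        St i \<sigma>' (fold f [0..<i] s) \<and> fold f [0..<i] s ''j'' 0 = length (bs @ cs))" if "i \<le> N" for i
    using that
  proof (induction i)
    case 0
    then show ?case using assms(7) by (intro exI[of _ "[]"] exI[of _ \<sigma>]) simp
  next
    case (Suc i)
    then obtain cs \<sigma>1 where 1: "Inv i (bs @ cs) \<sigma>1"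
      "\<And>s. Ok s \<Longrightarrow> St 0 \<sigma> s \<Longrightarrow> s ''j'' 0 = length bs \<Longrightarrow> ext s (bs @ cs) \<Longrightarrow>
        St i \<sigma>1 (fold f [0..<i] s) \<and> fold f [0..<i] s ''j'' 0 = length (bs @ cs)"
      by auto
    obtain ds \<sigma>2 where 2: "Inv (Suc i) ((bs @ cs) @ ds) \<sigma>2"
      "\<And>s. Ok s \<Longrightarrow> s x 0 = i \<Longrightarrow> St i \<sigma>1 s \<Longrightarrow> s ''j'' 0 = length (bs @ cs) \<Longrightarrow> ext s ((bs @ cs) @ ds) \<Longrightarrow>
        St (Suc i) \<sigma>2 (den q s) \<and> den q s ''j'' 0 = length ((bs @ cs) @ ds)"
      using step[OF _ 1(1)] Suc.prems by auto
    have "St (Suc i) \<sigma>2 (fold f [0..<Suc i] s) \<and> fold f [0..<Suc i] s ''j'' 0 = length (bs @ cs @ ds)"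
      if s: "Ok s" "St 0 \<sigma> s" "s ''j'' 0 = length bs" "ext s (bs @ cs @ ds)" for s
    proof -
      define s1 where "s1 = fold f [0..<i] s"
      have e: "ext s (bs @ cs)" by (rule ext_append[of s _ ds]) (use s(4) in simp)
      have s1: "St i \<sigma>1 s1" "s1 ''j'' 0 = length (bs @ cs)" using 1(2)[OF s(1-3) e] by (simp_all add: s1_def)
      define s2 where "s2 = upd s1 x 0 i"
      have z: "s2 z = s z" if "z \<notin> insert x (asg q)" for z
        using fr[OF that, of i s] that by (simp add: s2_def s1_def upd_other)
      have "Ok s2" by (rule frame[OF s(1)]) (rule z)
      moreover have "ext s2 ((bs @ cs) @ ds)" using s(4) ext_cong[of s2 s] z[OF x(2)] by simp
      moreover have "St i \<sigma>1 s2" using St[OF s1(1)] by (simp add: s2_def)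
      moreover have "s2 x 0 = i" "s2 ''j'' 0 = length (bs @ cs)" using s1(2) x(1) by (simp_all add: s2_def)
      ultimately have "St (Suc i) \<sigma>2 (den q s2) \<and> den q s2 ''j'' 0 = length ((bs @ cs) @ ds)" by (intro 2(2))
      moreover have "fold f [0..<Suc i] s = den q s2" by (simp add: f_def s2_def s1_def)
      ultimately show ?thesis by simp
    qed
    then show ?case using 2(1) by (intro exI[of _ "cs @ ds"] exI[of _ \<sigma>2]) simp
  qed
  then obtain cs \<sigma>' where *: "Inv N (bs @ cs) \<sigma>'"
      "\<And>s. Ok s \<Longrightarrow> St 0 \<sigma> s \<Longrightarrow> s ''j'' 0 = length bs \<Longrightarrow> ext s (bs @ cs) \<Longrightarrow>
        St N \<sigma>' (fold f [0..<N] s) \<and> fold f [0..<N] s ''j'' 0 = length (bs @ cs)"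
    by blast
  have "den (FFor x y q) s = upd (fold f [0..<N] s) x 0 N" if "Ok s" for s
    using N[OF that] by (simp add: den_For f_def)
  then show ?thesis using * x(1) by (intro exI[of _ cs] exI[of _ \<sigma>']) (auto intro: St)
qed

section \<open>Colourings around two isolated vertices\<close>

definition cand_ab :: fprog where
  "cand_ab = FAssign ''j'' (Const 0) (Const 0) ;; FFor ''v'' ''n''
     (FCond (adj (V ''a'') (V ''v'')) (FAssign ''col'' (V ''v'') (Const 1))
       (FCond (adj (V ''b'') (V ''v'')) (FAssign ''col'' (V ''v'') (Const 0))
         (FAssign ''col'' (V ''v'') (Cell ''g'' (V ''j'')) ;; FAssign ''j'' (Const 0) (Plus (V ''j'') (Const 1)))))"

lemma asg_cand_ab [simp]: "asg cand_ab = {''j'', ''v'', ''col''}"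
  by (auto simp: cand_ab_def)

lemma cand_ab_complete:
  assumes "a \<le> n" "b \<le> n" "\<And>v. v < n \<Longrightarrow> {a, v} \<in> E \<Longrightarrow> T v"
    "\<And>v. v < n \<Longrightarrow> {a, v} \<notin> E \<Longrightarrow> {b, v} \<in> E \<Longrightarrow> \<not> T v"
  shows "\<exists>bs. length bs \<le> card {v. v < n \<and> {a, v} \<notin> E \<and> {b, v} \<notin> E} \<and>
    (\<forall>s. env n E k s \<and> s ''a'' 0 = a \<and> s ''b'' 0 = b \<and> ext s bs \<longrightarrow>
      (\<forall>v<n. (0 < den cand_ab s ''col'' v) = T v))"
proof -
  let ?p = "(FCond (adj (V ''a'') (V ''v'')) (FAssign ''col'' (V ''v'') (Const 1))
       (FCond (adj (V ''b'') (V ''v'')) (FAssign ''col'' (V ''v'') (Const 0))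
         (FAssign ''col'' (V ''v'') (Cell ''g'' (V ''j'')) ;; FAssign ''j'' (Const 0) (Plus (V ''j'') (Const 1)))))"
  let ?Ok = "\<lambda>s. env n E k s \<and> s ''a'' 0 = a \<and> s ''b'' 0 = b"
  let ?Inv = "\<lambda>i (bs :: bool list) (_::unit). length bs \<le> card {v. v < i \<and> {a, v} \<notin> E \<and> {b, v} \<notin> E}"
  let ?St = "\<lambda>i (_::unit) s. \<forall>v<i. (0 < s ''col'' v) = T v"
  have "\<exists>cs \<sigma>'. ?Inv n ([] @ cs) \<sigma>' \<and>
      (\<forall>s. ?Ok s \<and> ?St 0 () s \<and> s ''j'' 0 = length ([] :: bool list) \<and> ext s ([] @ cs) \<longrightarrow>
        ?St n \<sigma>' (den (FFor ''v'' ''n'' ?p) s) \<and> den (FFor ''v'' ''n'' ?p) s ''j'' 0 = length ([] @ cs))"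
  proof (rule den_For_oracle[where Ok = ?Ok and Inv = ?Inv and St = ?St])
    fix s s' assume "?Ok s" "\<And>z. z \<notin> insert ''v'' (asg ?p) \<Longrightarrow> s' z = s z"
    then show "?Ok s'"
      using env_frame[of n E k s "insert ''v'' (asg ?p)" s'] by (auto simp: env_vars_def)
  next
    fix i bs \<sigma> assume i: "i < n" and I: "?Inv i bs \<sigma>"
    let ?z = "{a, i} \<notin> E \<and> {b, i} \<notin> E"
    let ?cs = "if ?z then [T i] else []"
    have "?Inv (Suc i) (bs @ ?cs) ()" using I by (auto simp: Collect_less_Suc_conj)
    moreover have "?St (Suc i) () (den ?p s) \<and> den ?p s ''j'' 0 = length (bs @ ?cs)"
      if s: "?Ok s" "s ''v'' 0 = i" "?St i \<sigma> s" "s ''j'' 0 = length bs" "ext s (bs @ ?cs)" for s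
    proof -
      have e: "env n E k s" using s(1) by simp
      have adj: "bval (adj (V ''a'') (V ''v'')) s \<longleftrightarrow> {a, i} \<in> E" "bval (adj (V ''b'') (V ''v'')) s \<longleftrightarrow> {b, i} \<in> E"
        using bval_adj[OF e, of "V ''a''" "V ''v''"] bval_adj[OF e, of "V ''b''" "V ''v''"] s(1,2) i assms(1,2) by auto
      have "?z \<Longrightarrow> s ''g'' (length bs) = of_bool (T i)" using s(5) ext_nth[of s bs "T i" "[]"] by simp
      then show ?thesis
        using adj s(2-4) assms(3,4)[OF i] by (auto simp: less_Suc_eq)
    qed
    ultimately show "\<exists>cs \<sigma>'. ?Inv (Suc i) (bs @ cs) \<sigma>' \<and>
      (\<forall>s. ?Ok s \<and> s ''v'' 0 = i \<and> ?St i \<sigma> s \<and> s ''j'' 0 = length bs \<and> ext s (bs @ cs) \<longrightarrow>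
        ?St (Suc i) \<sigma>' (den ?p s) \<and> den ?p s ''j'' 0 = length (bs @ cs))"
      by (intro exI[of _ ?cs] exI[of _ "()"]) blast
  qed (auto simp: env_def)
  then obtain bs where bs: "length bs \<le> card {v. v < n \<and> {a, v} \<notin> E \<and> {b, v} \<notin> E}"
    "\<And>s. ?Ok s \<Longrightarrow> s ''j'' 0 = 0 \<Longrightarrow> ext s bs \<Longrightarrow> \<forall>v<n. (0 < den (FFor ''v'' ''n'' ?p) s ''col'' v) = T v"
    by auto
  have "\<forall>v<n. (0 < den cand_ab s ''col'' v) = T v" if s: "?Ok s" "ext s bs" for s
  proof -
    define s0 where "s0 = upd s ''j'' 0 0"
    have "?Ok s0" using s(1) env_upd[of n E k s "''j''"] by (simp add: s0_def env_vars_def)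
    moreover have "ext s0 bs" using s(2) by (simp add: s0_def ext_def)
    ultimately have "\<forall>v<n. (0 < den (FFor ''v'' ''n'' ?p) s0 ''col'' v) = T v"
      by (intro bs(2)) (simp_all add: s0_def)
    then show ?thesis by (simp add: cand_ab_def s0_def)
  qed
  then show ?thesis using bs(1) by blast
qed

section \<open>Counting in a solution\<close>

lemma component_self [simp]: "v \<in> component E T v"
  by (simp add: component_def)

lemma component_eqI: "v \<in> component E T u \<Longrightarrow> component E T v = component E T u"
  by (auto simp: component_eq_iff in_component_iff dest: conn_sym)

lemma component_edge: "{u, v} \<in> E \<Longrightarrow> T u = T v \<Longrightarrow> component E T u = component E T v"
  by (simp add: component_eq_iff conn_edge mono_edges_iff)

lemma component_colour: "component E T u = component E T v \<Longrightarrow> T u = T v"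
  by (simp add: component_eq_iff conn_mono_colour)

lemma component_isolated:
  assumes "\<And>v. {a, v} \<in> E \<Longrightarrow> T v \<noteq> T a"
  shows "component E T a = {a}"
proof -
  have "v = a" if "(a, v) \<in> conn (mono_edges E T)" for v
    using that by (induction rule: conn_induct) (use assms in \<open>auto simp: mono_edges_iff\<close>)
  then show ?thesis by (auto simp: component_def)
qed

lemma finite_colour_class [simp]: "finite (colour_class n T b)"
  by (simp add: colour_class_def)

lemma card_colour_classes: "card (colour_class n T False) + card (colour_class n T True) = n"
proof -
  have "colour_class n T False \<union> colour_class n T True = {..<n}" "colour_class n T False \<inter> colour_class n T True = {}"
    by (auto simp: colour_class_def)
  then show ?thesis using card_Un_disjoint[of "colour_class n T False" "colour_class n T True"] by simp
qed

lemma ncomp_sum: "ncomp n E T False + ncomp n E T True = card (component E T ` {..<n})"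
proof -
  have "component E T ` colour_class n T False \<inter> component E T ` colour_class n T True = {}"
    by (auto simp: colour_class_def dest: component_colour)
  moreover have "{..<n} = colour_class n T False \<union> colour_class n T True" by (auto simp: colour_class_def)
  ultimately show ?thesis unfolding ncomp_def
    by (simp only: image_Un) (simp add: card_Un_disjoint)
qed

lemma ncomp_le: "ncomp n E T b \<le> card (colour_class n T b)"
  unfolding ncomp_def by (rule card_image_le) simp

text \<open>Otherwise every component of colour \<open>b\<close> has at least two vertices, so this
  colour class alone has at least \<open>ncomp n E T b\<close>, hence more than \<open>k\<close>,
  vertices in excess of its components. That exceeds the budget.\<close>

lemma ex_isolated:
  assumes "simple_graph ({..<n}, E)" "sol bal n E k T" "k < ncomp n E T b"
  shows "\<exists>a<n. T a = b \<and> (\<forall>v. {a, v} \<in> E \<longrightarrow> T v \<noteq> T a)"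
proof (rule ccontr)
  assume no: "\<not> ?thesis"
  let ?S = "colour_class n T b" and ?c = "component E T"
  have "2 \<le> card {x \<in> ?S. ?c x = y}" if y: "y \<in> ?c ` ?S" for y
  proof -
    obtain a where a: "a < n" "T a = b" "y = ?c a" using y by (auto simp: colour_class_def)
    then obtain v where v: "{a, v} \<in> E" "T v = T a" using no by blast
    then have "v < n" "a \<noteq> v" "?c v = ?c a" using edge_less[OF assms(1)] component_edge[OF v(1)] by auto
    then have "{a, v} \<subseteq> {x \<in> ?S. ?c x = y}" using a v by (auto simp: colour_class_def)
    then have "card {a, v} \<le> card {x \<in> ?S. ?c x = y}" by (intro card_mono) auto
    then show ?thesis using \<open>a \<noteq> v\<close> by simp
  qed
  then have "(\<Sum>y\<in>?c ` ?S. 2) \<le> (\<Sum>y\<in>?c ` ?S. card {x \<in> ?S. ?c x = y})" by (intro sum_mono)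
  also have "\<dots> = card ?S"
    using sum.image_gen[of ?S "\<lambda>_. 1 :: nat" ?c] by simp
  finally have "2 * ncomp n E T b \<le> card ?S" by (simp add: ncomp_def)
  moreover have "ncomp n E T (\<not> b) \<le> card (colour_class n T (\<not> b))" by (rule ncomp_le)
  moreover have "card ?S + card (colour_class n T (\<not> b)) = n"
    "ncomp n E T b + ncomp n E T (\<not> b) = ncomp n E T False + ncomp n E T True"
    using card_colour_classes[of n T] by (cases b; simp)+
  moreover have "n \<le> k + ncomp n E T False + ncomp n E T True" using assms(2) by (simp add: sol_def)
  ultimately show False using assms(3) by linarith
qed

text \<open>The component of \<open>a\<close> is just \<open>{a}\<close>, so the edge that the
  biclique demands between the two components starts at \<open>a\<close>.\<close>

lemma isolated_meets:
  assumes "sol bal n E k T" "a < n" "v < n" "T a \<noteq> T v" "\<forall>v. {a, v} \<in> E \<longrightarrow> T v \<noteq> T a"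
  shows "\<exists>v'. {a, v'} \<in> E \<and> component E T v' = component E T v"
proof -
  have "component E T a = {a}" using assms(5) by (intro component_isolated) blast
  moreover have "\<exists>u'\<in>component E T a. \<exists>v'\<in>component E T v. {u', v'} \<in> E"
    using assms(1-4) unfolding sol_def by blast
  ultimately show ?thesis using component_eqI by auto
qed

text \<open>Every component meets \<open>N(a)\<close> or \<open>N(b)\<close>, the ones of colour 1
  the former and the ones of colour 0 the latter. Hence \<open>N(a) \<union> N(b)\<close> has at
  least as many vertices as there are components, which is at least \<open>n - k\<close>.\<close>

lemma card_undetermined:
  assumes G: "simple_graph ({..<n}, E)" and sol: "sol bal n E k T"
    and a: "a < n" "\<not> T a" "\<forall>v. {a, v} \<in> E \<longrightarrow> T v \<noteq> T a"
    and b: "b < n" "T b" "\<forall>v. {b, v} \<in> E \<longrightarrow> T v \<noteq> T b"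
  shows "card {v. v < n \<and> {a, v} \<notin> E \<and> {b, v} \<notin> E} \<le> k"
proof -
  let ?Z = "{v. v < n \<and> {a, v} \<notin> E \<and> {b, v} \<notin> E}" and ?N = "{v. {a, v} \<in> E \<or> {b, v} \<in> E}"
  have N: "?N \<subseteq> {..<n}" using edge_less[OF G] by auto
  have "component E T v \<in> component E T ` ?N" if vn: "v < n" for v
  proof (cases "T v")
    case True
    then obtain v' where "{a, v'} \<in> E" "component E T v' = component E T v"
      using isolated_meets[OF sol a(1) vn _ a(3)] a(2) by blast
    then show ?thesis by (intro image_eqI[of _ _ v']) auto
  next
    case False
    then obtain v' where "{b, v'} \<in> E" "component E T v' = component E T v"
      using isolated_meets[OF sol b(1) vn _ b(3)] b(2) by blast
    then show ?thesis by (intro image_eqI[of _ _ v']) auto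
  qed
  then have "component E T ` {..<n} \<subseteq> component E T ` ?N" by auto
  then have "card (component E T ` {..<n}) \<le> card (component E T ` ?N)"
    using finite_subset[OF N] by (intro card_mono) auto
  also have "\<dots> \<le> card ?N" using finite_subset[OF N] by (intro card_image_le) auto
  finally have "n \<le> k + card ?N" using sol ncomp_sum[of n E T] by (simp add: sol_def)
  moreover have "card ?Z + card ?N = card {..<n}"
  proof -
    have "{..<n} = ?Z \<union> ?N" using N by auto
    moreover have "card (?Z \<union> ?N) = card ?Z + card ?N"
      by (rule card_Un_disjoint) (use finite_subset[OF N] in auto)
    ultimately show ?thesis by (simp only:)
  qed
  ultimately show ?thesis by simp
qed

section \<open>Colourings around one isolated vertex\<close>

definition paint :: "string \<Rightarrow> fprog" where
  "paint x = FAssign ''p'' (V x) (Cell ''g'' (V ''j'')) ;; FAssign ''j'' (Const 0) (Plus (V ''j'') (Const 1))"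

text \<open>The branching acts on an edge none of whose ends has colour 1 yet (0 and 1 are colours,
  2 is uncoloured). The second end is guessed only if the first one has colour 0, since an end of
  colour 1 already settles the edge.\<close>

definition branch_step :: fprog where
  "branch_step = FCond (Conj (adj (V ''u'') (V ''v''))
       (Conj (Neg (Eq (Cell ''p'' (V ''u'')) (Const 1))) (Neg (Eq (Cell ''p'' (V ''v'')) (Const 1)))))
     (FCond (Eq (Cell ''p'' (V ''u'')) (Const 2)) (paint ''u'') FSkip ;;
      FCond (Conj (Eq (Cell ''p'' (V ''u'')) (Const 0)) (Eq (Cell ''p'' (V ''v'')) (Const 2))) (paint ''v'') FSkip)
     FSkip"

lemma asg_branch_step [simp]: "asg branch_step = {''p'', ''j''}"
  by (auto simp: branch_step_def paint_def)

text \<open>This and \<open>branch_state\<close> are the abstract run of \<open>branch_step\<close>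
  in which every answer is taken from \<open>T\<close>: the bits that are read and the partial
  colouring \<sigma> that results.\<close>

definition branch_bits :: "nat set set \<Rightarrow> (nat \<Rightarrow> bool) \<Rightarrow> nat \<Rightarrow> nat \<Rightarrow> (nat \<Rightarrow> nat) \<Rightarrow> bool list" where
  "branch_bits E T u v \<sigma> = (if {u, v} \<in> E \<and> \<sigma> u \<noteq> 1 \<and> \<sigma> v \<noteq> 1 then
     (if \<sigma> u = 2 then [T u] else []) @
     (if (\<sigma> u = 2 \<longrightarrow> \<not> T u) \<and> \<sigma> v = 2 then [T v] else []) else [])"

definition branch_state :: "nat set set \<Rightarrow> (nat \<Rightarrow> bool) \<Rightarrow> nat \<Rightarrow> nat \<Rightarrow> (nat \<Rightarrow> nat) \<Rightarrow> nat \<Rightarrow> nat" where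
  "branch_state E T u v \<sigma> = (if {u, v} \<in> E \<and> \<sigma> u \<noteq> 1 \<and> \<sigma> v \<noteq> 1 then
     (let \<tau> = (if \<sigma> u = 2 then \<sigma>(u := of_bool (T u)) else \<sigma>) in
      if \<tau> u = 0 \<and> \<tau> v = 2 then \<tau>(v := of_bool (T v)) else \<tau>) else \<sigma>)"

lemma den_branch_step:
  assumes "env n E k s" "s ''u'' 0 = u" "s ''v'' 0 = v" "u < n" "v < n"
    and p: "\<forall>w<n. s ''p'' w = \<sigma> w" and \<sigma>: "\<forall>w<n. \<sigma> w = 2 \<or> \<sigma> w = of_bool (T w)"
    and j: "s ''j'' 0 = length bs" "ext s (bs @ branch_bits E T u v \<sigma>)"
  shows "(\<forall>w<n. den branch_step s ''p'' w = branch_state E T u v \<sigma> w) \<and>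
    den branch_step s ''j'' 0 = length (bs @ branch_bits E T u v \<sigma>)"
proof (cases "{u, v} \<in> E \<and> \<sigma> u \<noteq> 1 \<and> \<sigma> v \<noteq> 1")
  case False
  then show ?thesis
    using bval_adj[OF assms(1), of "V ''u''" "V ''v''"] assms(2-5) p j
    by (auto simp: branch_step_def branch_state_def branch_bits_def)
next
  case True
  have uv: "u \<noteq> v" using edge_less[OF env_simple[OF assms(1)]] True by blast
  have pu: "s ''p'' u = \<sigma> u" "s ''p'' v = \<sigma> v" using p assms(4,5) by auto
  have b: "bval (Conj (adj (V ''u'') (V ''v''))
       (Conj (Neg (Eq (Cell ''p'' (V ''u'')) (Const 1))) (Neg (Eq (Cell ''p'' (V ''v'')) (Const 1))))) s"
    using bval_adj[OF assms(1), of "V ''u''" "V ''v''"] assms(2-5) pu True by simp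
  have g1: "s ''g'' (length bs) = of_bool (T u)" if "\<sigma> u = 2"
    using that True j(2) by (intro ext_nth[of s bs]) (simp add: branch_bits_def)
  have g2: "s ''g'' (length bs) = of_bool (T v)" if "\<sigma> u \<noteq> 2" "\<sigma> v = 2"
    using that True j(2) by (intro ext_nth[of s bs _ "[]"]) (simp add: branch_bits_def)
  have g3: "s ''g'' (Suc (length bs)) = of_bool (T v)" if "\<sigma> u = 2" "\<not> T u" "\<sigma> v = 2"
    using ext_nth[of s "bs @ [T u]" "T v" "[]"] that True j(2) by (simp add: branch_bits_def)
  have su: "\<sigma> u = 2 \<or> \<sigma> u = 0" using \<sigma> assms(4) True by (metis of_bool_eq(1,2))
  show ?thesis
  proof (cases "\<sigma> u = 2")
    case u2: True
    show ?thesis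
    proof (cases "\<sigma> v = 2 \<and> \<not> T u")
      case c: True
      then show ?thesis
        using b True uv pu g1 g3 u2 j(1) assms(2,3) p
        by (auto simp: branch_step_def branch_state_def branch_bits_def paint_def)
    next
      case c: False
      then show ?thesis
        using b True uv pu g1 u2 j(1) assms(2,3) p
        by (cases "T u") (auto simp: branch_step_def branch_state_def branch_bits_def paint_def)
    qed
  next
    case u0: False
    then show ?thesis
      using b True uv pu g2 su j(1) assms(2,3) p
      by (auto simp: branch_step_def branch_state_def branch_bits_def paint_def)
  qed
qed

text \<open>Each step that asks for bits lowers the budget of contractions: a vertex outside \<open>N(a)\<close> that gets
  colour 1 costs one contraction, as every component of colour 1 meets \<open>N(a)\<close>, and so does a vertex
  of colour 0 whose component has been seen before.\<close>

definition spent :: "nat \<Rightarrow> nat set set \<Rightarrow> (nat \<Rightarrow> bool) \<Rightarrow> nat \<Rightarrow> (nat \<Rightarrow> nat) \<Rightarrow> nat" where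
  "spent n E T a \<sigma> = card {v. v < n \<and> \<sigma> v = 1 \<and> {a, v} \<notin> E} +
     (card {v. v < n \<and> \<sigma> v = 0} - card (component E T ` {v. v < n \<and> \<sigma> v = 0}))"

text \<open>A vertex of colour 1 enters the first set of \<open>spent\<close>. A vertex of colour 0
  raises the number of vertices by one but the number of components seen by at most one, and not at
  all if its component was seen before.\<close>

lemma spent_paint:
  fixes T :: "nat \<Rightarrow> bool"
  assumes v: "v < n" "\<sigma> v = 2" "{a, v} \<notin> E"
  defines "\<tau> \<equiv> \<sigma>(v := of_bool (T v))"
  shows "spent n E T a \<sigma> \<le> spent n E T a \<tau>"
    and "T v \<Longrightarrow> spent n E T a \<tau> = Suc (spent n E T a \<sigma>)"
    and "u < n \<Longrightarrow> \<sigma> u = 0 \<Longrightarrow> component E T u = component E T v \<Longrightarrow> \<not> T v \<Longrightarrow>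
      spent n E T a \<tau> = Suc (spent n E T a \<sigma>)"
proof -
  let ?Y = "\<lambda>\<sigma>. {v. v < n \<and> \<sigma> v = 1 \<and> {a, v} \<notin> E}" and ?A = "\<lambda>\<sigma>. {v. v < n \<and> \<sigma> v = (0 :: nat)}"
  have le: "card (component E T ` ?A \<sigma>) \<le> card (?A \<sigma>)" by (rule card_image_le) simp
  {
    assume T: "T v"
    then have "?Y \<tau> = insert v (?Y \<sigma>)" "?A \<tau> = ?A \<sigma>" using v by (auto simp: \<tau>_def)
    moreover have "v \<notin> ?Y \<sigma>" using v by simp
    ultimately show "spent n E T a \<tau> = Suc (spent n E T a \<sigma>)" by (simp add: spent_def)
  } note 1 = this
  have A: "?Y \<tau> = ?Y \<sigma>" "?A \<tau> = insert v (?A \<sigma>)" "v \<notin> ?A \<sigma>" if "\<not> T v"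
    using that v by (auto simp: \<tau>_def)
  {
    assume u: "u < n" "\<sigma> u = 0" "component E T u = component E T v" and T: "\<not> T v"
    then have "component E T ` ?A \<tau> = component E T ` ?A \<sigma>" unfolding A(2)[OF T] by auto
    then show "spent n E T a \<tau> = Suc (spent n E T a \<sigma>)"
      using A[OF T] le by (simp add: spent_def)
  }
  show "spent n E T a \<sigma> \<le> spent n E T a \<tau>"
  proof (cases "T v")
    case False
    have "card (component E T ` ?A \<tau>) \<le> Suc (card (component E T ` ?A \<sigma>))"
      unfolding A(2)[OF False] image_insert by (simp add: card_insert_if)
    then show ?thesis using A[OF False] by (simp add: spent_def)
  qed (use 1 in simp)
qed

definition branch_inv :: "nat \<Rightarrow> nat set set \<Rightarrow> (nat \<Rightarrow> bool) \<Rightarrow> nat \<Rightarrow> bool list \<Rightarrow> (nat \<Rightarrow> nat) \<Rightarrow> bool" where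
  "branch_inv n E T a bs \<sigma> \<longleftrightarrow> (\<forall>v<n. \<sigma> v = 2 \<or> \<sigma> v = of_bool (T v)) \<and>
     (\<forall>v<n. {a, v} \<in> E \<longrightarrow> \<sigma> v = 1) \<and> length bs \<le> 2 * spent n E T a \<sigma>"

definition resolved :: "nat set set \<Rightarrow> (nat \<Rightarrow> nat) \<Rightarrow> nat \<Rightarrow> nat \<Rightarrow> bool" where
  "resolved E \<sigma> u v \<longleftrightarrow> ({u, v} \<in> E \<longrightarrow> \<sigma> u = 1 \<or> \<sigma> v = 1 \<or> \<sigma> u = 0 \<and> \<sigma> v = 0)"

lemma branch_state_keeps:
  "\<sigma> w \<noteq> 2 \<Longrightarrow> branch_state E T u v \<sigma> w = \<sigma> w"
  by (auto simp: branch_state_def Let_def)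

text \<open>Painting changes uncoloured vertices only, and a resolved edge depends on none of them.
  So a single pass over all pairs resolves every edge.\<close>

lemma resolved_keeps: "resolved E \<sigma> x y \<Longrightarrow> resolved E (branch_state E T u v \<sigma>) x y"
  unfolding resolved_def using branch_state_keeps[of \<sigma> _ E T u v]
  by (metis numeral_One numeral_eq_iff semiring_norm(85) zero_neq_numeral)

text \<open>A step that reads bits reads at most two of them and raises \<open>spent\<close> by at
  least one: the vertex painted last either gets colour 1 or joins a neighbour of colour 0 in the
  same component. This is the source of the factor 2 in \<open>branch_inv\<close>.\<close>

lemma branch_step_inv:
  fixes T :: "nat \<Rightarrow> bool"
  assumes G: "simple_graph ({..<n}, E)" and uv: "u < n" "v < n" and I: "branch_inv n E T a bs \<sigma>"
  defines "\<tau> \<equiv> branch_state E T u v \<sigma>"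
  shows "branch_inv n E T a (bs @ branch_bits E T u v \<sigma>) \<tau>" "resolved E \<tau> u v"
proof -
  have s2: "\<forall>v<n. \<sigma> v = 2 \<or> \<sigma> v = of_bool (T v)" and Na: "\<forall>v<n. {a, v} \<in> E \<longrightarrow> \<sigma> v = 1"
    and len: "length bs \<le> 2 * spent n E T a \<sigma>" using I by (auto simp: branch_inv_def)
  have su: "\<sigma> u = 2 \<or> \<sigma> u = of_bool (T u)" and sv: "\<sigma> v = 2 \<or> \<sigma> v = of_bool (T v)" using s2 uv by auto
  have *: "branch_inv n E T a (bs @ branch_bits E T u v \<sigma>) \<tau> \<and> resolved E \<tau> u v"
  proof (cases "{u, v} \<in> E \<and> \<sigma> u \<noteq> 1 \<and> \<sigma> v \<noteq> 1")
    case False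
    then show ?thesis using I by (auto simp: \<tau>_def branch_state_def branch_bits_def resolved_def)
  next
    case e: True
    have ne: "u \<noteq> v" using edge_less[OF G] e by blast
    have c: "component E T u = component E T v" if "T u = T v" using component_edge[of u v E T] that e by blast
    have ok: "\<forall>w<n. \<tau> w = 2 \<or> \<tau> w = of_bool (T w)" "\<forall>w<n. {a, w} \<in> E \<longrightarrow> \<tau> w = 1"
      using s2 Na branch_state_keeps[of \<sigma> _ E T u v] unfolding \<tau>_def
      by (auto simp: branch_state_def Let_def)
    have nu: "{a, w} \<notin> E" if "\<sigma> w = 2" "w < n" for w using Na that by auto
    show ?thesis
    proof (cases "\<sigma> u = 2")
      case u2: True
      define \<rho> where "\<rho> = \<sigma>(u := of_bool (T u))"
      note pu = spent_paint[where \<sigma> = \<sigma> and T = T and E = E and a = a, OF uv(1) u2 nu[OF u2 uv(1)], folded \<rho>_def]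
      show ?thesis
      proof (cases "T u")
        case True
        then have "\<tau> = \<rho>" "branch_bits E T u v \<sigma> = [True]" using e u2 by (auto simp: \<tau>_def branch_state_def branch_bits_def \<rho>_def)
        then show ?thesis using ok len pu(2)[OF True] True by (auto simp: branch_inv_def resolved_def \<rho>_def)
      next
        case Fu: False
        show ?thesis
        proof (cases "\<sigma> v = 2")
          case v2: True
          have t: "\<tau> = \<rho>(v := of_bool (T v))" "length (branch_bits E T u v \<sigma>) = 2"
            using e u2 v2 Fu ne by (auto simp: \<tau>_def branch_state_def branch_bits_def \<rho>_def)
          have "\<rho> v = 2" "\<rho> u = 0" using v2 ne Fu by (auto simp: \<rho>_def)
          note pv = spent_paint[where \<sigma> = \<rho> and T = T and E = E and a = a, OF uv(2) this(1) nu[OF v2 uv(2)], folded t(1)]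
          have "spent n E T a \<tau> = Suc (spent n E T a \<rho>)"
            using pv(2) pv(3)[OF uv(1) \<open>\<rho> u = 0\<close>] c Fu by blast
          then have "length bs + 2 \<le> 2 * spent n E T a \<tau>" using pu(1) len by linarith
          then show ?thesis using ok t by (auto simp: branch_inv_def resolved_def \<rho>_def Fu)
        next
          case v0: False
          then have "\<sigma> v = 0" "\<not> T v" using sv e by (auto split: if_splits)
          have t: "\<tau> = \<rho>" "length (branch_bits E T u v \<sigma>) = 1"
            using e u2 v0 Fu ne by (auto simp: \<tau>_def branch_state_def branch_bits_def \<rho>_def)
          have "spent n E T a \<tau> = Suc (spent n E T a \<sigma>)"
            unfolding t(1) using pu(3)[OF uv(2) \<open>\<sigma> v = 0\<close>] c Fu \<open>\<not> T v\<close> by simp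
          then show ?thesis using ok t len \<open>\<sigma> v = 0\<close> ne Fu by (auto simp: branch_inv_def resolved_def \<rho>_def)
        qed
      qed
    next
      case u0: False
      then have u0': "\<sigma> u = 0" "\<not> T u" using su e by (auto split: if_splits)
      show ?thesis
      proof (cases "\<sigma> v = 2")
        case v2: True
        have t: "\<tau> = \<sigma>(v := of_bool (T v))" "length (branch_bits E T u v \<sigma>) = 1"
          using e u0' v2 ne by (auto simp: \<tau>_def branch_state_def branch_bits_def)
        note pv = spent_paint[where \<sigma> = \<sigma> and T = T and E = E and a = a, OF uv(2) v2 nu[OF v2 uv(2)], folded t(1)]
        have "spent n E T a \<tau> = Suc (spent n E T a \<sigma>)"
          using pv(2) pv(3)[OF uv(1) u0'(1)] c u0'(2) by blast
        then show ?thesis using ok t len u0' ne by (auto simp: branch_inv_def resolved_def)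
      next
        case v0: False
        then have "\<sigma> v = 0" using sv e by (auto split: if_splits)
        then have "\<tau> = \<sigma>" "branch_bits E T u v \<sigma> = []"
          using u0' e by (auto simp: \<tau>_def branch_state_def branch_bits_def)
        then show ?thesis using I u0' \<open>\<sigma> v = 0\<close> by (auto simp: resolved_def)
      qed
    qed
  qed
  then show "branch_inv n E T a (bs @ branch_bits E T u v \<sigma>) \<tau>" "resolved E \<tau> u v" by auto
qed

text \<open>Both summands count vertices in excess of components. In colour 1 every component meets
  \<open>N(a)\<close>, so vertices outside \<open>N(a)\<close> are surplus; in colour 0 the painted
  vertices are surplus as far as they outnumber the components they meet. The total surplus is at
  most \<open>k\<close>.\<close>

lemma spent_le:
  assumes G: "simple_graph ({..<n}, E)" and sol: "sol bal n E k T"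
    and a: "a < n" "\<not> T a" "\<forall>v. {a, v} \<in> E \<longrightarrow> T v \<noteq> T a"
    and \<sigma>: "\<forall>v<n. \<sigma> v = 2 \<or> \<sigma> v = of_bool (T v)"
  shows "spent n E T a \<sigma> \<le> k"
proof -
  let ?A = "colour_class n T False" and ?B = "colour_class n T True" and ?c = "component E T"
  let ?Y = "{v. v < n \<and> \<sigma> v = 1 \<and> {a, v} \<notin> E}" and ?Z = "{v. v < n \<and> \<sigma> v = 0}" and ?N = "{v. {a, v} \<in> E}"
  have \<sigma>1: "T v" if "v < n" "\<sigma> v = 1" for v
    using \<sigma> that by (cases "T v") auto
  have \<sigma>0: "\<not> T v" if "v < n" "\<sigma> v = 0" for v
    using \<sigma> that by (cases "T v") auto
  have N: "?N \<subseteq> ?B" using a edge_less[OF G] by (auto simp: colour_class_def)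
  have "?c ` ?B \<subseteq> ?c ` ?N"
  proof
    fix y assume "y \<in> ?c ` ?B"
    then obtain v where v: "v < n" "T v" "y = ?c v" by (auto simp: colour_class_def)
    then obtain v' where "{a, v'} \<in> E" "?c v' = ?c v"
      using isolated_meets[OF sol a(1) v(1) _ a(3)] a(2) by blast
    then show "y \<in> ?c ` ?N" using v by (intro image_eqI[of _ _ v']) auto
  qed
  moreover have finN: "finite ?N" using N by (rule finite_subset) simp
  ultimately have "ncomp n E T True \<le> card (?c ` ?N)" unfolding ncomp_def by (intro card_mono) auto
  also have "\<dots> \<le> card ?N" using finN by (rule card_image_le)
  finally have 1: "ncomp n E T True \<le> card ?N" .
  have "?Y \<subseteq> ?B - ?N" using \<sigma>1 by (auto simp: colour_class_def)
  then have "card ?Y \<le> card (?B - ?N)" by (intro card_mono) auto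
  also have "\<dots> = card ?B - card ?N" using N finN by (intro card_Diff_subset) auto
  finally have 2: "card ?Y + card ?N \<le> card ?B" using card_mono[OF _ N] by simp
  have Z: "?Z \<subseteq> ?A" using \<sigma>0 by (auto simp: colour_class_def)
  have "?c ` ?A \<subseteq> ?c ` ?Z \<union> ?c ` (?A - ?Z)" by auto
  then have "card (?c ` ?A) \<le> card (?c ` ?Z \<union> ?c ` (?A - ?Z))" by (intro card_mono) auto
  also have "\<dots> \<le> card (?c ` ?Z) + card (?c ` (?A - ?Z))" by (rule card_Un_le)
  also have "card (?c ` (?A - ?Z)) \<le> card (?A - ?Z)" by (rule card_image_le) simp
  also have "card (?A - ?Z) = card ?A - card ?Z" using Z by (intro card_Diff_subset) auto
  finally have 3: "ncomp n E T False \<le> card (?c ` ?Z) + (card ?A - card ?Z)" by (simp add: ncomp_def)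
  have 4: "card ?Z \<le> card ?A" using card_mono[OF _ Z] by simp
  have 5: "card (?c ` ?Z) \<le> card ?Z" by (rule card_image_le) simp
  have "n \<le> k + ncomp n E T False + ncomp n E T True" using sol by (simp add: sol_def)
  then show ?thesis unfolding spent_def
    using 1 2 3 4 5 card_colour_classes[of n T] by linarith
qed

definition branch :: fprog where
  "branch = FFor ''u'' ''n'' (FFor ''v'' ''n'' branch_step)"

lemma branch_complete:
  assumes G: "simple_graph ({..<n}, E)" and I: "branch_inv n E T a bs \<sigma>"
  shows "\<exists>cs \<sigma>'. branch_inv n E T a (bs @ cs) \<sigma>' \<and> (\<forall>u<n. \<forall>v<n. resolved E \<sigma>' u v) \<and>
    (\<forall>s. env n E k s \<and> (\<forall>v<n. s ''p'' v = \<sigma> v) \<and> s ''j'' 0 = length bs \<and> ext s (bs @ cs) \<longrightarrow>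
      (\<forall>v<n. den branch s ''p'' v = \<sigma>' v) \<and> den branch s ''j'' 0 = length (bs @ cs))"
proof -
  let ?St = "\<lambda>(_::nat) \<sigma> s. \<forall>v<n. s ''p'' v = (\<sigma> v :: nat)"
  let ?Inv = "\<lambda>i bs \<sigma>. branch_inv n E T a bs \<sigma> \<and> (\<forall>u<i. \<forall>v<n. resolved E \<sigma> u v)"
  have "\<exists>cs \<sigma>'. ?Inv n (bs @ cs) \<sigma>' \<and>
    (\<forall>s. env n E k s \<and> ?St 0 \<sigma> s \<and> s ''j'' 0 = length bs \<and> ext s (bs @ cs) \<longrightarrow>
      ?St n \<sigma>' (den (FFor ''u'' ''n'' (FFor ''v'' ''n'' branch_step)) s) \<and>
      den (FFor ''u'' ''n'' (FFor ''v'' ''n'' branch_step)) s ''j'' 0 = length (bs @ cs))"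
  proof (rule den_For_oracle[where Ok = "env n E k" and Inv = ?Inv and St = ?St])
    fix s s' assume "env n E k s" "\<And>z. z \<notin> insert ''u'' (asg (FFor ''v'' ''n'' branch_step)) \<Longrightarrow> s' z = s z"
    then show "env n E k s'"
      using env_frame[of n E k s "insert ''u'' (asg (FFor ''v'' ''n'' branch_step))" s'] by (auto simp: env_vars_def)
  next
    fix u bs \<sigma> assume u: "u < n" and Iu: "?Inv u bs \<sigma>"
    let ?InvI = "\<lambda>i bs \<sigma>. ?Inv u bs \<sigma> \<and> (\<forall>v<i. resolved E \<sigma> u v)"
    let ?Ok = "\<lambda>s. env n E k s \<and> s ''u'' 0 = u"
    have "\<exists>cs \<sigma>'. ?InvI n (bs @ cs) \<sigma>' \<and>
      (\<forall>s. ?Ok s \<and> ?St 0 \<sigma> s \<and> s ''j'' 0 = length bs \<and> ext s (bs @ cs) \<longrightarrow>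
        ?St n \<sigma>' (den (FFor ''v'' ''n'' branch_step) s) \<and>
        den (FFor ''v'' ''n'' branch_step) s ''j'' 0 = length (bs @ cs))"
    proof (rule den_For_oracle[where Ok = ?Ok and Inv = ?InvI and St = ?St])
      fix s s' assume "?Ok s" "\<And>z. z \<notin> insert ''v'' (asg branch_step) \<Longrightarrow> s' z = s z"
      then show "?Ok s'"
        using env_frame[of n E k s "insert ''v'' (asg branch_step)" s'] by (auto simp: env_vars_def)
    next
      fix v bs \<sigma> assume v: "v < n" and Iv: "?InvI v bs \<sigma>"
      let ?cs = "branch_bits E T u v \<sigma>" and ?\<tau> = "branch_state E T u v \<sigma>"
      have b: "branch_inv n E T a bs \<sigma>" using Iv by blast
      have "?InvI (Suc v) (bs @ ?cs) ?\<tau>"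
        using branch_step_inv[OF G u v b] Iv resolved_keeps by (auto simp: less_Suc_eq)
      moreover have "?St (Suc v) ?\<tau> (den branch_step s) \<and> den branch_step s ''j'' 0 = length (bs @ ?cs)"
        if "?Ok s \<and> s ''v'' 0 = v \<and> ?St v \<sigma> s \<and> s ''j'' 0 = length bs \<and> ext s (bs @ ?cs)" for s
        using that u v b by (intro den_branch_step) (auto simp: branch_inv_def)
      ultimately show "\<exists>cs \<sigma>'. ?InvI (Suc v) (bs @ cs) \<sigma>' \<and>
        (\<forall>s. ?Ok s \<and> s ''v'' 0 = v \<and> ?St v \<sigma> s \<and> s ''j'' 0 = length bs \<and> ext s (bs @ cs) \<longrightarrow>
        ?St (Suc v) \<sigma>' (den branch_step s) \<and> den branch_step s ''j'' 0 = length (bs @ cs))"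
        by blast
    qed (use Iu in \<open>auto simp: env_def\<close>)
    then obtain cs \<sigma>' where *: "?InvI n (bs @ cs) \<sigma>'" "\<And>s. ?Ok s \<Longrightarrow> ?St 0 \<sigma> s \<Longrightarrow> s ''j'' 0 = length bs \<Longrightarrow>
        ext s (bs @ cs) \<Longrightarrow> ?St n \<sigma>' (den (FFor ''v'' ''n'' branch_step) s) \<and>
        den (FFor ''v'' ''n'' branch_step) s ''j'' 0 = length (bs @ cs)"
      by blast
    have "?Inv (Suc u) (bs @ cs) \<sigma>'" using *(1) by (simp add: less_Suc_eq)
    then show "\<exists>cs \<sigma>'. ?Inv (Suc u) (bs @ cs) \<sigma>' \<and>
        (\<forall>s. env n E k s \<and> s ''u'' 0 = u \<and> ?St u \<sigma> s \<and> s ''j'' 0 = length bs \<and> ext s (bs @ cs) \<longrightarrow>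
        ?St (Suc u) \<sigma>' (den (FFor ''v'' ''n'' branch_step) s) \<and>
        den (FFor ''v'' ''n'' branch_step) s ''j'' 0 = length (bs @ cs))"
      using *(2) by blast
  qed (use I in \<open>auto simp: env_def\<close>)
  then show ?thesis unfolding branch_def by blast
qed

text \<open>\<open>p v = 2\<close> marks \<open>v\<close> as uncoloured; \<open>cd\<close> guesses which of the vertices already coloured 1 belong
  to one fixed component of that colour.\<close>

definition init_p :: fprog where
  "init_p = FFor ''v'' ''n'' (FCond (adj (V ''a'') (V ''v''))
     (FAssign ''p'' (V ''v'') (Const 1)) (FAssign ''p'' (V ''v'') (Const 2)))"

definition guess_cd :: fprog where
  "guess_cd = FFor ''v'' ''n'' (FCond (Eq (Cell ''p'' (V ''v'')) (Const 1))
     (FAssign ''cd'' (V ''v'') (Cell ''g'' (V ''j'')) ;; FAssign ''j'' (Const 0) (Plus (V ''j'') (Const 1))) FSkip)"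

definition look :: fprog where
  "look = FAssign ''c0'' (Const 0) (Const 0) ;; FAssign ''c1'' (Const 0) (Const 0) ;;
     FFor ''v'' ''n'' (FCond (Conj (adj (V ''w'') (V ''v'')) (Eq (Cell ''p'' (V ''v'')) (Const 1)))
       (FCond (Less (Const 0) (Cell ''cd'' (V ''v''))) (FAssign ''c1'' (Const 0) (Const 1))
         (FAssign ''c0'' (Const 0) (Const 1))) FSkip)"

definition finish :: fprog where
  "finish = FFor ''w'' ''n'' (FCond (Eq (Cell ''p'' (V ''w'')) (Const 2))
     (look ;; FCond (Conj (Less (Const 0) (V ''c0'')) (Less (Const 0) (V ''c1'')))
       (FAssign ''col'' (V ''w'') (Const 0)) (FAssign ''col'' (V ''w'') (Const 1)))
     (FAssign ''col'' (V ''w'') (Cell ''p'' (V ''w''))))"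

definition cand_a :: fprog where
  "cand_a = FAssign ''j'' (Const 0) (Const 0) ;; init_p ;; branch ;; guess_cd ;; finish"

lemma asg_cand_a [simp]: "asg init_p = {''v'', ''p''}" "asg branch = {''u'', ''v'', ''p'', ''j''}"
  "asg guess_cd = {''v'', ''cd'', ''j''}" "asg look = {''c0'', ''c1'', ''v''}"
  "asg finish = {''w'', ''c0'', ''c1'', ''v'', ''col''}"
  "asg cand_a = {''u'', ''v'', ''w'', ''p'', ''j'', ''cd'', ''c0'', ''c1'', ''col''}"
  by (auto simp: init_p_def branch_def guess_cd_def look_def finish_def cand_a_def)

lemma den_init_p:
  assumes "env n E k s" "s ''a'' 0 = a" "a \<le> n"
  shows "\<forall>v<n. den init_p s ''p'' v = (if {a, v} \<in> E then 1 else 2)"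
  unfolding init_p_def
proof (rule den_For_induct[where I = "\<lambda>i s. \<forall>v<i. s ''p'' v = (if {a, v} \<in> E then 1 else 2)"])
  let ?p = "FCond (adj (V ''a'') (V ''v''))
     (FAssign ''p'' (V ''v'') (Const 1)) (FAssign ''p'' (V ''v'') (Const 2))"
  fix i s' assume i: "i < s ''n'' 0" and I: "\<forall>v<i. s' ''p'' v = (if {a, v} \<in> E then 1 else 2)"
    and fr: "\<And>z. z \<notin> insert ''v'' (asg ?p) \<Longrightarrow> s' z = s z"
  have e: "env n E k (upd s' ''v'' 0 i)"
    by (rule env_upd, rule env_frame[OF assms(1)], erule fr) (auto simp: env_vars_def)
  have "s' ''a'' 0 = a" using fr[of "''a''"] assms(2) by simp
  moreover have "i < n" using i assms(1) by (simp add: env_def)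
  ultimately show "\<forall>v<Suc i. den ?p (upd s' ''v'' 0 i) ''p'' v = (if {a, v} \<in> E then 1 else 2)"
    using bval_adj[OF e, of "V ''a''" "V ''v''"] I assms(3) by (simp add: less_Suc_eq)
qed (use assms(1) in \<open>auto simp: env_def\<close>)

lemma guess_cd_complete:
  assumes "\<forall>v<n. \<sigma> v = 1 \<longrightarrow> T v" "length bs = l"
  shows "\<exists>cs. length cs \<le> card (colour_class n T True) \<and>
    (\<forall>s. env n E k s \<and> (\<forall>v<n. s ''p'' v = \<sigma> v) \<and> s ''j'' 0 = l \<and> ext s (bs @ cs) \<longrightarrow>
      (\<forall>v<n. \<sigma> v = 1 \<longrightarrow> (0 < den guess_cd s ''cd'' v) = D v))"
proof -
  let ?p = "FCond (Eq (Cell ''p'' (V ''v'')) (Const 1))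
     (FAssign ''cd'' (V ''v'') (Cell ''g'' (V ''j'')) ;; FAssign ''j'' (Const 0) (Plus (V ''j'') (Const 1))) FSkip"
  let ?Ok = "\<lambda>s. env n E k s \<and> (\<forall>v<n. s ''p'' v = \<sigma> v)"
  let ?Inv = "\<lambda>i (cs :: bool list) (_::unit). length cs \<le> length bs + card {v. v < i \<and> T v}"
  let ?St = "\<lambda>i (_::unit) s. \<forall>v<i. \<sigma> v = 1 \<longrightarrow> (0 < s ''cd'' v) = D v"
  have "\<exists>cs \<sigma>'. ?Inv n (bs @ cs) \<sigma>' \<and>
      (\<forall>s. ?Ok s \<and> ?St 0 () s \<and> s ''j'' 0 = length bs \<and> ext s (bs @ cs) \<longrightarrow>
        ?St n \<sigma>' (den (FFor ''v'' ''n'' ?p) s) \<and> den (FFor ''v'' ''n'' ?p) s ''j'' 0 = length (bs @ cs))"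
  proof (rule den_For_oracle[where Ok = ?Ok and Inv = ?Inv and St = ?St])
    fix s s' assume "?Ok s" "\<And>z. z \<notin> insert ''v'' (asg ?p) \<Longrightarrow> s' z = s z"
    then show "?Ok s'"
      using env_frame[of n E k s "insert ''v'' (asg ?p)" s'] by (auto simp: env_vars_def)
  next
    fix i bs \<tau> assume i: "i < n" and I: "?Inv i bs \<tau>"
    let ?cs = "if \<sigma> i = 1 then [D i] else []"
    have "?Inv (Suc i) (bs @ ?cs) ()" using I assms(1) i by (auto simp: Collect_less_Suc_conj)
    moreover have "?St (Suc i) () (den ?p s) \<and> den ?p s ''j'' 0 = length (bs @ ?cs)"
      if s: "?Ok s" "s ''v'' 0 = i" "?St i \<tau> s" "s ''j'' 0 = length bs" "ext s (bs @ ?cs)" for s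
    proof -
      have "\<sigma> i = 1 \<Longrightarrow> s ''g'' (length bs) = of_bool (D i)" using s(5) ext_nth[of s bs "D i" "[]"] by simp
      moreover have "s ''p'' i = \<sigma> i" using s(1) i by simp
      ultimately show ?thesis using s(2-4) by (auto simp: less_Suc_eq)
    qed
    ultimately show "\<exists>cs \<sigma>'. ?Inv (Suc i) (bs @ cs) \<sigma>' \<and>
      (\<forall>s. ?Ok s \<and> s ''v'' 0 = i \<and> ?St i \<tau> s \<and> s ''j'' 0 = length bs \<and> ext s (bs @ cs) \<longrightarrow>
        ?St (Suc i) \<sigma>' (den ?p s) \<and> den ?p s ''j'' 0 = length (bs @ cs))"
      by (intro exI[of _ ?cs] exI[of _ "()"]) blast
  qed (auto simp: env_def)
  then obtain cs where cs: "length (bs @ cs) \<le> length bs + card {v. v < n \<and> T v}"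
    "\<And>s. ?Ok s \<Longrightarrow> s ''j'' 0 = length bs \<Longrightarrow> ext s (bs @ cs) \<Longrightarrow>
       \<forall>v<n. \<sigma> v = 1 \<longrightarrow> (0 < den (FFor ''v'' ''n'' ?p) s ''cd'' v) = D v"
    by auto
  show ?thesis
    using cs assms(2) by (intro exI[of _ cs]) (auto simp: guess_cd_def colour_class_def)
qed

lemma den_look:
  assumes "env n E k s" "s ''w'' 0 = w" "w < n" "\<forall>v<n. s ''p'' v = \<sigma> v"
    and "\<forall>v<n. \<sigma> v = 1 \<longrightarrow> (0 < s ''cd'' v) = D v"
  shows "0 < den look s ''c0'' 0 \<longleftrightarrow> (\<exists>v<n. {w, v} \<in> E \<and> \<sigma> v = 1 \<and> \<not> D v)"
    and "0 < den look s ''c1'' 0 \<longleftrightarrow> (\<exists>v<n. {w, v} \<in> E \<and> \<sigma> v = 1 \<and> D v)"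
proof -
  let ?p = "FCond (Conj (adj (V ''w'') (V ''v'')) (Eq (Cell ''p'' (V ''v'')) (Const 1)))
       (FCond (Less (Const 0) (Cell ''cd'' (V ''v''))) (FAssign ''c1'' (Const 0) (Const 1))
         (FAssign ''c0'' (Const 0) (Const 1))) FSkip"
  define s0 where "s0 = upd (upd s ''c0'' 0 0) ''c1'' 0 0"
  have n: "s0 ''n'' 0 = n" using assms(1) by (simp add: s0_def env_def)
  have body: "den ?p (upd s' ''v'' 0 i) ''c0'' 0 = (if {w, i} \<in> E \<and> \<sigma> i = 1 \<and> \<not> D i then 1 else s' ''c0'' 0) \<and>
     den ?p (upd s' ''v'' 0 i) ''c1'' 0 = (if {w, i} \<in> E \<and> \<sigma> i = 1 \<and> D i then 1 else s' ''c1'' 0)"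
    if i: "i < s0 ''n'' 0" and fr: "\<And>z. z \<notin> insert ''v'' (asg ?p) \<Longrightarrow> s' z = s0 z" for i s'
  proof -
    define s1 where "s1 = upd s' ''v'' 0 i"
    have s1: "s1 z = s z" if "z \<notin> {''v'', ''c0'', ''c1''}" for z
      using that fr[of z] by (simp add: s1_def s0_def upd_other)
    have e: "env n E k s1"
      by (rule env_frame[OF assms(1), of "{''v'', ''c0'', ''c1''}"]) (use s1 in \<open>auto simp: env_vars_def\<close>)
    have "s1 ''w'' 0 = w" "s1 ''p'' i = \<sigma> i" "\<sigma> i = 1 \<Longrightarrow> (0 < s1 ''cd'' i) = D i"
      "s1 ''v'' 0 = i" "s1 ''c0'' 0 = s' ''c0'' 0" "s1 ''c1'' 0 = s' ''c1'' 0"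
      using assms s1 i n by (simp_all add: s1_def)
    then show ?thesis unfolding s1_def[symmetric]
      using bval_adj[OF e, of "V ''w''" "V ''v''"] assms(3) i n by auto
  qed
  have eq: "den look s = den (FFor ''v'' ''n'' ?p) s0" "s0 ''c0'' 0 = 0" "s0 ''c1'' 0 = 0"
    by (simp_all add: look_def s0_def)
  have if01: "0 < (if b then 1 else 0 :: nat) \<longleftrightarrow> b" for b by simp
  have "den (FFor ''v'' ''n'' ?p) s0 ''c0'' 0 =
      (if \<exists>v<s0 ''n'' 0. {w, v} \<in> E \<and> \<sigma> v = 1 \<and> \<not> D v then 1 else s0 ''c0'' 0)"
    by (rule den_For_flag) (use body in auto)
  then show "0 < den look s ''c0'' 0 \<longleftrightarrow> (\<exists>v<n. {w, v} \<in> E \<and> \<sigma> v = 1 \<and> \<not> D v)"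
    unfolding eq n by (simp only: if01)
  have "den (FFor ''v'' ''n'' ?p) s0 ''c1'' 0 =
      (if \<exists>v<s0 ''n'' 0. {w, v} \<in> E \<and> \<sigma> v = 1 \<and> D v then 1 else s0 ''c1'' 0)"
    by (rule den_For_flag) (use body in auto)
  then show "0 < den look s ''c1'' 0 \<longleftrightarrow> (\<exists>v<n. {w, v} \<in> E \<and> \<sigma> v = 1 \<and> D v)"
    unfolding eq n by (simp only: if01)
qed

lemma den_finish:
  assumes "env n E k s" "\<forall>v<n. s ''p'' v = \<sigma> v" "\<forall>v<n. \<sigma> v = 1 \<longrightarrow> (0 < s ''cd'' v) = D v"
  shows "\<forall>w<n. (0 < den finish s ''col'' w) = (if \<sigma> w = 2 then
     \<not> ((\<exists>v<n. {w, v} \<in> E \<and> \<sigma> v = 1 \<and> \<not> D v) \<and> (\<exists>v<n. {w, v} \<in> E \<and> \<sigma> v = 1 \<and> D v)) else 0 < \<sigma> w)"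
proof -
  define R where "R w = (if \<sigma> w = 2 then
     \<not> ((\<exists>v<n. {w, v} \<in> E \<and> \<sigma> v = 1 \<and> \<not> D v) \<and> (\<exists>v<n. {w, v} \<in> E \<and> \<sigma> v = 1 \<and> D v)) else 0 < \<sigma> w)" for w
  let ?p = "FCond (Eq (Cell ''p'' (V ''w'')) (Const 2))
     (look ;; FCond (Conj (Less (Const 0) (V ''c0'')) (Less (Const 0) (V ''c1'')))
       (FAssign ''col'' (V ''w'') (Const 0)) (FAssign ''col'' (V ''w'') (Const 1)))
     (FAssign ''col'' (V ''w'') (Cell ''p'' (V ''w'')))"
  have "\<forall>w<n. (0 < den (FFor ''w'' ''n'' ?p) s ''col'' w) = R w"
  proof (rule den_For_induct[where I = "\<lambda>i s. \<forall>w<i. (0 < s ''col'' w) = R w"])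
    fix i s' assume i: "i < s ''n'' 0" and I: "\<forall>w<i. (0 < s' ''col'' w) = R w"
      and fr: "\<And>z. z \<notin> insert ''w'' (asg ?p) \<Longrightarrow> s' z = s z"
    define s1 where "s1 = upd s' ''w'' 0 i"
    have i': "i < n" using i assms(1) by (simp add: env_def)
    have s1: "s1 z = s z" if "z \<notin> {''w'', ''c0'', ''c1'', ''v'', ''col''}" for z
      using that fr[of z] by (simp add: s1_def upd_other)
    have e: "env n E k s1"
      by (rule env_frame[OF assms(1), of "{''w'', ''c0'', ''c1'', ''v'', ''col''}"]) (use s1 in \<open>auto simp: env_vars_def\<close>)
    have w: "s1 ''w'' 0 = i" and c: "s1 ''col'' = s' ''col''" by (simp_all add: s1_def upd_other)
    have p: "\<forall>v<n. s1 ''p'' v = \<sigma> v" "\<forall>v<n. \<sigma> v = 1 \<longrightarrow> (0 < s1 ''cd'' v) = D v"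
      using assms(2,3) s1 by simp_all
    define s2 where "s2 = den look s1"
    have s2: "s2 ''w'' = s1 ''w''" "s2 ''col'' = s1 ''col''" unfolding s2_def by (rule den_frame; simp)+
    have lk: "(0 < s2 ''c0'' 0) = (\<exists>v<n. {i, v} \<in> E \<and> \<sigma> v = 1 \<and> \<not> D v)"
      "(0 < s2 ''c1'' 0) = (\<exists>v<n. {i, v} \<in> E \<and> \<sigma> v = 1 \<and> D v)"
      unfolding s2_def using den_look[OF e w i' p] by blast+
    have R: "R i = (if \<sigma> i = 2 then \<not> (0 < s2 ''c0'' 0 \<and> 0 < s2 ''c1'' 0) else 0 < \<sigma> i)"
      unfolding R_def lk ..
    have "(0 < den ?p s1 ''col'' i) = R i" "\<forall>w. w \<noteq> i \<longrightarrow> den ?p s1 ''col'' w = s' ''col'' w"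
      using R p i' w c s2 by (auto simp: s2_def[symmetric])
    then show "\<forall>w<Suc i. (0 < den ?p s1 ''col'' w) = R w" using I by (auto simp: less_Suc_eq)
  qed (use assms(1) in \<open>auto simp: env_def\<close>)
  then show ?thesis unfolding finish_def R_def .
qed

text \<open>Once all edges outside \<open>N(a)\<close> are resolved, an uncoloured vertex sees only vertices of colour 1.
  If its own colour is 1, all of these lie in its component; if it is 0, it is isolated and must be
  adjacent to every component of colour 1, of which there are at least two.\<close>

lemma cand_a_complete:
  assumes G: "simple_graph ({..<n}, E)" and sol: "sol bal n E k T"
    and a: "a < n" "\<not> T a" "\<forall>v. {a, v} \<in> E \<longrightarrow> T v \<noteq> T a"
    and t: "2 \<le> ncomp n E T True" "ncomp n E T True \<le> k"
  shows "\<exists>bs. length bs \<le> 4 * k \<and> (\<forall>s. env n E k s \<and> s ''a'' 0 = a \<and> ext s bs \<longrightarrow>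
      (\<forall>v<n. (0 < den cand_a s ''col'' v) = T v))"
proof -
  define \<sigma>0 where "\<sigma>0 = (\<lambda>v. if {a, v} \<in> E then 1 else 2 :: nat)"
  have "branch_inv n E T a [] \<sigma>0" using a(2,3) by (auto simp: branch_inv_def \<sigma>0_def)
  from branch_complete[where k = k, OF G this] obtain bs \<sigma> where inv: "branch_inv n E T a bs \<sigma>"
    and res: "\<And>u v. u < n \<Longrightarrow> v < n \<Longrightarrow> resolved E \<sigma> u v"
    and br: "\<And>s. env n E k s \<Longrightarrow> \<forall>v<n. s ''p'' v = \<sigma>0 v \<Longrightarrow> s ''j'' 0 = 0 \<Longrightarrow> ext s bs \<Longrightarrow>
      (\<forall>v<n. den branch s ''p'' v = \<sigma> v) \<and> den branch s ''j'' 0 = length bs"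
    by auto
  have \<sigma>: "\<forall>v<n. \<sigma> v = 2 \<or> \<sigma> v = of_bool (T v)" and len: "length bs \<le> 2 * spent n E T a \<sigma>"
    using inv by (auto simp: branch_inv_def)
  have \<sigma>1: "\<forall>v<n. \<sigma> v = 1 \<longrightarrow> T v" using \<sigma> by (metis numeral_One numeral_eq_iff of_bool_eq(1) semiring_norm(85) zero_neq_one)
  let ?c = "component E T"
  have "colour_class n T True \<noteq> {}" using t(1) by (auto simp: ncomp_def)
  then obtain b0 where b0: "b0 < n" "T b0" by (auto simp: colour_class_def)
  obtain b1 where b1: "b1 < n" "T b1" "?c b1 \<noteq> ?c b0"
  proof (rule ccontr)
    assume no: "\<not> thesis"
    have "?c ` colour_class n T True \<subseteq> {?c b0}"
      using no that by (auto simp: colour_class_def)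
    then have "ncomp n E T True \<le> card {?c b0}" unfolding ncomp_def by (intro card_mono) auto
    then show False using t(1) by simp
  qed
  define D where "D v \<longleftrightarrow> ?c v = ?c b0" for v
  obtain cs where cs: "length cs \<le> card (colour_class n T True)"
    "\<And>s. env n E k s \<Longrightarrow> \<forall>v<n. s ''p'' v = \<sigma> v \<Longrightarrow> s ''j'' 0 = length bs \<Longrightarrow> ext s (bs @ cs) \<Longrightarrow>
      \<forall>v<n. \<sigma> v = 1 \<longrightarrow> (0 < den guess_cd s ''cd'' v) = D v"
    using guess_cd_complete[where bs = bs and E = E and k = k and D = D, OF \<sigma>1 refl] by blast
  \<comment> \<open>Colour 0 has at least as many vertices as components, which leaves at most
    \<open>k + t\<close>, hence \<open>2 * k\<close>, vertices of colour 1. These bits together with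
    the \<open>2 * k\<close> of the branching make \<open>4 * k\<close>.\<close>
  have "card (colour_class n T True) \<le> k + ncomp n E T True"
    using sol ncomp_le[of n E T False] card_colour_classes[of n T] by (simp add: sol_def)
  then have "length (bs @ cs) \<le> 4 * k"
    using len spent_le[OF G sol a \<sigma>] cs(1) t(2) by simp
  moreover have "\<forall>v<n. (0 < den cand_a s ''col'' v) = T v"
    if s: "env n E k s" "s ''a'' 0 = a" "ext s (bs @ cs)" for s
  proof -
    define s1 where "s1 = upd s ''j'' 0 0"
    define s2 where "s2 = den init_p s1"
    define s3 where "s3 = den branch s2"
    define s4 where "s4 = den guess_cd s3"
    have e1: "env n E k s1" unfolding s1_def by (rule env_upd[OF s(1)]) (simp add: env_vars_def)
    have e2: "env n E k s2" unfolding s2_def by (rule env_den[OF e1]) (auto simp: env_vars_def)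
    have e3: "env n E k s3" unfolding s3_def by (rule env_den[OF e2]) (auto simp: env_vars_def)
    have e4: "env n E k s4" unfolding s4_def by (rule env_den[OF e3]) (auto simp: env_vars_def)
    have g2: "s2 ''g'' = s ''g''" "s2 ''j'' 0 = 0"
      using den_frame[of "''g''" init_p s1] den_frame[of "''j''" init_p s1] by (simp_all add: s2_def s1_def upd_other)
    have g3: "s3 ''g'' = s ''g''" using den_frame[of "''g''" branch s2] g2 by (simp add: s3_def)
    have p2: "\<forall>v<n. s2 ''p'' v = \<sigma>0 v"
      unfolding s2_def \<sigma>0_def using den_init_p[OF e1] s(2) a(1) by (simp add: s1_def)
    have ext2: "ext s2 bs" "ext s3 (bs @ cs)"
      using s(3) ext_append[of s bs cs] ext_cong[of s2 s bs] ext_cong[of s3 s "bs @ cs"] g2(1) g3 by simp_all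
    have p3: "\<forall>v<n. s3 ''p'' v = \<sigma> v" "s3 ''j'' 0 = length bs"
      using br[OF e2 p2 g2(2) ext2(1)] by (simp_all add: s3_def)
    have p4: "\<forall>v<n. s4 ''p'' v = \<sigma> v" using p3(1) den_frame[of "''p''" guess_cd s3] by (simp add: s4_def)
    have cd: "\<forall>v<n. \<sigma> v = 1 \<longrightarrow> (0 < s4 ''cd'' v) = D v"
      using cs(2)[OF e3 p3 ext2(2)] by (simp add: s4_def)
    have col: "den cand_a s = den finish s4" by (simp add: cand_a_def s1_def s2_def s3_def s4_def)
    show ?thesis
    proof (intro allI impI)
      fix w assume w: "w < n"
      have fin: "(0 < den cand_a s ''col'' w) = (if \<sigma> w = 2 then
         \<not> ((\<exists>v<n. {w, v} \<in> E \<and> \<sigma> v = 1 \<and> \<not> D v) \<and> (\<exists>v<n. {w, v} \<in> E \<and> \<sigma> v = 1 \<and> D v)) else 0 < \<sigma> w)"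
        using den_finish[OF e4 p4 cd] w unfolding col by blast
      show "(0 < den cand_a s ''col'' w) = T w"
      proof (cases "\<sigma> w = 2")
        case False
        then have "\<sigma> w = of_bool (T w)" using \<sigma> w by blast
        then show ?thesis using fin False by simp
      next
        case True
        have nb: "v < n \<and> \<sigma> v = 1" if "{w, v} \<in> E" for v
          using res[of w v] that True w edge_less[OF G that] by (auto simp: resolved_def)
        show ?thesis
        proof (cases "T w")
          case Tw: True
          have "D v = (?c w = ?c b0)" if "{w, v} \<in> E" for v
            using component_edge[OF that, of T] nb[OF that] \<sigma>1 Tw by (auto simp: D_def)
          then show ?thesis using fin True Tw by auto
        next
          case Fw: False
          have iso: "\<forall>v. {w, v} \<in> E \<longrightarrow> T v \<noteq> T w" using nb \<sigma>1 Fw by blast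
          obtain v0 where "{w, v0} \<in> E" "?c v0 = ?c b0"
            using isolated_meets[OF sol w b0(1) _ iso] Fw b0(2) by blast
          moreover obtain v1 where "{w, v1} \<in> E" "?c v1 = ?c b1"
            using isolated_meets[OF sol w b1(1) _ iso] Fw b1(2) by blast
          ultimately show ?thesis using fin True Fw nb b1(3) unfolding D_def by metis
        qed
      qed
    qed
  qed
  ultimately show ?thesis by blast
qed

section \<open>Connected vertex covers\<close>

text \<open>\<open>tree E v S c\<close>: a tree with root \<open>v\<close> and \<open>c\<close> edges spans \<open>S\<close>.  The two subtrees
  that are joined need not be disjoint, so \<open>c + 1\<close> is only an upper bound for the size of \<open>S\<close>.\<close>

inductive tree :: "nat set set \<Rightarrow> nat \<Rightarrow> nat set \<Rightarrow> nat \<Rightarrow> bool" for E where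
  root: "tree E v {v} 0"
| join: "tree E v S c \<Longrightarrow> tree E u S' c' \<Longrightarrow> {v, u} \<in> E \<Longrightarrow> tree E v (S \<union> S') (c + c' + 1)"

text \<open>The new vertex is hung onto \<open>x\<close> inside the subtree that contains
  \<open>x\<close>, so the root stays the same.\<close>

lemma tree_grow: "tree E v S c \<Longrightarrow> x \<in> S \<Longrightarrow> {x, y} \<in> E \<Longrightarrow> tree E v (insert y S) (Suc c)"
proof (induction rule: tree.induct)
  case (root v)
  then show ?case using tree.join[OF tree.root[of E v] tree.root[of E y]] by (simp add: insert_commute)
next
  case (join v S c u S' c')
  show ?case
  proof (cases "x \<in> S")
    case True
    then show ?thesis using tree.join[OF join.IH(1) join.hyps(2,3)] join.prems by simp
  next
    case False
    then have "tree E u (insert y S') (Suc c')" using join by simp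
    from tree.join[OF join.hyps(1) this join.hyps(3)] show ?thesis by simp
  qed
qed

lemma tree_card: "tree E v S c \<Longrightarrow> finite S \<and> card S \<le> c + 1 \<and> v \<in> S"
proof (induction rule: tree.induct)
  case (join v S c u S' c')
  then show ?case using card_Un_le[of S S'] by auto
qed auto

lemma tree_less:
  assumes "simple_graph ({..<n}, E)" "tree E v S c" "v < n"
  shows "S \<subseteq> {..<n}"
  using assms(2,3) by (induction rule: tree.induct) (use edge_less[OF assms(1)] in auto)

lemma tree_conn:
  assumes "tree E v S c" "\<forall>x\<in>S. T x"
  shows "\<forall>x\<in>S. (v, x) \<in> conn (mono_edges E T)"
  using assms
proof (induction rule: tree.induct)
  case (join v S c u S' c')
  have "T v" "T u" using tree_card join by auto
  then have "(v, u) \<in> conn (mono_edges E T)" using join by (simp add: conn_edge mono_edges_iff)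
  then show ?case using join by (auto intro: conn_trans)
qed simp

lemma conn_crossing:
  assumes "(v, w) \<in> conn F" "v \<in> S" "w \<notin> S"
  shows "\<exists>x\<in>S. \<exists>y. y \<notin> S \<and> {x, y} \<in> F \<and> (v, y) \<in> conn F"
  using assms
proof (induction rule: conn_induct)
  case (step y z)
  show ?case
  proof (cases "y \<in> S")
    case True
    then show ?thesis using step conn_trans[OF step(1) conn_edge[OF step(2)]] by blast
  qed (use step in blast)
qed simp

text \<open>Take a maximal connected set \<open>S\<close> through \<open>v\<close> that swallows no
  component of colour 0. Maximality forces \<open>S\<close> to contain all of colour 1 and to leave
  out exactly one vertex of each component of colour 0. The vertices left out lie in different
  components, so no two are adjacent and \<open>S\<close> is a vertex cover; their number is
  \<open>ncomp n E T False\<close>, so \<open>S\<close> has at most \<open>k + 1\<close>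
  vertices.\<close>

lemma sol_connected_cover:
  assumes G: "simple_graph ({..<n}, E)" and sol: "sol bal n E k T"
    and t: "ncomp n E T True = 1"
  shows "\<exists>v S c. v < n \<and> tree E v S c \<and> c \<le> k \<and> (\<forall>x y. {x, y} \<in> E \<longrightarrow> x \<in> S \<or> y \<in> S)"
proof -
  let ?C = "component E T"
  obtain C where "?C ` colour_class n T True = {C}"
    using t by (auto simp: ncomp_def card_1_singleton_iff)
  then have C: "?C w = C" if "w < n" "T w" for w
    using that by (auto simp: colour_class_def)
  have "colour_class n T True \<noteq> {}" using t by (auto simp: ncomp_def)
  then obtain v where v: "v < n" "T v" by (auto simp: colour_class_def)
  have one: "?C w = ?C v" if "w < n" "T w" for w
    using C[OF that] C[OF v] by simp
  \<comment> \<open>Connectedness is recorded by a tree with one edge less than \<open>S\<close> has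
    vertices, so that the bound on \<open>card S\<close> turns into one on the number of
    edges.\<close>
  define P where "P S \<longleftrightarrow> tree E v S (card S - 1) \<and> S \<subseteq> {..<n} \<and>
      (\<forall>x<n. \<not> T x \<longrightarrow> (\<exists>y\<in>?C x. y \<notin> S))" for S
  have "P {v}"
    unfolding P_def
  proof (intro conjI allI impI)
    show "tree E v {v} (card {v} - 1)" using tree.root by simp
    show "\<exists>y\<in>?C x. y \<notin> {v}" if "\<not> T x" for x using v(2) that by (intro bexI[of _ x]) auto
  qed (use v in simp)
  moreover have "finite {S. P S}" by (rule finite_subset[of _ "Pow {..<n}"]) (auto simp: P_def)
  ultimately obtain S where S: "P S" and max: "\<And>S'. P S' \<Longrightarrow> S \<subseteq> S' \<Longrightarrow> S = S'"
    using finite_has_maximal[of "{S. P S}"] by blast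
  have tr: "tree E v S (card S - 1)" and Sn: "S \<subseteq> {..<n}" and out: "\<And>x. x < n \<Longrightarrow> \<not> T x \<Longrightarrow> \<exists>y\<in>?C x. y \<notin> S"
    using S by (auto simp: P_def)
  have fin: "finite S" and vS: "v \<in> S" using tree_card[OF tr] by auto
  \<comment> \<open>By maximality, adding \<open>y\<close> swallows a component of colour 0, so
    \<open>y\<close> is the last vertex of that component outside \<open>S\<close>.\<close>
  have bdry: "\<not> T y \<and> (\<forall>y'\<in>?C y. y' \<notin> S \<longrightarrow> y' = y)" if xy: "x \<in> S" "y \<notin> S" "{x, y} \<in> E" for x y
  proof -
    have yn: "y < n" using edge_less[OF G xy(3)] by blast
    have "card S > 0" using fin vS by (auto simp: card_gt_0_iff)
    then have "tree E v (insert y S) (card (insert y S) - 1)"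
      using tree_grow[OF tr xy(1,3)] fin xy(2) by simp
    moreover have "\<not> P (insert y S)" using max[of "insert y S"] xy(2) by auto
    ultimately obtain z where z: "z < n" "\<not> T z" "\<forall>y'\<in>?C z. y' \<in> insert y S"
      using Sn yn unfolding P_def by blast
    obtain y' where "y' \<in> ?C z" "y' \<notin> S" using out[OF z(1,2)] by blast
    then have "y \<in> ?C z" using z(3) by auto
    then have "?C y = ?C z" by (rule component_eqI)
    then show ?thesis using z component_colour[of E T y z] by auto
  qed
  have B: "w \<in> S" if w: "w < n" "T w" for w
  proof (rule ccontr)
    assume "w \<notin> S"
    moreover have "(v, w) \<in> conn (mono_edges E T)" using one[OF w] by (simp add: component_eq_iff[symmetric])
    ultimately obtain x y where xy: "x \<in> S" "y \<notin> S" "{x, y} \<in> mono_edges E T" "(v, y) \<in> conn (mono_edges E T)"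
      using conn_crossing vS by metis
    then have "T y" using conn_mono_colour v(2) by blast
    then show False using bdry[OF xy(1,2)] xy(3) by (simp add: mono_edges_iff)
  qed
  \<comment> \<open>Some edge leads from \<open>S\<close> to a vertex of this component outside
    \<open>S\<close>: a crossing edge inside the component if \<open>S\<close> already meets it, and
    otherwise the edge that the biclique provides to the component of \<open>v\<close>, which lies
    in \<open>S\<close>. Then \<open>bdry\<close> applies.\<close>
  have uniq: "y1 = y2" if y: "z < n" "\<not> T z" "y1 \<in> ?C z" "y1 \<notin> S" "y2 \<in> ?C z" "y2 \<notin> S" for z y1 y2
  proof -
    have "\<exists>x\<in>S. \<exists>y\<in>?C z. y \<notin> S \<and> {x, y} \<in> E"
    proof (cases "\<exists>x. x \<in> ?C z \<and> x \<in> S")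
      case True
      then obtain x' where x': "x' \<in> ?C z" "x' \<in> S" by blast
      have "?C x' = ?C y1" using component_eqI x'(1) y(3) by metis
      then have "(x', y1) \<in> conn (mono_edges E T)" by (simp add: component_eq_iff)
      from conn_crossing[OF this x'(2) y(4)] obtain x y where
        "x \<in> S" "y \<notin> S" "{x, y} \<in> mono_edges E T" "(x', y) \<in> conn (mono_edges E T)" by blast
      moreover from this have "y \<in> ?C z" using x'(1) by (auto simp: in_component_iff intro: conn_trans)
      ultimately show ?thesis by (auto simp: mono_edges_iff)
    next
      case False
      have "\<exists>u'\<in>?C z. \<exists>v'\<in>?C v. {u', v'} \<in> E" using sol y(1,2) v unfolding sol_def by blast
      then obtain u' v' where *: "u' \<in> ?C z" "v' \<in> ?C v" "{u', v'} \<in> E" by blast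
      have "T v'" using *(2) v(2) by (simp add: in_component_iff conn_mono_colour)
      moreover have "v' < n" using edge_less[OF G *(3)] by blast
      ultimately have "v' \<in> S" by (intro B)
      then show ?thesis using * False by (metis insert_commute)
    qed
    then obtain x y0 where x: "x \<in> S" "y0 \<in> ?C z" "y0 \<notin> S" "{x, y0} \<in> E" by blast
    have "?C y0 = ?C z" using x(2) by (rule component_eqI)
    then have "\<forall>y'\<in>?C z. y' \<notin> S \<longrightarrow> y' = y0" using bdry[OF x(1,3,4)] by simp
    then show ?thesis using y by blast
  qed
  let ?O = "{..<n} - S"
  have O: "x < n \<and> \<not> T x \<and> x \<notin> S" if "x \<in> ?O" for x using that B by auto
  have "inj_on ?C ?O"
  proof (rule inj_onI)
    fix x y assume xy: "x \<in> ?O" "y \<in> ?O" "?C x = ?C y"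
    have "y \<in> ?C x" unfolding xy(3) by simp
    then show "x = y" using uniq[of x x y] O[OF xy(1)] O[OF xy(2)] by simp
  qed
  then have "card ?O = card (?C ` ?O)" by (simp add: card_image)
  moreover have "?C ` ?O = ?C ` colour_class n T False"
  proof
    show "?C ` ?O \<subseteq> ?C ` colour_class n T False" using O by (auto simp: colour_class_def)
    show "?C ` colour_class n T False \<subseteq> ?C ` ?O"
    proof
      fix c assume "c \<in> ?C ` colour_class n T False"
      then obtain x where x: "x < n" "\<not> T x" "c = ?C x" by (auto simp: colour_class_def)
      then obtain y where y: "y \<in> ?C x" "y \<notin> S" using out by blast
      then have "y < n" using conn_mono_less[OF G _ x(1)] by (auto simp: in_component_iff)
      then show "c \<in> ?C ` ?O" using component_eqI[OF y(1)] y(2) x(3) by (intro image_eqI[of _ _ y]) auto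
    qed
  qed
  ultimately have "card ?O = ncomp n E T False" by (simp add: ncomp_def)
  moreover have "card ?O = n - card S" using card_Diff_subset[OF fin Sn] by simp
  moreover have "card S \<le> n" using card_mono[OF _ Sn] by simp
  moreover have "n \<le> k + ncomp n E T False + 1" using sol t by (simp add: sol_def)
  ultimately have "card S - 1 \<le> k" by linarith
  moreover have "x \<in> S \<or> y \<in> S" if xy: "{x, y} \<in> E" for x y
  proof (rule ccontr)
    assume no: "\<not> (x \<in> S \<or> y \<in> S)"
    have e: "x < n" "y < n" "x \<noteq> y" using edge_less[OF G xy] by auto
    then have "\<not> T x" "\<not> T y" using B no by auto
    moreover from this have "?C x = ?C y" using xy by (intro component_edge) auto
    then have "y \<in> ?C x" by simp
    ultimately show False using uniq[of x x y] e no by simp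
  qed
  ultimately show ?thesis using v(1) tr by blast
qed

text \<open>Vertices outside a cover are independent and hence singleton components, and the
  neighbour that \<open>iso\<close> gives each of them lies in \<open>S\<close>, which is one
  component. Nothing controls the balance of this colouring, hence the argument
  \<open>False\<close>.\<close>

lemma connected_cover_sol:
  assumes G: "simple_graph ({..<n}, E)" and tr: "tree E v S c" "v < n" "c \<le> k"
    and cover: "\<And>x y. {x, y} \<in> E \<Longrightarrow> x \<in> S \<or> y \<in> S"
    and iso: "\<And>x. x < n \<Longrightarrow> \<exists>y. {x, y} \<in> E"
  shows "sol False n E k (\<lambda>x. x \<in> S)"
proof -
  let ?T = "\<lambda>x. x \<in> S"
  have Sn: "S \<subseteq> {..<n}" by (rule tree_less[OF G tr(1,2)])
  have S: "finite S" "card S \<le> c + 1" "v \<in> S" using tree_card[OF tr(1)] by auto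
  have single: "component E ?T x = {x}" if "x \<notin> S" for x
    using cover that by (intro component_isolated) auto
  have "colour_class n ?T False = {..<n} - S" by (auto simp: colour_class_def)
  moreover have "inj_on (component E ?T) ({..<n} - S)" using single by (auto simp: inj_on_def)
  ultimately have "ncomp n E ?T False = n - card S"
    using card_Diff_subset[OF S(1) Sn] by (simp add: ncomp_def card_image)
  moreover have "ncomp n E ?T True \<noteq> 0"
    using S(3) tr(2) by (auto simp: ncomp_def colour_class_def)
  ultimately have "n \<le> k + ncomp n E ?T False + ncomp n E ?T True" using S(2) tr(3) by linarith
  moreover have key: "\<exists>z\<in>component E ?T y. {x, z} \<in> E" if xy: "x < n" "x \<notin> S" "y \<in> S" for x y
  proof -
    obtain z where z: "{x, z} \<in> E" using iso xy(1) by blast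
    then have "z \<in> S" using cover xy(2) by blast
    then have "(v, z) \<in> conn (mono_edges E ?T)" "(v, y) \<in> conn (mono_edges E ?T)"
      using tree_conn[OF tr(1), of ?T] xy(3) by auto
    then have "z \<in> component E ?T y" unfolding in_component_iff by (meson conn_sym conn_trans)
    then show ?thesis using z by blast
  qed
  have "\<exists>u'\<in>component E ?T u. \<exists>v'\<in>component E ?T w. {u', v'} \<in> E"
    if uw: "u < n" "w < n" "(u \<in> S) \<noteq> (w \<in> S)" for u w
  proof (cases "u \<in> S")
    case True
    then obtain z where "z \<in> component E ?T u" "{w, z} \<in> E" using key[of w u] uw by blast
    then show ?thesis by (metis component_self insert_commute)
  next
    case False
    then obtain z where "z \<in> component E ?T w" "{u, z} \<in> E" using key[of u w] uw by blast
    then show ?thesis by (metis component_self)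
  qed
  ultimately show ?thesis by (simp add: sol_def)
qed

section \<open>Guessing a vertex cover\<close>

text \<open>The usual branching on an uncovered edge, with one bit for each chosen vertex.
  \<open>tm\<close> numbers the chosen vertices from 1, so that 0 is free to mean not
  chosen.\<close>

definition vc_step :: fprog where
  "vc_step = FCond (Conj (adj (V ''u'') (V ''v'')) (Conj (Eq (Cell ''tm'' (V ''u'')) (Const 0)) (Eq (Cell ''tm'' (V ''v'')) (Const 0))))
     (FCond (Less (Const 0) (Cell ''g'' (V ''j'')))
        (FAssign ''tm'' (V ''u'') (Plus (V ''j'') (Const 1))) (FAssign ''tm'' (V ''v'') (Plus (V ''j'') (Const 1))) ;;
      FAssign ''j'' (Const 0) (Plus (V ''j'') (Const 1))) FSkip"

definition vc :: fprog where
  "vc = FAssign ''j'' (Const 0) (Const 0) ;; FFor ''v'' ''n'' (FAssign ''tm'' (V ''v'') (Const 0)) ;;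
     FFor ''u'' ''n'' (FFor ''v'' ''n'' vc_step)"

lemma asg_vc [simp]: "asg vc_step = {''tm'', ''j''}" "asg vc = {''tm'', ''j'', ''u'', ''v''}"
  by (auto simp: vc_step_def vc_def)

lemma den_vc_step:
  assumes "env n E k s" "s ''u'' 0 = u" "s ''v'' 0 = v" "u < n" "v < n"
  shows "den vc_step s = (if {u, v} \<in> E \<and> s ''tm'' u = 0 \<and> s ''tm'' v = 0
    then upd (upd s ''tm'' (if 0 < s ''g'' (s ''j'' 0) then u else v) (Suc (s ''j'' 0))) ''j'' 0 (Suc (s ''j'' 0)) else s)"
  using bval_adj[OF assms(1), of "V ''u''" "V ''v''"] assms(2-5) by (auto simp: vc_step_def)

definition terms_ok :: "nat \<Rightarrow> mem \<Rightarrow> bool" where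
  "terms_ok n s \<longleftrightarrow> (\<forall>v<n. s ''tm'' v \<le> s ''j'' 0) \<and>
     (\<forall>u<n. \<forall>v<n. s ''tm'' u = s ''tm'' v \<and> 0 < s ''tm'' u \<longrightarrow> u = v)"

text \<open>Nothing is assumed about the bits: whichever end is chosen covers the edge, and chosen
  vertices are never dropped.\<close>

lemma den_vc_sound:
  assumes "env n E k s"
  defines "s1 \<equiv> den vc s"
  shows "terms_ok n s1 \<and> (\<forall>u<n. \<forall>v<n. {u, v} \<in> E \<longrightarrow> 0 < s1 ''tm'' u \<or> 0 < s1 ''tm'' v)"
proof -
  let ?cov = "\<lambda>s u v. {u, v} \<in> E \<longrightarrow> 0 < s ''tm'' u \<or> 0 < s ''tm'' v"
  define s0 where "s0 = den (FFor ''v'' ''n'' (FAssign ''tm'' (V ''v'') (Const 0))) (upd s ''j'' 0 0)"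
  have "\<forall>v<n. s0 ''tm'' v = 0"
    unfolding s0_def
    by (rule den_For_induct[where I = "\<lambda>i s1. \<forall>v<i. s1 ''tm'' v = 0"])
       (use assms(1) in \<open>auto simp: less_Suc_eq env_def\<close>)
  then have t0: "terms_ok n s0" by (simp add: terms_ok_def)
  have e0: "env n E k s0" unfolding s0_def
    by (rule env_den[OF env_upd[OF assms(1)]]) (auto simp: env_vars_def)
  have n0: "s0 ''n'' 0 = n" using e0 by (simp add: env_def)
  have step: "terms_ok n (den vc_step s) \<and> (\<forall>x. 0 < s ''tm'' x \<longrightarrow> 0 < den vc_step s ''tm'' x) \<and> ?cov (den vc_step s) u v"
    if "env n E k s" "s ''u'' 0 = u" "s ''v'' 0 = v" "u < n" "v < n" "terms_ok n s" for s u v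
  proof (cases "{u, v} \<in> E \<and> s ''tm'' u = 0 \<and> s ''tm'' v = 0")
    case True
    have "s ''tm'' x \<noteq> Suc (s ''j'' 0)" if "x < n" for x
      using \<open>terms_ok n s\<close> that unfolding terms_ok_def by (metis not_less_eq_eq order_refl)
    then show ?thesis using True that(6) unfolding den_vc_step[OF that(1-5)]
      by (auto simp: terms_ok_def le_SucI)
  next
    case False
    then show ?thesis using that(6) unfolding den_vc_step[OF that(1-5)] by auto
  qed
  have inner: "terms_ok n (den (FFor ''v'' ''n'' vc_step) s) \<and>
      (\<forall>x. 0 < s ''tm'' x \<longrightarrow> 0 < den (FFor ''v'' ''n'' vc_step) s ''tm'' x) \<and>
      (\<forall>v<n. ?cov (den (FFor ''v'' ''n'' vc_step) s) u v)"
    if "env n E k s" "s ''u'' 0 = u" "u < n" "terms_ok n s" for s u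
  proof (rule den_For_induct[where I = "\<lambda>i s1. terms_ok n s1 \<and> (\<forall>x. 0 < s ''tm'' x \<longrightarrow> 0 < s1 ''tm'' x) \<and> (\<forall>v<i. ?cov s1 u v)"])
    fix i s' assume i: "i < s ''n'' 0" and I: "terms_ok n s' \<and> (\<forall>x. 0 < s ''tm'' x \<longrightarrow> 0 < s' ''tm'' x) \<and> (\<forall>v<i. ?cov s' u v)"
      and fr: "\<And>z. z \<notin> insert ''v'' (asg vc_step) \<Longrightarrow> s' z = s z"
    define s2 where "s2 = upd s' ''v'' 0 i"
    have e: "env n E k s2" unfolding s2_def
      by (rule env_upd, rule env_frame[OF that(1)], erule fr) (auto simp: env_vars_def)
    have "s2 ''u'' 0 = u" "s2 ''v'' 0 = i" "i < n" "terms_ok n s2" "s2 ''tm'' = s' ''tm''"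
      using fr[of "''u''"] that(1,2) i I by (simp_all add: s2_def env_def terms_ok_def upd_other)
    then have "terms_ok n (den vc_step s2)" "\<forall>x. 0 < s' ''tm'' x \<longrightarrow> 0 < den vc_step s2 ''tm'' x" "?cov (den vc_step s2) u i"
      using step[of s2 u i, OF e] that(3) by auto
    then show "terms_ok n (den vc_step s2) \<and> (\<forall>x. 0 < s ''tm'' x \<longrightarrow> 0 < den vc_step s2 ''tm'' x) \<and>
        (\<forall>v<Suc i. ?cov (den vc_step s2) u v)"
      using I by (auto simp: less_Suc_eq) (metis not_gr_zero)+
  qed (use that in \<open>auto simp: env_def terms_ok_def\<close>)
  have "terms_ok n (den (FFor ''u'' ''n'' (FFor ''v'' ''n'' vc_step)) s0) \<and>
      (\<forall>u<n. \<forall>v<n. ?cov (den (FFor ''u'' ''n'' (FFor ''v'' ''n'' vc_step)) s0) u v)"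
  proof (rule den_For_induct[where I = "\<lambda>i s1. terms_ok n s1 \<and> (\<forall>u<i. \<forall>v<n. ?cov s1 u v)"])
    fix i s' assume i: "i < s0 ''n'' 0" and I: "terms_ok n s' \<and> (\<forall>u<i. \<forall>v<n. ?cov s' u v)"
      and fr: "\<And>z. z \<notin> insert ''u'' (asg (FFor ''v'' ''n'' vc_step)) \<Longrightarrow> s' z = s0 z"
    define s2 where "s2 = upd s' ''u'' 0 i"
    have e: "env n E k s2" unfolding s2_def
      by (rule env_upd, rule env_frame[OF e0], erule fr) (auto simp: env_vars_def)
    have "s2 ''u'' 0 = i" "i < n" "terms_ok n s2" "s2 ''tm'' = s' ''tm''"
      using i I n0 by (simp_all add: s2_def terms_ok_def upd_other)
    then have "terms_ok n (den (FFor ''v'' ''n'' vc_step) s2)"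
      "\<forall>x. 0 < s' ''tm'' x \<longrightarrow> 0 < den (FFor ''v'' ''n'' vc_step) s2 ''tm'' x"
      "\<forall>v<n. ?cov (den (FFor ''v'' ''n'' vc_step) s2) i v"
      using inner[of s2 i, OF e] by auto
    then show "terms_ok n (den (FFor ''v'' ''n'' vc_step) s2) \<and> (\<forall>u<Suc i. \<forall>v<n. ?cov (den (FFor ''v'' ''n'' vc_step) s2) u v)"
      using I by (auto simp: less_Suc_eq) (metis not_gr_zero)+
  qed (use t0 n0 in \<open>auto simp: terms_ok_def\<close>)
  moreover have "s1 = den (FFor ''u'' ''n'' (FFor ''v'' ''n'' vc_step)) s0"
    by (simp add: s1_def s0_def vc_def)
  ultimately show ?thesis by simp
qed

text \<open>The answers follow \<open>S\<close>: the end \<open>u\<close> is chosen if it lies in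
  \<open>S\<close>, and otherwise \<open>v\<close>, which then does because \<open>S\<close> is a
  cover. Each bit adds a new element of \<open>S\<close>, which bounds the number of bits.\<close>

lemma vc_complete:
  assumes G: "simple_graph ({..<n}, E)" and S: "finite S" and cover: "\<And>x y. {x, y} \<in> E \<Longrightarrow> x \<in> S \<or> y \<in> S"
  shows "\<exists>bs. length bs \<le> card S \<and> (\<forall>s. env n E k s \<and> ext s bs \<longrightarrow>
    (\<forall>v<n. 0 < den vc s ''tm'' v \<longrightarrow> v \<in> S) \<and> den vc s ''j'' 0 = length bs \<and>
    (\<forall>i<length bs. \<exists>v<n. den vc s ''tm'' v = Suc i))"
proof -
  let ?St = "\<lambda>(_::nat) \<sigma> s. \<forall>v<n. s ''tm'' v = (\<sigma> v :: nat)"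
  let ?Inv = "\<lambda>(_::nat) (bs :: bool list) \<sigma>. (\<forall>v<n. 0 < \<sigma> v \<longrightarrow> v \<in> S) \<and> length bs = card {v. v < n \<and> 0 < \<sigma> v} \<and>
    (\<forall>i<length bs. \<exists>v<n. \<sigma> v = Suc i)"
  have "\<exists>cs \<sigma>'. ?Inv n ([] @ cs) \<sigma>' \<and>
    (\<forall>s. env n E k s \<and> ?St 0 (\<lambda>_. 0) s \<and> s ''j'' 0 = length ([] :: bool list) \<and> ext s ([] @ cs) \<longrightarrow>
      ?St n \<sigma>' (den (FFor ''u'' ''n'' (FFor ''v'' ''n'' vc_step)) s) \<and>
      den (FFor ''u'' ''n'' (FFor ''v'' ''n'' vc_step)) s ''j'' 0 = length ([] @ cs))"
  proof (rule den_For_oracle[where Ok = "env n E k" and Inv = ?Inv and St = ?St])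
    fix s s' assume "env n E k s" "\<And>z. z \<notin> insert ''u'' (asg (FFor ''v'' ''n'' vc_step)) \<Longrightarrow> s' z = s z"
    then show "env n E k s'"
      using env_frame[of n E k s "insert ''u'' (asg (FFor ''v'' ''n'' vc_step))" s'] by (auto simp: env_vars_def)
  next
    fix u bs \<sigma> assume u: "u < n" and Iu: "?Inv u bs \<sigma>"
    let ?Ok = "\<lambda>s. env n E k s \<and> s ''u'' 0 = u"
    show "\<exists>cs \<sigma>'. ?Inv (Suc u) (bs @ cs) \<sigma>' \<and>
      (\<forall>s. env n E k s \<and> s ''u'' 0 = u \<and> ?St u \<sigma> s \<and> s ''j'' 0 = length bs \<and> ext s (bs @ cs) \<longrightarrow>
        ?St (Suc u) \<sigma>' (den (FFor ''v'' ''n'' vc_step) s) \<and>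
        den (FFor ''v'' ''n'' vc_step) s ''j'' 0 = length (bs @ cs))"
    proof -
      have "\<exists>cs \<sigma>'. ?Inv n (bs @ cs) \<sigma>' \<and>
      (\<forall>s. ?Ok s \<and> ?St 0 \<sigma> s \<and> s ''j'' 0 = length bs \<and> ext s (bs @ cs) \<longrightarrow>
        ?St n \<sigma>' (den (FFor ''v'' ''n'' vc_step) s) \<and>
        den (FFor ''v'' ''n'' vc_step) s ''j'' 0 = length (bs @ cs))"
      proof (rule den_For_oracle[where Ok = ?Ok and Inv = ?Inv and St = ?St])
        fix s s' assume "?Ok s" "\<And>z. z \<notin> insert ''v'' (asg vc_step) \<Longrightarrow> s' z = s z"
        then show "?Ok s'"
          using env_frame[of n E k s "insert ''v'' (asg vc_step)" s'] by (auto simp: env_vars_def)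
      next
        fix v bs \<sigma> assume v: "v < n" and Iv: "?Inv v bs \<sigma>"
        let ?c = "{u, v} \<in> E \<and> \<sigma> u = 0 \<and> \<sigma> v = 0"
        let ?w = "if u \<in> S then u else v"
        let ?cs = "if ?c then [u \<in> S] else []" and ?\<tau> = "if ?c then \<sigma>(?w := Suc (length bs)) else \<sigma>"
        have "?Inv (Suc v) (bs @ ?cs) ?\<tau>"
        proof (cases ?c)
          case True
          have w: "?w < n" "?w \<in> S" "\<sigma> ?w = 0" using u v True cover by auto
          have "{v. v < n \<and> 0 < (\<sigma>(?w := Suc (length bs))) v} = insert ?w {v. v < n \<and> 0 < \<sigma> v}"
            using w(1) by auto
          then have "card {v. v < n \<and> 0 < (\<sigma>(?w := Suc (length bs))) v} = Suc (card {v. v < n \<and> 0 < \<sigma> v})"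
            using w(3) by simp
          moreover have "\<exists>v<n. (\<sigma>(?w := Suc (length bs))) v = Suc i" if i: "i < Suc (length bs)" for i
          proof (cases "i = length bs")
            case True
            then show ?thesis using w(1) by (intro exI[of _ ?w]) simp
          next
            case False
            then obtain x where "x < n" "\<sigma> x = Suc i" using Iv i by (auto simp: less_Suc_eq)
            then show ?thesis using w(3) by (intro exI[of _ x]) auto
          qed
          ultimately show ?thesis using True Iv w by auto
        qed (use Iv in auto)
        moreover have "?St (Suc v) ?\<tau> (den vc_step s) \<and> den vc_step s ''j'' 0 = length (bs @ ?cs)"
          if s: "?Ok s" "s ''v'' 0 = v" "?St v \<sigma> s" "s ''j'' 0 = length bs" "ext s (bs @ ?cs)" for s
        proof -
          have "?c \<Longrightarrow> s ''g'' (length bs) = of_bool (u \<in> S)" using s(5) ext_nth[of s bs "u \<in> S" "[]"] by simp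
          then show ?thesis using s(3,4) u v den_vc_step[of n E k s u v] s(1,2) by auto
        qed
        ultimately show "\<exists>cs \<sigma>'. ?Inv (Suc v) (bs @ cs) \<sigma>' \<and>
          (\<forall>s. ?Ok s \<and> s ''v'' 0 = v \<and> ?St v \<sigma> s \<and> s ''j'' 0 = length bs \<and> ext s (bs @ cs) \<longrightarrow>
          ?St (Suc v) \<sigma>' (den vc_step s) \<and> den vc_step s ''j'' 0 = length (bs @ cs))"
          by (intro exI[of _ ?cs] exI[of _ ?\<tau>]) blast
      qed (use Iu in \<open>auto simp: env_def\<close>)
      then show ?thesis by blast
    qed
  qed (auto simp: env_def)
  then obtain bs \<sigma> where I: "?Inv n bs \<sigma>" and run: "\<And>s. env n E k s \<Longrightarrow> ?St 0 (\<lambda>_. 0) s \<Longrightarrow>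
      s ''j'' 0 = length ([] :: bool list) \<Longrightarrow> ext s ([] @ bs) \<Longrightarrow>
      ?St n \<sigma> (den (FFor ''u'' ''n'' (FFor ''v'' ''n'' vc_step)) s) \<and>
      den (FFor ''u'' ''n'' (FFor ''v'' ''n'' vc_step)) s ''j'' 0 = length ([] @ bs)"
    unfolding append_Nil by blast
  have "{v. v < n \<and> 0 < \<sigma> v} \<subseteq> S" using I by blast
  then have "length bs \<le> card S" using I card_mono[OF S] by simp
  moreover have "(\<forall>v<n. den vc s ''tm'' v = \<sigma> v) \<and> den vc s ''j'' 0 = length bs"
    if s: "env n E k s" "ext s bs" for s
  proof -
    let ?q = "FFor ''v'' ''n'' (FAssign ''tm'' (V ''v'') (Const 0))"
    define s0 where "s0 = den ?q (upd s ''j'' 0 0)"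
    have "\<forall>v<n. s0 ''tm'' v = 0"
      unfolding s0_def
      by (rule den_For_induct[where I = "\<lambda>i s1. \<forall>v<i. s1 ''tm'' v = 0"])
         (use s(1) in \<open>auto simp: less_Suc_eq env_def\<close>)
    moreover have "env n E k s0" unfolding s0_def
      by (rule env_den[OF env_upd[OF s(1)]]) (auto simp: env_vars_def)
    moreover have "s0 ''j'' 0 = 0" "s0 ''g'' = s ''g''"
      unfolding s0_def using den_frame[of "''j''" ?q] den_frame[of "''g''" ?q] by (simp_all add: upd_other)
    moreover from this have "ext s0 bs" using s(2) ext_cong by blast
    moreover have "den vc s = den (FFor ''u'' ''n'' (FFor ''v'' ''n'' vc_step)) s0"
      by (simp add: vc_def s0_def)
    ultimately show ?thesis using run[of s0] by simp
  qed
  ultimately show ?thesis using I by (intro exI[of _ bs]) (auto, metis)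
qed

section \<open>Steiner trees by dynamic programming\<close>

text \<open>As in \<open>decode\<close>, both masks are taken apart from the top by comparison and
  subtraction, and the result is assembled on the way.\<close>

definition or_prog :: fprog where
  "or_prog = FAssign ''rx'' (Const 0) (V ''x'') ;; FAssign ''ry'' (Const 0) (V ''y'') ;; FAssign ''z'' (Const 0) (Const 0) ;;
     FFor ''i'' ''k1''
      (FAssign ''w'' (Const 0) (Monus (V ''k1'') (Plus (V ''i'') (Const 1))) ;; FAssign ''bt'' (Const 0) (Const 0) ;;
       FCond (Less (V ''rx'') (Cell ''pw'' (V ''w''))) FSkip
         (FAssign ''rx'' (Const 0) (Monus (V ''rx'') (Cell ''pw'' (V ''w''))) ;; FAssign ''bt'' (Const 0) (Const 1)) ;;
       FCond (Less (V ''ry'') (Cell ''pw'' (V ''w''))) FSkip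
         (FAssign ''ry'' (Const 0) (Monus (V ''ry'') (Cell ''pw'' (V ''w''))) ;; FAssign ''bt'' (Const 0) (Const 1)) ;;
       FCond (Less (Const 0) (V ''bt'')) (FAssign ''z'' (Const 0) (Plus (V ''z'') (Cell ''pw'' (V ''w'')))) FSkip)"

lemma asg_or_prog [simp]: "asg or_prog = {''rx'', ''ry'', ''z'', ''i'', ''w'', ''bt''}"
  by (auto simp: or_prog_def)

lemma den_or_prog:
  assumes "env n E k s" "s ''x'' 0 = x" "s ''y'' 0 = y" "x < 2 ^ (k + 1)" "y < 2 ^ (k + 1)"
  shows "den or_prog s ''z'' 0 = or x y"
proof -
  define m where "m = k + 1"
  define s0 where "s0 = upd (upd (upd s ''rx'' 0 x) ''ry'' 0 y) ''z'' 0 0"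
  let ?p = "(FAssign ''w'' (Const 0) (Monus (V ''k1'') (Plus (V ''i'') (Const 1))) ;; FAssign ''bt'' (Const 0) (Const 0) ;;
       FCond (Less (V ''rx'') (Cell ''pw'' (V ''w''))) FSkip
         (FAssign ''rx'' (Const 0) (Monus (V ''rx'') (Cell ''pw'' (V ''w''))) ;; FAssign ''bt'' (Const 0) (Const 1)) ;;
       FCond (Less (V ''ry'') (Cell ''pw'' (V ''w''))) FSkip
         (FAssign ''ry'' (Const 0) (Monus (V ''ry'') (Cell ''pw'' (V ''w''))) ;; FAssign ''bt'' (Const 0) (Const 1)) ;;
       FCond (Less (Const 0) (V ''bt'')) (FAssign ''z'' (Const 0) (Plus (V ''z'') (Cell ''pw'' (V ''w'')))) FSkip)"
  have m: "s0 ''k1'' 0 = m" using assms(1) by (simp add: env_def m_def s0_def)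
  have xy: "take_bit m x = x" "take_bit m y = y"
    using assms(4,5) by (simp_all add: m_def take_bit_nat_eq_self)
  have "den (FFor ''i'' ''k1'' ?p) s0 ''z'' 0 = or x y"
  proof (rule den_For_induct[where I = "\<lambda>i s. s ''rx'' 0 = take_bit (m - i) x \<and> s ''ry'' 0 = take_bit (m - i) y \<and>
      s ''z'' 0 + take_bit (m - i) (or x y) = or x y"])
    show "s0 ''rx'' 0 = take_bit (m - 0) x \<and> s0 ''ry'' 0 = take_bit (m - 0) y \<and>
      s0 ''z'' 0 + take_bit (m - 0) (or x y) = or x y"
      using xy by (simp add: s0_def take_bit_or)
  next
    fix i s'
    assume i: "i < s0 ''k1'' 0" and I: "s' ''rx'' 0 = take_bit (m - i) x \<and> s' ''ry'' 0 = take_bit (m - i) y \<and>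
      s' ''z'' 0 + take_bit (m - i) (or x y) = or x y"
      and fr: "\<And>z. z \<notin> insert ''i'' (asg ?p) \<Longrightarrow> s' z = s0 z"
    define w where "w = m - Suc i"
    have w: "m - i = Suc w" "w < m" using i m by (auto simp: w_def)
    have "s' ''k1'' 0 = m" using fr[of "''k1''"] m by simp
    moreover have "s' ''pw'' w = 2 ^ w"
      using fr[of "''pw''"] assms(1) w(2) by (simp add: env_def m_def s0_def upd_other)
    moreover have "s' ''rx'' 0 = 2 ^ w * of_bool (bit x w) + take_bit w x"
      "s' ''ry'' 0 = 2 ^ w * of_bool (bit y w) + take_bit w y"
      using I w(1) by (simp_all add: take_bit_Suc_from_most)
    moreover have "s' ''z'' 0 + (2 ^ w * of_bool (bit x w \<or> bit y w) + take_bit w (or x y)) = or x y"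
    proof -
      have "take_bit (Suc w) (or x y) = 2 ^ w * of_bool (bit x w \<or> bit y w) + take_bit w (or x y)"
        by (simp only: take_bit_Suc_from_most bit_or_iff)
      then show ?thesis using I unfolding w(1) by (simp only:)
    qed
    moreover have "take_bit w x < 2 ^ w" "take_bit w y < 2 ^ w" by simp_all
    moreover have "m - Suc i = w" by (simp add: w_def)
    ultimately show "den ?p (upd s' ''i'' 0 i) ''rx'' 0 = take_bit (m - Suc i) x \<and>
       den ?p (upd s' ''i'' 0 i) ''ry'' 0 = take_bit (m - Suc i) y \<and>
       den ?p (upd s' ''i'' 0 i) ''z'' 0 + take_bit (m - Suc i) (or x y) = or x y"
      by (cases "bit x w"; cases "bit y w") auto
  qed (use m in auto)
  moreover have "den or_prog s = den (FFor ''i'' ''k1'' ?p) s0"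
    using assms(2,3) by (simp add: or_prog_def s0_def)
  ultimately show ?thesis by simp
qed

section \<open>The table of tree costs and its relaxation\<close>

text \<open>Entry of row \<open>m\<close> and column \<open>v\<close>: the cost of a tree with root
  \<open>v\<close> that covers the terminals in the mask \<open>m\<close>.\<close>

definition fcell :: "aexp \<Rightarrow> aexp \<Rightarrow> aexp" where
  "fcell m v = Cell ''f'' (Plus (Cell ''mul'' m) v)"

text \<open>The counterpart of the rule \<open>join\<close> of \<open>tree\<close>. Joined subtrees
  may overlap, so the masks \<open>x\<close> and \<open>y\<close> range over all pairs and not only
  over disjoint ones.\<close>

definition relax_step :: fprog where
  "relax_step = FCond (Conj (adj (V ''v'') (V ''u''))
      (Less (Plus (Plus (fcell (V ''x'') (V ''v'')) (fcell (V ''y'') (V ''u''))) (Const 1)) (fcell (V ''z'') (V ''v''))))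
     (FAssign ''f'' (Plus (Cell ''mul'' (V ''z'')) (V ''v''))
        (Plus (Plus (fcell (V ''x'') (V ''v'')) (fcell (V ''y'') (V ''u''))) (Const 1))) FSkip"

definition relax_round :: fprog where
  "relax_round = FFor ''x'' ''K'' (FFor ''y'' ''K'' (or_prog ;; FFor ''v'' ''n'' (FFor ''u'' ''n'' relax_step)))"

definition relax :: fprog where
  "relax = FFor ''r'' ''k1'' relax_round"

lemma asg_relax [simp]: "asg relax_step = {''f''}"
  "asg relax_round = {''f'', ''x'', ''y'', ''v'', ''u'', ''rx'', ''ry'', ''z'', ''i'', ''w'', ''bt''}"
  "asg relax = {''f'', ''r'', ''x'', ''y'', ''v'', ''u'', ''rx'', ''ry'', ''z'', ''i'', ''w'', ''bt''}"
  by (auto simp: relax_step_def relax_round_def relax_def)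

lemma env_mul: "env n E k s \<Longrightarrow> m < 2 ^ (k + 1) \<Longrightarrow> s ''mul'' m = m * n"
  by (simp add: env_def)

lemma den_relax_step:
  assumes "env n E k s" "s ''x'' 0 = x" "s ''y'' 0 = y" "s ''z'' 0 = z" "s ''v'' 0 = v" "s ''u'' 0 = u"
    and "x < 2 ^ (k + 1)" "y < 2 ^ (k + 1)" "z < 2 ^ (k + 1)" "v < n" "u < n"
  shows "den relax_step s = (if {v, u} \<in> E \<and> s ''f'' (x * n + v) + s ''f'' (y * n + u) + 1 < s ''f'' (z * n + v)
    then upd s ''f'' (z * n + v) (s ''f'' (x * n + v) + s ''f'' (y * n + u) + 1) else s)"
  using bval_adj[OF assms(1), of "V ''v''" "V ''u''"] assms(2-6,10,11)
    env_mul[OF assms(1,7)] env_mul[OF assms(1,8)] env_mul[OF assms(1,9)]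
  by (simp add: relax_step_def fcell_def)

lemma row_inj:
  assumes "m * n + v = m' * n + v'" "v < n" "v' < (n :: nat)"
  shows "m = m' \<and> v = v'"
proof -
  have "(m * n + v) div n = m" "(m * n + v) mod n = v" "(m' * n + v') div n = m'" "(m' * n + v') mod n = v'"
    using assms(2,3) by simp_all
  then show ?thesis using assms(1) by metis
qed

lemma or_less: "x < 2 ^ l \<Longrightarrow> y < 2 ^ l \<Longrightarrow> or x y < (2 ^ l :: nat)"
  by (metis take_bit_nat_eq_self take_bit_nat_less_exp take_bit_or)

text \<open>\<open>\<sigma> u = i + 1\<close> means that bit \<open>i\<close> of a mask stands for the terminal \<open>u\<close>, and
  \<open>\<sigma> u = 0\<close> that \<open>u\<close> is not a terminal.  Values above \<open>k\<close> stand for infinity.\<close>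

definition dp_sound :: "nat \<Rightarrow> nat set set \<Rightarrow> nat \<Rightarrow> (nat \<Rightarrow> nat) \<Rightarrow> mem \<Rightarrow> bool" where
  "dp_sound n E k \<sigma> s \<longleftrightarrow> (\<forall>m<2 ^ (k + 1). \<forall>v<n. s ''f'' (m * n + v) \<le> k \<longrightarrow>
     (\<exists>S c. tree E v S c \<and> c \<le> s ''f'' (m * n + v) \<and> (\<forall>u<n. 0 < \<sigma> u \<and> bit m (\<sigma> u - 1) \<longrightarrow> u \<in> S)))"

text \<open>\<open>s0\<close> is the memory at the start of a round and \<open>D\<close> the set of
  joins tried in it so far. Since entries only decrease, measuring against \<open>s0\<close> makes
  the bounds insensitive to the updates made in place during the round.\<close>

definition dp_inv :: "nat \<Rightarrow> nat set set \<Rightarrow> nat \<Rightarrow> (nat \<Rightarrow> nat) \<Rightarrow> mem \<Rightarrow> (nat \<times> nat \<times> nat \<times> nat) set \<Rightarrow> mem \<Rightarrow> bool" where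
  "dp_inv n E k \<sigma> s0 D s \<longleftrightarrow> dp_sound n E k \<sigma> s \<and> (\<forall>a. s ''f'' a \<le> s0 ''f'' a) \<and>
     (\<forall>(x, y, v, u)\<in>D. {v, u} \<in> E \<longrightarrow> s ''f'' (or x y * n + v) \<le> s0 ''f'' (x * n + v) + s0 ''f'' (y * n + u) + 1)"

lemma dp_inv_cong: "s' ''f'' = s ''f'' \<Longrightarrow> dp_inv n E k \<sigma> s0 D s' = dp_inv n E k \<sigma> s0 D s"
  by (simp add: dp_inv_def dp_sound_def)

lemma dp_inv_relax_step:
  assumes e: "env n E k s" "s ''x'' 0 = x" "s ''y'' 0 = y" "s ''z'' 0 = or x y" "s ''v'' 0 = v" "s ''u'' 0 = u"
    and b: "x < 2 ^ (k + 1)" "y < 2 ^ (k + 1)" "v < n" "u < n"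
    and I: "dp_inv n E k \<sigma> s0 D s"
  shows "dp_inv n E k \<sigma> s0 (insert (x, y, v, u) D) (den relax_step s)"
proof -
  let ?z = "or x y" and ?f = "s ''f''"
  have z: "?z < 2 ^ (k + 1)" using b(1,2) by (rule or_less)
  note d = den_relax_step[OF e b(1,2) z b(3,4)]
  have snd: "dp_sound n E k \<sigma> s" and le: "\<And>a. ?f a \<le> s0 ''f'' a"
    and D: "\<And>x y v u. (x, y, v, u) \<in> D \<Longrightarrow> {v, u} \<in> E \<Longrightarrow> ?f (or x y * n + v) \<le> s0 ''f'' (x * n + v) + s0 ''f'' (y * n + u) + 1"
    using I by (auto simp: dp_inv_def)
  have b0: "?f (x * n + v) + ?f (y * n + u) + 1 \<le> s0 ''f'' (x * n + v) + s0 ''f'' (y * n + u) + 1"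
    using le[of "x * n + v"] le[of "y * n + u"] by simp
  show ?thesis
  proof (cases "{v, u} \<in> E \<and> ?f (x * n + v) + ?f (y * n + u) + 1 < ?f (?z * n + v)")
    case False
    then have "den relax_step s = s" unfolding d by (rule if_not_P)
    moreover have "{v, u} \<in> E \<Longrightarrow> ?f (?z * n + v) \<le> s0 ''f'' (x * n + v) + s0 ''f'' (y * n + u) + 1"
      using False b0 by linarith
    ultimately show ?thesis using I by (auto simp: dp_inv_def)
  next
    case True
    let ?c = "?f (x * n + v) + ?f (y * n + u) + 1"
    have s1: "den relax_step s ''f'' = ?f(?z * n + v := ?c)" unfolding d if_P[OF True] by (simp add: upd_def)
    have "\<exists>S c. tree E v S c \<and> c \<le> ?c \<and> (\<forall>w<n. 0 < \<sigma> w \<and> bit ?z (\<sigma> w - 1) \<longrightarrow> w \<in> S)" if c: "?c \<le> k"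
    proof -
      have "?f (x * n + v) \<le> k" "?f (y * n + u) \<le> k" using c by simp_all
      from snd[unfolded dp_sound_def, rule_format, OF b(1,3) this(1)]
        snd[unfolded dp_sound_def, rule_format, OF b(2,4) this(2)]
      obtain S1 c1 S2 c2 where S: "tree E v S1 c1" "c1 \<le> ?f (x * n + v)"
        "\<forall>w<n. 0 < \<sigma> w \<and> bit x (\<sigma> w - 1) \<longrightarrow> w \<in> S1" "tree E u S2 c2" "c2 \<le> ?f (y * n + u)"
        "\<forall>w<n. 0 < \<sigma> w \<and> bit y (\<sigma> w - 1) \<longrightarrow> w \<in> S2"
        by blast
      have "tree E v (S1 \<union> S2) (c1 + c2 + 1)" using S(1,4) True by (intro tree.join) auto
      then show ?thesis using S by (intro exI[of _ "S1 \<union> S2"] exI[of _ "c1 + c2 + 1"]) (auto simp: bit_or_iff)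
    qed
    note new = this
    have "dp_sound n E k \<sigma> (den relax_step s)"
      unfolding dp_sound_def s1
    proof (intro allI impI)
      fix m v' assume m: "m < (2 :: nat) ^ (k + 1)" "v' < n" "(?f(?z * n + v := ?c)) (m * n + v') \<le> k"
      show "\<exists>S c. tree E v' S c \<and> c \<le> (?f(?z * n + v := ?c)) (m * n + v') \<and>
          (\<forall>u<n. 0 < \<sigma> u \<and> bit m (\<sigma> u - 1) \<longrightarrow> u \<in> S)"
      proof (cases "m * n + v' = ?z * n + v")
        case eq: True
        then have "m = ?z" "v' = v" using row_inj m(2) b(3) by blast+
        then show ?thesis using new m(3) by simp
      next
        case False
        then show ?thesis
          using snd[unfolded dp_sound_def, rule_format, OF m(1,2)] m(3) by simp
      qed
    qed
    moreover have "den relax_step s ''f'' a \<le> s0 ''f'' a" for a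
      unfolding s1 using le[of a] le[of "?z * n + v"] True by auto
    moreover have "den relax_step s ''f'' (or x' y' * n + v') \<le> s0 ''f'' (x' * n + v') + s0 ''f'' (y' * n + u') + 1"
      if *: "(x', y', v', u') \<in> insert (x, y, v, u) D" "{v', u'} \<in> E" for x' y' v' u'
    proof (cases "(x', y', v', u') = (x, y, v, u)")
      case True
      then show ?thesis unfolding s1 using b0 by simp
    next
      case False
      then have "?f (or x' y' * n + v') \<le> s0 ''f'' (x' * n + v') + s0 ''f'' (y' * n + u') + 1"
        using D * by blast
      then show ?thesis unfolding s1 using True by auto
    qed
    ultimately show ?thesis unfolding dp_inv_def by blast
  qed
qed

lemma den_For_dp:
  assumes e: "Ok s" and N: "s y 0 = N" and I: "dp_inv n E k \<sigma> s0 D s" and x: "x \<noteq> ''f''"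
    and step: "\<And>i s' D. i < N \<Longrightarrow> Ok s' \<Longrightarrow> s' x 0 = i \<Longrightarrow> dp_inv n E k \<sigma> s0 D s' \<Longrightarrow> dp_inv n E k \<sigma> s0 (D \<union> B i) (den p s')"
    and frame: "\<And>s'. (\<And>z. z \<notin> insert x (asg p) \<Longrightarrow> s' z = s z) \<Longrightarrow> Ok s'"
  shows "dp_inv n E k \<sigma> s0 (D \<union> (\<Union>i<N. B i)) (den (FFor x y p) s)"
proof (rule den_For_induct[where I = "\<lambda>i. dp_inv n E k \<sigma> s0 (D \<union> (\<Union>j<i. B j))"])
  fix i s' assume i: "i < s y 0" and I: "dp_inv n E k \<sigma> s0 (D \<union> (\<Union>j<i. B j)) s'"
    and fr: "\<And>z. z \<notin> insert x (asg p) \<Longrightarrow> s' z = s z"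
  have "Ok (upd s' x 0 i)" by (rule frame) (use fr in \<open>simp add: upd_other\<close>)
  moreover have "dp_inv n E k \<sigma> s0 (D \<union> (\<Union>j<i. B j)) (upd s' x 0 i)"
    using I dp_inv_cong[of "upd s' x 0 i" s'] x by (simp add: upd_other)
  ultimately have "dp_inv n E k \<sigma> s0 (D \<union> (\<Union>j<i. B j) \<union> B i) (den p (upd s' x 0 i))"
    using step[of i "upd s' x 0 i"] i N by simp
  moreover have "D \<union> (\<Union>j<i. B j) \<union> B i = D \<union> (\<Union>j<Suc i. B j)" by (auto simp: less_Suc_eq)
  ultimately show "dp_inv n E k \<sigma> s0 (D \<union> (\<Union>j<Suc i. B j)) (den p (upd s' x 0 i))" by simp
next
  fix s' assume "dp_inv n E k \<sigma> s0 (D \<union> (\<Union>j<s y 0. B j)) s'"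
  then show "dp_inv n E k \<sigma> s0 (D \<union> (\<Union>i<N. B i)) (upd s' x 0 (s y 0))"
    using dp_inv_cong[of "upd s' x 0 (s y 0)" s'] x N by (simp add: upd_other)
qed (use I in simp)

lemma dp_inv_relax_round:
  assumes "env n E k s" "dp_sound n E k \<sigma> s"
  shows "dp_inv n E k \<sigma> s ({..<2 ^ (k + 1)} \<times> {..<2 ^ (k + 1)} \<times> {..<n} \<times> {..<n}) (den relax_round s)"
proof -
  let ?K = "2 ^ (k + 1) :: nat"
  have fr: "env n E k s'" if "env n E k s" "\<And>z. z \<notin> A \<Longrightarrow> s' z = s z" "A \<inter> env_vars = {}" for s s' A
    using env_frame that by blast
  have u: "dp_inv n E k \<sigma> s (D \<union> (\<Union>u<n. {(x, y, v, u)})) (den (FFor ''u'' ''n'' relax_step) s1)"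
    if "env n E k s1 \<and> s1 ''x'' 0 = x \<and> s1 ''y'' 0 = y \<and> s1 ''z'' 0 = or x y \<and> s1 ''v'' 0 = v" (is "?Ok s1")
      "x < ?K" "y < ?K" "v < n" "dp_inv n E k \<sigma> s D s1" for x y v s1 D
  proof (rule den_For_dp[where Ok = ?Ok])
    show "dp_inv n E k \<sigma> s (D \<union> {(x, y, v, i)}) (den relax_step s')"
      if "i < n" "?Ok s'" "s' ''u'' 0 = i" "dp_inv n E k \<sigma> s D s'" for i s' D
      using dp_inv_relax_step[of n E k s' x y v i \<sigma> s D] that \<open>x < ?K\<close> \<open>y < ?K\<close> \<open>v < n\<close> by simp
    show "?Ok s'" if "\<And>z. z \<notin> insert ''u'' (asg relax_step) \<Longrightarrow> s' z = s1 z" for s'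
      using fr[of s1 "insert ''u'' (asg relax_step)" s'] that \<open>?Ok s1\<close> by (auto simp: env_vars_def)
  qed (use that in \<open>auto simp: env_def\<close>)
  have v: "dp_inv n E k \<sigma> s (D \<union> (\<Union>v<n. \<Union>u<n. {(x, y, v, u)}))
      (den (FFor ''v'' ''n'' (FFor ''u'' ''n'' relax_step)) s1)"
    if "env n E k s1 \<and> s1 ''x'' 0 = x \<and> s1 ''y'' 0 = y \<and> s1 ''z'' 0 = or x y" (is "?Ok s1")
      "x < ?K" "y < ?K" "dp_inv n E k \<sigma> s D s1" for x y s1 D
  proof (rule den_For_dp[where Ok = ?Ok])
    show "dp_inv n E k \<sigma> s (D \<union> (\<Union>u<n. {(x, y, i, u)})) (den (FFor ''u'' ''n'' relax_step) s')"
      if "i < n" "?Ok s'" "s' ''v'' 0 = i" "dp_inv n E k \<sigma> s D s'" for i s' D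
      using u[of s' x y i D] that \<open>x < ?K\<close> \<open>y < ?K\<close> by simp
    show "?Ok s'" if "\<And>z. z \<notin> insert ''v'' (asg (FFor ''u'' ''n'' relax_step)) \<Longrightarrow> s' z = s1 z" for s'
      using fr[of s1 "insert ''v'' (asg (FFor ''u'' ''n'' relax_step))" s'] that \<open>?Ok s1\<close> by (auto simp: env_vars_def)
  qed (use that in \<open>auto simp: env_def\<close>)
  let ?q = "or_prog ;; FFor ''v'' ''n'' (FFor ''u'' ''n'' relax_step)"
  have y: "dp_inv n E k \<sigma> s (D \<union> (\<Union>y<?K. \<Union>v<n. \<Union>u<n. {(x, y, v, u)})) (den (FFor ''y'' ''K'' ?q) s1)"
    if "env n E k s1 \<and> s1 ''x'' 0 = x" (is "?Ok s1") "x < ?K" "dp_inv n E k \<sigma> s D s1" for x s1 D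
  proof (rule den_For_dp[where Ok = ?Ok])
    show "dp_inv n E k \<sigma> s (D \<union> (\<Union>v<n. \<Union>u<n. {(x, i, v, u)})) (den ?q s')"
      if *: "i < ?K" "?Ok s'" "s' ''y'' 0 = i" "dp_inv n E k \<sigma> s D s'" for i s' D
    proof -
      define s2 where "s2 = den or_prog s'"
      have s2: "s2 z = s' z" if "z \<notin> asg or_prog" for z unfolding s2_def using that by (rule den_frame)
      have "env n E k s2" by (rule fr[of s' "asg or_prog"]) (use * s2 in \<open>auto simp: env_vars_def\<close>)
      moreover have "s2 ''z'' 0 = or x i"
        unfolding s2_def using den_or_prog[of n E k s' x i] * \<open>x < ?K\<close> by simp
      moreover have "dp_inv n E k \<sigma> s D s2" using *(4) s2[of "''f''"] dp_inv_cong[of s2 s'] by simp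
      ultimately show ?thesis using v[of s2 x i D] s2 * \<open>x < ?K\<close> by (simp add: s2_def)
    qed
    show "?Ok s'" if "\<And>z. z \<notin> insert ''y'' (asg ?q) \<Longrightarrow> s' z = s1 z" for s'
      using fr[of s1 "insert ''y'' (asg ?q)" s'] that \<open>?Ok s1\<close> by (auto simp: env_vars_def)
  qed (use that in \<open>auto simp: env_def\<close>)
  have "dp_inv n E k \<sigma> s ({} \<union> (\<Union>x<?K. \<Union>y<?K. \<Union>v<n. \<Union>u<n. {(x, y, v, u)})) (den (FFor ''x'' ''K'' (FFor ''y'' ''K'' ?q)) s)"
  proof (rule den_For_dp[where Ok = "env n E k"])
    show "dp_inv n E k \<sigma> s (D \<union> (\<Union>y<?K. \<Union>v<n. \<Union>u<n. {(i, y, v, u)})) (den (FFor ''y'' ''K'' ?q) s')"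
      if "i < ?K" "env n E k s'" "s' ''x'' 0 = i" "dp_inv n E k \<sigma> s D s'" for i s' D
      using y[of s' i D] that by simp
    show "env n E k s'" if "\<And>z. z \<notin> insert ''x'' (asg (FFor ''y'' ''K'' ?q)) \<Longrightarrow> s' z = s z" for s'
      using fr[of s "insert ''x'' (asg (FFor ''y'' ''K'' ?q))" s'] that assms(1) by (auto simp: env_vars_def)
  qed (use assms in \<open>auto simp: env_def dp_inv_def\<close>)
  moreover have "{} \<union> (\<Union>x<?K. \<Union>y<?K. \<Union>v<n. \<Union>u<n. {(x, y, v, u)}) = {..<?K} \<times> {..<?K} \<times> {..<n} \<times> {..<n}"
    by auto
  ultimately show ?thesis unfolding relax_round_def by simp
qed

definition dp_complete :: "nat \<Rightarrow> nat set set \<Rightarrow> nat \<Rightarrow> (nat \<Rightarrow> nat) \<Rightarrow> nat \<Rightarrow> mem \<Rightarrow> bool" where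
  "dp_complete n E k \<sigma> r s \<longleftrightarrow> (\<forall>v S c m. tree E v S c \<longrightarrow> c \<le> r \<longrightarrow> v < n \<longrightarrow> m < 2 ^ (k + 1) \<longrightarrow>
     (\<forall>i. bit m i \<longrightarrow> (\<exists>u\<in>S. u < n \<and> \<sigma> u = Suc i)) \<longrightarrow> s ''f'' (m * n + v) \<le> c)"

text \<open>The last \<open>join\<close> splits the tree into two with fewer edges, and the mask
  into the terminals found in either. The two partial masks may overlap, but their \<open>or\<close>
  is the whole mask, and the relaxation has tried this pair.\<close>

lemma dp_complete_Suc:
  assumes G: "simple_graph ({..<n}, E)" and C: "dp_complete n E k \<sigma> r s0"
    and I: "dp_inv n E k \<sigma> s0 ({..<2 ^ (k + 1)} \<times> {..<2 ^ (k + 1)} \<times> {..<n} \<times> {..<n}) s"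
  shows "dp_complete n E k \<sigma> (Suc r) s"
  unfolding dp_complete_def
proof (intro allI impI)
  fix v S c and m :: nat assume tr: "tree E v S c" and c: "c \<le> Suc r" "v < n" and m: "m < 2 ^ (k + 1)"
    and own: "\<forall>i. bit m i \<longrightarrow> (\<exists>u\<in>S. u < n \<and> \<sigma> u = Suc i)"
  have le: "s ''f'' a \<le> s0 ''f'' a" for a using I by (simp add: dp_inv_def)
  from tr show "s ''f'' (m * n + v) \<le> c"
  proof cases
    case root
    then have "s0 ''f'' (m * n + v) \<le> c" using C tr c m own unfolding dp_complete_def by blast
    then show ?thesis using le order_trans by blast
  next
    case (join S1 c1 u S2 c2)
    have u: "u < n" using edge_less[OF G join(5)] by blast
    have split: "\<exists>m1<2 ^ (k + 1) :: nat. \<forall>i<k + 1. bit m1 i = (bit m i \<and> (\<exists>u\<in>S'. u < n \<and> \<sigma> u = Suc i))" for S'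
      by (rule ex_bits)
    obtain m1 :: nat where m1: "m1 < 2 ^ (k + 1)" "\<forall>i<k + 1. bit m1 i = (bit m i \<and> (\<exists>u\<in>S1. u < n \<and> \<sigma> u = Suc i))"
      using split by blast
    obtain m2 :: nat where m2: "m2 < 2 ^ (k + 1)" "\<forall>i<k + 1. bit m2 i = (bit m i \<and> (\<exists>u\<in>S2. u < n \<and> \<sigma> u = Suc i))"
      using split by blast
    have small: "i < k + 1" if "bit m' i" "m' < 2 ^ (k + 1)" for m' i :: nat
    proof -
      have "take_bit (k + 1) m' = m'" using that(2) by (simp add: take_bit_nat_eq_self)
      then show ?thesis using that(1) by (metis bit_take_bit_iff)
    qed
    have "or m1 m2 = m"
    proof (rule bit_eqI)
      fix i
      show "bit (or m1 m2) i = bit m i"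
      proof (cases "i < k + 1")
        case True
        then show ?thesis using m1(2) m2(2) own join(1) by (auto simp: bit_or_iff)
      next
        case False
        then show ?thesis using small m1(1) m2(1) m unfolding bit_or_iff by blast
      qed
    qed
    moreover have "s0 ''f'' (m1 * n + v) \<le> c1"
    proof (rule C[unfolded dp_complete_def, rule_format, OF join(3) _ c(2) m1(1)])
      show "\<exists>u\<in>S1. u < n \<and> \<sigma> u = Suc i" if "bit m1 i" for i using m1 small[OF that m1(1)] that by blast
    qed (use c join(2) in simp)
    moreover have "s0 ''f'' (m2 * n + u) \<le> c2"
    proof (rule C[unfolded dp_complete_def, rule_format, OF join(4) _ u m2(1)])
      show "\<exists>u\<in>S2. u < n \<and> \<sigma> u = Suc i" if "bit m2 i" for i using m2 small[OF that m2(1)] that by blast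
    qed (use c join(2) in simp)
    moreover have "s ''f'' (or m1 m2 * n + v) \<le> s0 ''f'' (m1 * n + v) + s0 ''f'' (m2 * n + u) + 1"
      using I m1(1) m2(1) c(2) u join(5) unfolding dp_inv_def by blast
    ultimately show ?thesis using join(2) by simp
  qed
qed

lemma den_relax:
  assumes "env n E k s" "dp_sound n E k \<sigma> s" "dp_complete n E k \<sigma> 0 s"
  shows "dp_sound n E k \<sigma> (den relax s) \<and> dp_complete n E k \<sigma> (k + 1) (den relax s)"
proof -
  have "dp_sound n E k \<sigma> (den (FFor ''r'' ''k1'' relax_round) s) \<and>
     dp_complete n E k \<sigma> (k + 1) (den (FFor ''r'' ''k1'' relax_round) s)"
  proof (rule den_For_induct[where I = "\<lambda>i s. dp_sound n E k \<sigma> s \<and> dp_complete n E k \<sigma> i s"])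
    fix i s' assume I: "dp_sound n E k \<sigma> s' \<and> dp_complete n E k \<sigma> i s'"
      and fr: "\<And>z. z \<notin> insert ''r'' (asg relax_round) \<Longrightarrow> s' z = s z"
    define s1 where "s1 = upd s' ''r'' 0 i"
    have e: "env n E k s1" unfolding s1_def
      by (rule env_upd, rule env_frame[OF assms(1)], erule fr) (auto simp: env_vars_def)
    have "dp_sound n E k \<sigma> s1" "dp_complete n E k \<sigma> i s1"
      using I by (simp_all add: s1_def dp_sound_def dp_complete_def)
    then have "dp_inv n E k \<sigma> s1 ({..<2 ^ (k + 1)} \<times> {..<2 ^ (k + 1)} \<times> {..<n} \<times> {..<n}) (den relax_round s1)"
      by (intro dp_inv_relax_round[OF e])
    then show "dp_sound n E k \<sigma> (den relax_round s1) \<and> dp_complete n E k \<sigma> (Suc i) (den relax_round s1)"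
      using dp_complete_Suc[OF env_simple[OF e] \<open>dp_complete n E k \<sigma> i s1\<close>] by (auto simp: dp_inv_def)
  next
    fix s' assume "dp_sound n E k \<sigma> s' \<and> dp_complete n E k \<sigma> (s ''k1'' 0) s'"
    moreover have "s ''k1'' 0 = k + 1" using assms(1) by (simp add: env_def)
    ultimately show "dp_sound n E k \<sigma> (upd s' ''r'' 0 (s ''k1'' 0)) \<and> dp_complete n E k \<sigma> (k + 1) (upd s' ''r'' 0 (s ''k1'' 0))"
      by (simp add: dp_sound_def dp_complete_def)
  qed (use assms(2,3) in blast)
  then show ?thesis by (simp add: relax_def)
qed

section \<open>The table for trees without edges\<close>

text \<open>A single root covers the empty mask, whose row starts at cell 0, and, if it is a
  terminal, its own singleton mask. All other entries start at \<open>k + 1\<close>, that is,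
  infinity.\<close>

definition dp_init :: fprog where
  "dp_init = FFor ''x'' ''K'' (FFor ''v'' ''n'' (FAssign ''f'' (Plus (Cell ''mul'' (V ''x'')) (V ''v'')) (V ''k1''))) ;;
     FFor ''v'' ''n'' (FAssign ''f'' (V ''v'') (Const 0) ;; FCond (Less (Const 0) (Cell ''tm'' (V ''v'')))
       (FAssign ''f'' (Plus (Cell ''mul'' (Cell ''pw'' (Monus (Cell ''tm'' (V ''v'')) (Const 1)))) (V ''v'')) (Const 0)) FSkip)"

lemma asg_dp_init [simp]: "asg dp_init = {''f'', ''x'', ''v''}"
  by (auto simp: dp_init_def)

lemma den_dp_init:
  assumes e: "env n E k s" and \<sigma>: "\<forall>v<n. s ''tm'' v = \<sigma> v \<and> \<sigma> v \<le> k + 1" and mv: "m < 2 ^ (k + 1)" "v < n"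
  shows "den dp_init s ''f'' (m * n + v) = (if m = 0 \<or> 0 < \<sigma> v \<and> m = 2 ^ (\<sigma> v - 1) then 0 else k + 1)"
proof -
  let ?K = "2 ^ (k + 1) :: nat"
  let ?p = "FAssign ''f'' (Plus (Cell ''mul'' (V ''x'')) (V ''v'')) (V ''k1'')"
  let ?q = "FAssign ''f'' (V ''v'') (Const 0) ;; FCond (Less (Const 0) (Cell ''tm'' (V ''v'')))
       (FAssign ''f'' (Plus (Cell ''mul'' (Cell ''pw'' (Monus (Cell ''tm'' (V ''v'')) (Const 1)))) (V ''v'')) (Const 0)) FSkip"
  define s1 where "s1 = den (FFor ''x'' ''K'' (FFor ''v'' ''n'' ?p)) s"
  have nK: "s ''n'' 0 = n" "s ''K'' 0 = ?K" using e by (simp_all add: env_def)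
  have row: "(\<forall>v<n. den (FFor ''v'' ''n'' ?p) s' ''f'' (x * n + v) = k + 1) \<and>
      (\<forall>m v. m \<noteq> x \<and> v < n \<longrightarrow> den (FFor ''v'' ''n'' ?p) s' ''f'' (m * n + v) = s' ''f'' (m * n + v))"
    if e': "env n E k s'" and x: "s' ''x'' 0 = x" "x < ?K" for s' x
  proof (rule den_For_induct[where I = "\<lambda>i s''. (\<forall>v<i. s'' ''f'' (x * n + v) = k + 1) \<and>
      (\<forall>m v. m \<noteq> x \<and> v < n \<longrightarrow> s'' ''f'' (m * n + v) = s' ''f'' (m * n + v))"])
    fix i s'' assume i: "i < s' ''n'' 0" and I: "(\<forall>v<i. s'' ''f'' (x * n + v) = k + 1) \<and>
      (\<forall>m v. m \<noteq> x \<and> v < n \<longrightarrow> s'' ''f'' (m * n + v) = s' ''f'' (m * n + v))"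
      and fr: "\<And>z. z \<notin> insert ''v'' (asg ?p) \<Longrightarrow> s'' z = s' z"
    have "i < n" using i e' by (simp add: env_def)
    then have ne: "m * n + v \<noteq> x * n + i" if "m \<noteq> x" "v < n" for m v using row_inj that by blast
    have "den ?p (upd s'' ''v'' 0 i) ''f'' = (s'' ''f'')(x * n + i := k + 1)"
      using fr[of "''x''"] fr[of "''mul''"] fr[of "''k1''"] x e' env_mul[OF e' x(2)]
      by (simp add: upd_def env_def)
    then show "(\<forall>v<Suc i. den ?p (upd s'' ''v'' 0 i) ''f'' (x * n + v) = k + 1) \<and>
      (\<forall>m v. m \<noteq> x \<and> v < n \<longrightarrow> den ?p (upd s'' ''v'' 0 i) ''f'' (m * n + v) = s' ''f'' (m * n + v))"
      using I ne by (auto simp: less_Suc_eq)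
  qed (use e' in \<open>auto simp: env_def\<close>)
  have "\<forall>m<?K. \<forall>v<n. s1 ''f'' (m * n + v) = k + 1"
    unfolding s1_def
  proof (rule den_For_induct[where I = "\<lambda>i s'. \<forall>m<i. \<forall>v<n. s' ''f'' (m * n + v) = k + 1"])
    fix i s' assume i: "i < s ''K'' 0" and I: "\<forall>m<i. \<forall>v<n. s' ''f'' (m * n + v) = k + 1"
      and fr: "\<And>z. z \<notin> insert ''x'' (asg (FFor ''v'' ''n'' ?p)) \<Longrightarrow> s' z = s z"
    define s2 where "s2 = upd s' ''x'' 0 i"
    have "env n E k s2" unfolding s2_def
      by (rule env_upd, rule env_frame[OF e], erule fr) (auto simp: env_vars_def)
    moreover have "s2 ''x'' 0 = i" "s2 ''f'' = s' ''f''" by (simp_all add: s2_def upd_other)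
    ultimately have "(\<forall>v<n. den (FFor ''v'' ''n'' ?p) s2 ''f'' (i * n + v) = k + 1) \<and>
      (\<forall>m v. m \<noteq> i \<and> v < n \<longrightarrow> den (FFor ''v'' ''n'' ?p) s2 ''f'' (m * n + v) = s' ''f'' (m * n + v))"
      using row[of s2 i] i nK(2) by simp
    then show "\<forall>m<Suc i. \<forall>v<n. den (FFor ''v'' ''n'' ?p) s2 ''f'' (m * n + v) = k + 1"
      using I by (auto simp: less_Suc_eq)
  qed (use nK in auto)
  note s1 = this
  have fr1: "s1 z = s z" if "z \<notin> {''x'', ''v'', ''f''}" for z
    unfolding s1_def using that by (intro den_frame) auto
  have e1: "env n E k s1" by (rule env_frame[OF e, of "{''x'', ''v'', ''f''}"]) (use fr1 in \<open>auto simp: env_vars_def\<close>)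
  let ?z = "\<lambda>m v. m = 0 \<or> 0 < \<sigma> v \<and> m = 2 ^ (\<sigma> v - 1)"
  have "\<forall>m<?K. \<forall>v<n. den (FFor ''v'' ''n'' ?q) s1 ''f'' (m * n + v) = (if ?z m v then 0 else k + 1)"
  proof (rule den_For_induct[where I = "\<lambda>i s'. \<forall>m<?K. \<forall>v<n. s' ''f'' (m * n + v) = (if v < i \<and> ?z m v then 0 else k + 1)"])
    fix i s' assume i: "i < s1 ''n'' 0"
      and I: "\<forall>m<?K. \<forall>v<n. s' ''f'' (m * n + v) = (if v < i \<and> ?z m v then 0 else k + 1)"
      and fr: "\<And>z. z \<notin> insert ''v'' (asg ?q) \<Longrightarrow> s' z = s1 z"
    define s2 where "s2 = upd s' ''v'' 0 i"
    have i': "i < n" using i e1 by (simp add: env_def)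
    have e2: "env n E k s2" unfolding s2_def
      by (rule env_upd, rule env_frame[OF e1], erule fr) (auto simp: env_vars_def)
    have tm: "s2 ''tm'' i = \<sigma> i" "\<sigma> i \<le> k + 1"
      using fr[of "''tm''"] fr1[of "''tm''"] \<sigma> i' by (simp_all add: s2_def)
    have "\<sigma> i - 1 \<le> k" using tm(2) by simp
    then have pw: "(2 :: nat) ^ (\<sigma> i - 1) < ?K" by (intro power_strict_increasing) simp_all
    have "s2 ''pw'' (\<sigma> i - 1) = 2 ^ (\<sigma> i - 1)" using e2 \<open>\<sigma> i - 1 \<le> k\<close> unfolding env_def by simp
    then have f: "den ?q s2 ''f'' = (if 0 < \<sigma> i then (s' ''f'')(i := 0, 2 ^ (\<sigma> i - 1) * n + i := 0) else (s' ''f'')(i := 0))"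
      using tm(1) env_mul[OF e2 pw] by (auto simp: s2_def upd_def)
    show "\<forall>m<?K. \<forall>v<n. den ?q s2 ''f'' (m * n + v) = (if v < Suc i \<and> ?z m v then 0 else k + 1)"
    proof (intro allI impI)
      fix m v assume mv: "m < ?K" "v < n"
      have eq: "m * n + v = m' * n + i \<longleftrightarrow> m = m' \<and> v = i" for m' using row_inj[of m n v m' i] mv(2) i' by blast
      have eq0: "m * n + v = i \<longleftrightarrow> m = 0 \<and> v = i" using eq[of 0] by simp
      show "den ?q s2 ''f'' (m * n + v) = (if v < Suc i \<and> ?z m v then 0 else k + 1)"
        unfolding f using I mv eq eq0 by (auto simp: less_Suc_eq)
    qed
  next
    fix s' assume "\<forall>m<?K. \<forall>v<n. s' ''f'' (m * n + v) = (if v < s1 ''n'' 0 \<and> ?z m v then 0 else k + 1)"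
    moreover have "s1 ''n'' 0 = n" using e1 by (simp add: env_def)
    ultimately show "\<forall>m<?K. \<forall>v<n. upd s' ''v'' 0 (s1 ''n'' 0) ''f'' (m * n + v) = (if ?z m v then 0 else k + 1)"
      by simp
  qed (use s1 in simp)
  then show ?thesis using mv by (simp add: dp_init_def s1_def[symmetric])
qed

text \<open>Injectivity of the numbering makes the root the only terminal that its singleton mask
  can stand for.\<close>

lemma dp_init_ok:
  assumes e: "env n E k s" and \<sigma>: "\<forall>v<n. s ''tm'' v = \<sigma> v \<and> \<sigma> v \<le> k + 1"
    and inj: "\<forall>u<n. \<forall>v<n. \<sigma> u = \<sigma> v \<and> 0 < \<sigma> u \<longrightarrow> u = v"
  shows "dp_sound n E k \<sigma> (den dp_init s)" "dp_complete n E k \<sigma> 0 (den dp_init s)"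
proof -
  note f = den_dp_init[OF e \<sigma>]
  show "dp_sound n E k \<sigma> (den dp_init s)"
    unfolding dp_sound_def
  proof (intro allI impI)
    fix m v assume mv: "m < (2 :: nat) ^ (k + 1)" "v < n" and le: "den dp_init s ''f'' (m * n + v) \<le> k"
    have z: "m = 0 \<or> 0 < \<sigma> v \<and> m = 2 ^ (\<sigma> v - 1)" using le f[OF mv] by (auto split: if_splits)
    have "u = v" if "u < n" "0 < \<sigma> u" "bit m (\<sigma> u - 1)" for u
    proof -
      have "m \<noteq> 0" using that(3) by (metis bit_0_eq bot_apply bot_bool_def)
      then have "0 < \<sigma> v" "m = 2 ^ (\<sigma> v - 1)" using z by blast+
      then have "0 < \<sigma> v" "\<sigma> u - 1 = \<sigma> v - 1" using that(3) by (simp_all add: bit_exp_iff)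
      then have "\<sigma> u = \<sigma> v" using that(2) by simp
      then show ?thesis using inj that(1,2) mv(2) by blast
    qed
    then show "\<exists>S c. tree E v S c \<and> c \<le> den dp_init s ''f'' (m * n + v) \<and>
        (\<forall>u<n. 0 < \<sigma> u \<and> bit m (\<sigma> u - 1) \<longrightarrow> u \<in> S)"
      using tree.root[of E v] by (intro exI[of _ "{v}"] exI[of _ 0]) auto
  qed
  show "dp_complete n E k \<sigma> 0 (den dp_init s)"
    unfolding dp_complete_def
  proof (intro allI impI)
    fix v S c and m :: nat
    assume tr: "tree E v S c" "c \<le> 0" and v: "v < n" and m: "m < 2 ^ (k + 1)"
      and own: "\<forall>i. bit m i \<longrightarrow> (\<exists>u\<in>S. u < n \<and> \<sigma> u = Suc i)"
    have S: "S = {v}" using tr by (auto elim: tree.cases)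
    have "m = 0 \<or> 0 < \<sigma> v \<and> m = 2 ^ (\<sigma> v - 1)"
    proof (cases "m = 0")
      case False
      then obtain i where i: "bit m i" using bit_eqI[of m 0] by auto
      then have "\<sigma> v = Suc i" using own S by auto
      moreover have "l = i" if "bit m l" for l using own[rule_format, OF that] S calculation by simp
      then have "bit m l \<longleftrightarrow> i = l" for l using i by blast
      then have "m = 2 ^ i" by (intro bit_eqI) (auto simp: bit_exp_iff)
      ultimately show ?thesis by simp
    qed simp
    then show "den dp_init s ''f'' (m * n + v) \<le> c" using f[OF m v] by simp
  qed
qed

section \<open>The search for a connected vertex cover\<close>

text \<open>The test supplies the hypothesis \<open>iso\<close> of
  \<open>connected_cover_sol\<close>: a vertex cover is blind to vertices without neighbours, but
  the biclique condition is not.\<close>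

definition iso_test :: fprog where
  "iso_test = FAssign ''iso'' (Const 0) (Const 0) ;; FFor ''u'' ''n'' (FAssign ''fd'' (Const 0) (Const 0) ;;
     FFor ''v'' ''n'' (FCond (adj (V ''u'') (V ''v'')) (FAssign ''fd'' (Const 0) (Const 1)) FSkip) ;;
     FCond (Less (Const 0) (V ''fd'')) FSkip (FAssign ''iso'' (Const 0) (Const 1)))"

lemma asg_iso_test [simp]: "asg iso_test = {''iso'', ''u'', ''fd'', ''v''}"
  by (auto simp: iso_test_def)

lemma den_iso_test:
  assumes e: "env n E k s"
  shows "den iso_test s ''iso'' 0 = 0 \<longleftrightarrow> (\<forall>x<n. \<exists>y. {x, y} \<in> E)"
proof -
  define s0 where "s0 = upd s ''iso'' 0 0"
  let ?p = "FCond (adj (V ''u'') (V ''v'')) (FAssign ''fd'' (Const 0) (Const 1)) FSkip"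
  let ?q = "FAssign ''fd'' (Const 0) (Const 0) ;; FFor ''v'' ''n'' ?p ;;
     FCond (Less (Const 0) (V ''fd'')) FSkip (FAssign ''iso'' (Const 0) (Const 1))"
  have e0: "env n E k s0" unfolding s0_def by (rule env_upd[OF e]) (simp add: env_vars_def)
  have n: "s0 ''n'' 0 = n" using e0 by (simp add: env_def)
  have "den (FFor ''u'' ''n'' ?q) s0 ''iso'' 0 = (if \<exists>x<s0 ''n'' 0. \<not> (\<exists>y<n. {x, y} \<in> E) then 1 else s0 ''iso'' 0)"
  proof (rule den_For_flag)
    fix i s' assume i: "i < s0 ''n'' 0" and fr: "\<And>z. z \<notin> insert ''u'' (asg ?q) \<Longrightarrow> s' z = s0 z"
    define s1 where "s1 = upd (upd s' ''u'' 0 i) ''fd'' 0 0"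
    have s1: "s1 z = s0 z" if "z \<notin> {''u'', ''v'', ''fd'', ''iso''}" for z
      using that fr[of z] by (simp add: s1_def upd_other)
    have e1: "env n E k s1"
      by (rule env_frame[OF e0, of "{''u'', ''v'', ''fd'', ''iso''}"]) (use s1 in \<open>auto simp: env_vars_def\<close>)
    have n1: "s1 ''n'' 0 = n" "s1 ''u'' 0 = i" "s1 ''fd'' 0 = 0" using e1 by (simp_all add: env_def s1_def)
    have "den (FFor ''v'' ''n'' ?p) s1 ''fd'' 0 = (if \<exists>y<s1 ''n'' 0. {i, y} \<in> E then 1 else s1 ''fd'' 0)"
    proof (rule den_For_flag)
      fix j s' assume j: "j < s1 ''n'' 0" and fr: "\<And>z. z \<notin> insert ''v'' (asg ?p) \<Longrightarrow> s' z = s1 z"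
      have e2: "env n E k (upd s' ''v'' 0 j)"
        by (rule env_upd, rule env_frame[OF e1], erule fr) (auto simp: env_vars_def)
      show "den ?p (upd s' ''v'' 0 j) ''fd'' 0 = (if {i, j} \<in> E then 1 else s' ''fd'' 0)"
        using bval_adj[OF e2, of "V ''u''" "V ''v''"] i j n n1 fr[of "''u''"] by simp
    qed simp
    then have fd: "den (FFor ''v'' ''n'' ?p) s1 ''fd'' 0 = (if \<exists>y<n. {i, y} \<in> E then 1 else 0)"
      unfolding n1 .
    have if01: "0 < (if b then 1 else 0 :: nat) \<longleftrightarrow> b" for b by simp
    define Q where "Q \<longleftrightarrow> (\<exists>y<n. {i, y} \<in> E)"
    have fd: "(0 < den (FFor ''v'' ''n'' ?p) s1 ''fd'' 0) = Q" unfolding fd if01 Q_def ..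
    have "den (FFor ''v'' ''n'' ?p) s1 ''iso'' = s' ''iso''"
      using den_frame[of "''iso''" "FFor ''v'' ''n'' ?p" s1] by (simp add: s1_def upd_other)
    then show "den ?q (upd s' ''u'' 0 i) ''iso'' 0 = (if \<not> (\<exists>y<n. {i, y} \<in> E) then 1 else s' ''iso'' 0)"
      using fd unfolding Q_def[symmetric] by (simp add: s1_def)
  qed simp
  moreover have "den iso_test s = den (FFor ''u'' ''n'' ?q) s0" "s0 ''iso'' 0 = 0"
    by (simp_all add: iso_test_def s0_def)
  moreover have "(if b then 1 else 0 :: nat) = 0 \<longleftrightarrow> \<not> b" for b by simp
  ultimately have "den iso_test s ''iso'' 0 = 0 \<longleftrightarrow> \<not> (\<exists>x<n. \<not> (\<exists>y<n. {x, y} \<in> E))" by (simp only: n)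
  then show ?thesis using edge_less[OF env_simple[OF e]] by blast
qed

text \<open>The number \<open>j\<close> of chosen vertices depends on arbitrary bits; the test
  against \<open>k1\<close> keeps the numbering, and the mask of all terminals, within the
  table.\<close>

definition steiner :: fprog where
  "steiner = vc ;; iso_test ;; FCond (Conj (Neg (Less (V ''k1'') (V ''j''))) (Eq (V ''iso'') (Const 0)))
     (dp_init ;; relax ;; FFor ''v'' ''n''
        (FCond (Less (fcell (Monus (Cell ''pw'' (V ''j'')) (Const 1)) (V ''v'')) (V ''k1''))
          (FAssign ''out'' (Const 0) (Const 1)) FSkip)) FSkip"

lemma asg_steiner [simp]: "asg steiner = {''tm'', ''j'', ''u'', ''v'', ''iso'', ''fd'', ''f'', ''r'', ''x'', ''y'',
    ''rx'', ''ry'', ''z'', ''i'', ''w'', ''bt'', ''out''}"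
  by (auto simp: steiner_def)

text \<open>The mask \<open>2\<^sup>j - 1\<close> stands for all terminals.\<close>

lemma den_steiner:
  assumes e: "env n E k s"
  defines "s1 \<equiv> den vc s"
  shows "\<not> (s1 ''j'' 0 \<le> k + 1 \<and> (\<forall>x<n. \<exists>y. {x, y} \<in> E)) \<Longrightarrow> den steiner s ''out'' 0 = s ''out'' 0"
    and "s1 ''j'' 0 \<le> k + 1 \<Longrightarrow> \<forall>x<n. \<exists>y. {x, y} \<in> E \<Longrightarrow>
      \<exists>s4. dp_sound n E k (s1 ''tm'') s4 \<and> dp_complete n E k (s1 ''tm'') (k + 1) s4 \<and>
        den steiner s ''out'' 0 = (if \<exists>v<n. s4 ''f'' ((2 ^ s1 ''j'' 0 - 1) * n + v) \<le> k then 1 else s ''out'' 0)"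
proof -
  define s2 where "s2 = den iso_test s1"
  define s3 where "s3 = den dp_init s2"
  define s4 where "s4 = den relax s3"
  define c where "c \<longleftrightarrow> (\<forall>x<n. \<exists>y. {x, y} \<in> E)"
  let ?\<sigma> = "s1 ''tm''"
  let ?p = "FCond (Less (fcell (Monus (Cell ''pw'' (V ''j'')) (Const 1)) (V ''v'')) (V ''k1''))
          (FAssign ''out'' (Const 0) (Const 1)) FSkip"
  let ?r = "FFor ''v'' ''n'' ?p"
  have e1: "env n E k s1" unfolding s1_def by (rule env_den[OF e]) (auto simp: env_vars_def)
  have e2: "env n E k s2" unfolding s2_def by (rule env_den[OF e1]) (auto simp: env_vars_def)
  have e3: "env n E k s3" unfolding s3_def by (rule env_den[OF e2]) (auto simp: env_vars_def)
  have e4: "env n E k s4" unfolding s4_def by (rule env_den[OF e3]) (auto simp: env_vars_def)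
  have fr1: "s1 z = s z" if "z \<notin> asg vc" for z unfolding s1_def using that by (rule den_frame)
  have fr2: "s2 z = s1 z" if "z \<notin> asg iso_test" for z unfolding s2_def using that by (rule den_frame)
  have fr3: "s3 z = s2 z" if "z \<notin> asg dp_init" for z unfolding s3_def using that by (rule den_frame)
  have fr4: "s4 z = s3 z" if "z \<notin> asg relax" for z unfolding s4_def using that by (rule den_frame)
  have j: "s4 ''j'' = s1 ''j''" "s2 ''j'' = s1 ''j''" and out: "s4 ''out'' = s ''out''" "s2 ''out'' = s ''out''"
    and tm: "s2 ''tm'' = ?\<sigma>"
    using fr1 fr2 fr3 fr4 by simp_all
  have iso: "s2 ''iso'' 0 = 0 \<longleftrightarrow> c" unfolding s2_def c_def by (rule den_iso_test[OF e1])
  have k1: "s2 ''k1'' 0 = k + 1" using e2 by (simp add: env_def)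
  have steiner: "den steiner s = (if s1 ''j'' 0 \<le> k + 1 \<and> c then den ?r s4 else s2)"
    using iso k1 j by (auto simp: steiner_def s1_def[symmetric] s2_def[symmetric] s3_def[symmetric] s4_def[symmetric])
  show "den steiner s ''out'' 0 = s ''out'' 0" if "\<not> (s1 ''j'' 0 \<le> k + 1 \<and> (\<forall>x<n. \<exists>y. {x, y} \<in> E))"
    unfolding steiner if_not_P[OF that[folded c_def]] out ..
  {
    assume "s1 ''j'' 0 \<le> k + 1" "\<forall>x<n. \<exists>y. {x, y} \<in> E"
    then have True: "s1 ''j'' 0 \<le> k + 1 \<and> c" unfolding c_def by blast
    have ok: "terms_ok n s1" using den_vc_sound[OF e] by (simp add: s1_def)
    have \<sigma>: "\<forall>v<n. s2 ''tm'' v = ?\<sigma> v \<and> ?\<sigma> v \<le> k + 1"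
      using ok True tm by (auto simp: terms_ok_def)
    have inj: "\<forall>u<n. \<forall>v<n. ?\<sigma> u = ?\<sigma> v \<and> 0 < ?\<sigma> u \<longrightarrow> u = v" using ok by (simp add: terms_ok_def)
    have s4: "dp_sound n E k ?\<sigma> s4" "dp_complete n E k ?\<sigma> (k + 1) s4"
      using den_relax[OF e3] dp_init_ok[OF e2 \<sigma> inj] unfolding s3_def s4_def by blast+
    let ?m = "2 ^ s1 ''j'' 0 - 1 :: nat"
    have "(2 :: nat) ^ s1 ''j'' 0 \<le> 2 ^ (k + 1)" using True by (intro power_increasing) auto
    then have m: "?m < 2 ^ (k + 1)" using less_le_trans[of ?m "2 ^ s1 ''j'' 0" "2 ^ (k + 1)"] by simp
    have "s1 ''j'' 0 \<le> 4 * k + 1" using True by simp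
    then have pw: "s4 ''pw'' (s1 ''j'' 0) = 2 ^ s1 ''j'' 0" using e4 by (simp add: env_def)
    have k14: "s4 ''k1'' 0 = k + 1" "s4 ''n'' 0 = n" using e4 by (simp_all add: env_def)
    have "den ?r s4 ''out'' 0 = (if \<exists>v<s4 ''n'' 0. s4 ''f'' (?m * n + v) \<le> k then 1 else s4 ''out'' 0)"
    proof (rule den_For_flag)
      fix i s' assume fr: "\<And>z. z \<notin> insert ''v'' (asg ?p) \<Longrightarrow> s' z = s4 z"
      have "s' ''f'' = s4 ''f''" "s' ''pw'' = s4 ''pw''" "s' ''j'' = s4 ''j''" "s' ''k1'' = s4 ''k1''" "s' ''mul'' = s4 ''mul''"
        using fr by simp_all
      then show "den ?p (upd s' ''v'' 0 i) ''out'' 0 = (if s4 ''f'' (?m * n + i) \<le> k then 1 else s' ''out'' 0)"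
        using pw j k14 env_mul[OF e4 m] by (simp add: fcell_def less_Suc_eq_le)
    qed simp
    then have "den steiner s ''out'' 0 = (if \<exists>v<n. s4 ''f'' (?m * n + v) \<le> k then 1 else s ''out'' 0)"
      unfolding k14 out steiner if_P[OF True] .
    then show "\<exists>s4. dp_sound n E k ?\<sigma> s4 \<and> dp_complete n E k ?\<sigma> (k + 1) s4 \<and>
        den steiner s ''out'' 0 = (if \<exists>v<n. s4 ''f'' (?m * n + v) \<le> k then 1 else s ''out'' 0)"
      using s4 by blast
  }
qed

lemma bit_mask: "bit (2 ^ j - 1 :: nat) i \<longleftrightarrow> i < j"
  using bit_mask_iff[of j i, where 'a = nat] by (simp add: mask_eq_exp_minus_1)

text \<open>The tree behind a finite entry contains all terminals, and these form a vertex cover, so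
  its vertex set is a connected vertex cover.\<close>

lemma steiner_sound:
  assumes e: "env n E k s"
  shows "den steiner s ''out'' 0 = s ''out'' 0 \<or> den steiner s ''out'' 0 = 1 \<and> (\<exists>T. sol False n E k T)"
proof (cases "den steiner s ''out'' 0 = s ''out'' 0")
  case False
  let ?s1 = "den vc s"
  let ?m = "2 ^ ?s1 ''j'' 0 - 1 :: nat"
  have j: "?s1 ''j'' 0 \<le> k + 1" and iso: "\<forall>x<n. \<exists>y. {x, y} \<in> E"
    using den_steiner(1)[OF e] False by blast+
  from den_steiner(2)[OF e j iso] obtain s4 where snd: "dp_sound n E k (?s1 ''tm'') s4"
    and out4: "den steiner s ''out'' 0 = (if \<exists>v<n. s4 ''f'' (?m * n + v) \<le> k then 1 else s ''out'' 0)" by blast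
  have "\<exists>v<n. s4 ''f'' (?m * n + v) \<le> k" using out4 False by (metis (no_types, lifting))
  then obtain v where v: "v < n" "s4 ''f'' (?m * n + v) \<le> k" by blast
  then have out: "den steiner s ''out'' 0 = 1" using out4 by (metis (no_types, lifting))
  have "(2 :: nat) ^ ?s1 ''j'' 0 \<le> 2 ^ (k + 1)" using j by (intro power_increasing) auto
  then have m: "?m < 2 ^ (k + 1)" using less_le_trans[of ?m "2 ^ ?s1 ''j'' 0" "2 ^ (k + 1)"] by simp
  obtain S c where S: "tree E v S c" "c \<le> s4 ''f'' (?m * n + v)"
    "\<forall>u<n. 0 < ?s1 ''tm'' u \<and> bit ?m (?s1 ''tm'' u - 1) \<longrightarrow> u \<in> S"
    using snd[unfolded dp_sound_def, rule_format, OF m v] by blast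
  have vc: "terms_ok n ?s1" "\<And>u w. u < n \<Longrightarrow> w < n \<Longrightarrow> {u, w} \<in> E \<Longrightarrow> 0 < ?s1 ''tm'' u \<or> 0 < ?s1 ''tm'' w"
    using den_vc_sound[OF e] by auto
  have inS: "u \<in> S" if "u < n" "0 < ?s1 ''tm'' u" for u
  proof -
    have "?s1 ''tm'' u \<le> ?s1 ''j'' 0" using vc(1) that(1) by (simp add: terms_ok_def)
    then have "bit ?m (?s1 ''tm'' u - 1)" using that(2) by (simp only: bit_mask)
    then show ?thesis using S(3) that by blast
  qed
  note G = env_simple[OF e]
  have "sol False n E k (\<lambda>x. x \<in> S)"
  proof (rule connected_cover_sol[OF G S(1) v(1)])
    show "c \<le> k" using S(2) v(2) by simp
    show "x \<in> S \<or> y \<in> S" if "{x, y} \<in> E" for x y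
      using edge_less[OF G that] vc(2)[OF _ _ that] inS by blast
  qed (use iso in blast)
  then show ?thesis using out by blast
qed simp

text \<open>If the cover is guessed according to \<open>S\<close>, all terminals lie in
  \<open>S\<close>, and the tree on \<open>S\<close> itself bounds the entry of the full
  mask.\<close>

lemma steiner_complete:
  assumes G: "simple_graph ({..<n}, E)" and sol: "sol bal n E k T"
    and t: "ncomp n E T True = 1" and s: "1 \<le> ncomp n E T False"
  shows "\<exists>bs. length bs \<le> k + 1 \<and> (\<forall>s. env n E k s \<and> ext s bs \<longrightarrow> den steiner s ''out'' 0 = 1)"
proof -
  obtain v S c where v: "v < n" and tr: "tree E v S c" "c \<le> k"
    and cover: "\<And>x y. {x, y} \<in> E \<Longrightarrow> x \<in> S \<or> y \<in> S"
    using sol_connected_cover[OF G sol t] by blast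
  have S: "finite S" "card S \<le> k + 1" using tree_card[OF tr(1)] tr(2) by auto
  have ex: "\<exists>w<n. T w = b" for b
  proof -
    have "colour_class n T b \<noteq> {}" using s t by (cases b) (auto simp: ncomp_def)
    then show ?thesis by (auto simp: colour_class_def)
  qed
  \<comment> \<open>The component of \<open>x\<close> is adjacent to one of the other colour. If
    that edge does not start at \<open>x\<close>, the component has a second vertex and
    \<open>x\<close> a neighbour inside it.\<close>
  have iso: "\<exists>y. {x, y} \<in> E" if x: "x < n" for x
  proof -
    obtain w where w: "w < n" "T w = (\<not> T x)" using ex by blast
    then have "\<exists>u'\<in>component E T x. \<exists>v'\<in>component E T w. {u', v'} \<in> E"
      using sol x unfolding sol_def by blast
    then obtain u' v' where u: "(x, u') \<in> conn (mono_edges E T)" "{u', v'} \<in> E"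
      by (auto simp: in_component_iff)
    show ?thesis
    proof (cases "u' = x")
      case False
      then show ?thesis using conn_crossing[OF u(1), of "{x}"] by (auto simp: mono_edges_iff)
    qed (use u(2) in blast)
  qed
  obtain bs where bs: "length bs \<le> card S" "\<And>s. env n E k s \<Longrightarrow> ext s bs \<Longrightarrow>
    (\<forall>v<n. 0 < den vc s ''tm'' v \<longrightarrow> v \<in> S) \<and> den vc s ''j'' 0 = length bs \<and>
    (\<forall>i<length bs. \<exists>v<n. den vc s ''tm'' v = Suc i)"
    using vc_complete[OF G S(1) cover, of k] by blast
  have "den steiner s ''out'' 0 = 1" if e: "env n E k s" "ext s bs" for s
  proof -
    let ?s1 = "den vc s"
    let ?m = "2 ^ ?s1 ''j'' 0 - 1 :: nat"
    have vc: "\<And>v. v < n \<Longrightarrow> 0 < ?s1 ''tm'' v \<Longrightarrow> v \<in> S" "?s1 ''j'' 0 = length bs"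
      "\<And>i. i < length bs \<Longrightarrow> \<exists>v<n. ?s1 ''tm'' v = Suc i"
      using bs(2)[OF e] by blast+
    have j: "?s1 ''j'' 0 \<le> k + 1" using vc(2) bs(1) S(2) by simp
    have "\<forall>x<n. \<exists>y. {x, y} \<in> E" using iso by blast
    from den_steiner(2)[OF e(1) j this] obtain s4 where C: "dp_complete n E k (?s1 ''tm'') (k + 1) s4"
      and out: "den steiner s ''out'' 0 = (if \<exists>v<n. s4 ''f'' (?m * n + v) \<le> k then 1 else s ''out'' 0)"
      by blast
    have "(2 :: nat) ^ ?s1 ''j'' 0 \<le> 2 ^ (k + 1)" using j by (intro power_increasing) auto
    then have m: "?m < 2 ^ (k + 1)" using less_le_trans[of ?m "2 ^ ?s1 ''j'' 0" "2 ^ (k + 1)"] by simp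
    have "s4 ''f'' (?m * n + v) \<le> c"
    proof (rule C[unfolded dp_complete_def, rule_format, OF tr(1) _ v m])
      show "\<exists>u\<in>S. u < n \<and> ?s1 ''tm'' u = Suc i" if "bit ?m i" for i
        using that vc(1) vc(3)[of i] unfolding bit_mask vc(2) by force
    qed (use tr(2) in simp)
    then have "\<exists>v<n. s4 ''f'' (?m * n + v) \<le> k" using v tr(2) order_trans by blast
    then show ?thesis unfolding out by (rule if_P)
  qed
  then show ?thesis using bs(1) S(2) by (intro exI[of _ bs]) auto
qed

section \<open>The decision procedure\<close>

definition main :: "bool \<Rightarrow> fprog" where
  "main bal = check bal ;;
     FFor ''c'' ''L'' (decode ;; FFor ''a'' ''n1'' (FFor ''b'' ''n1'' (cand_ab ;; check bal) ;; cand_a ;; check bal)) ;;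
     (if bal then FSkip else FFor ''c'' ''K'' (decode ;; steiner))"

section \<open>Soundness and persistence of a positive answer\<close>

text \<open>\<open>Y\<close> says that the instance is a yes-instance. As the answer may change only
  to 1, and only under \<open>Y\<close>, the same predicate yields soundness and shows that a
  positive answer survives the rest of the program.\<close>

definition preserves :: "nat \<Rightarrow> nat set set \<Rightarrow> nat \<Rightarrow> bool \<Rightarrow> fprog \<Rightarrow> bool" where
  "preserves n E k Y p \<longleftrightarrow> (\<forall>s. env n E k s \<longrightarrow> env n E k (den p s) \<and>
     (den p s ''out'' 0 = s ''out'' 0 \<or> den p s ''out'' 0 = 1 \<and> Y))"

lemma preserves_frame: "asg p \<inter> env_vars = {} \<Longrightarrow> ''out'' \<notin> asg p \<Longrightarrow> preserves n E k Y p"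
  by (simp add: preserves_def env_den den_frame)

lemma preserves_Seq: "preserves n E k Y p \<Longrightarrow> preserves n E k Y q \<Longrightarrow> preserves n E k Y (p ;; q)"
  unfolding preserves_def den_simps by metis

lemma preserves_For:
  assumes p: "preserves n E k Y p" and x: "x \<notin> env_vars" "x \<noteq> ''out''"
  shows "preserves n E k Y (FFor x y p)"
  unfolding preserves_def
proof (intro allI impI)
  fix s assume e: "env n E k s"
  show "env n E k (den (FFor x y p) s) \<and>
    (den (FFor x y p) s ''out'' 0 = s ''out'' 0 \<or> den (FFor x y p) s ''out'' 0 = 1 \<and> Y)"
  proof (rule den_For_induct[where I = "\<lambda>_ s'. env n E k s' \<and> (s' ''out'' 0 = s ''out'' 0 \<or> s' ''out'' 0 = 1 \<and> Y)"])
    fix i s' assume I: "env n E k s' \<and> (s' ''out'' 0 = s ''out'' 0 \<or> s' ''out'' 0 = 1 \<and> Y)"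
    then have "env n E k (upd s' x 0 i)" using x(1) by (simp add: env_upd)
    moreover have "upd s' x 0 i ''out'' 0 = s' ''out'' 0" using x(2) by simp
    ultimately show "env n E k (den p (upd s' x 0 i)) \<and>
      (den p (upd s' x 0 i) ''out'' 0 = s ''out'' 0 \<or> den p (upd s' x 0 i) ''out'' 0 = 1 \<and> Y)"
      using p I unfolding preserves_def by metis
  next
    fix s' assume I: "env n E k s' \<and> (s' ''out'' 0 = s ''out'' 0 \<or> s' ''out'' 0 = 1 \<and> Y)"
    then have "env n E k (upd s' x 0 (s y 0))" using x(1) by (simp add: env_upd)
    moreover have "upd s' x 0 (s y 0) ''out'' 0 = s' ''out'' 0" using x(2) by simp
    ultimately show "env n E k (upd s' x 0 (s y 0)) \<and>
      (upd s' x 0 (s y 0) ''out'' 0 = s ''out'' 0 \<or> upd s' x 0 (s y 0) ''out'' 0 = 1 \<and> Y)"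
      using I by metis
  qed (use e in simp)
qed

lemma preserves_check: "preserves n E k (\<exists>T. sol bal n E k T) (check bal)"
  unfolding preserves_def
proof (intro allI impI conjI)
  fix s assume e: "env n E k s"
  show "env n E k (den (check bal) s)" by (rule env_den[OF e]) (auto simp: env_vars_def)
  show "den (check bal) s ''out'' 0 = s ''out'' 0 \<or> den (check bal) s ''out'' 0 = 1 \<and> (\<exists>T. sol bal n E k T)"
    using den_check[OF e, of bal] by auto
qed

lemma preserves_steiner: "preserves n E k (\<exists>T. sol False n E k T) steiner"
  unfolding preserves_def
proof (intro allI impI conjI)
  fix s assume e: "env n E k s"
  show "env n E k (den steiner s)" by (rule env_den[OF e]) (auto simp: env_vars_def)
qed (rule steiner_sound)

lemma preserves_parts:
  "preserves n E k Y decode" "preserves n E k Y cand_ab" "preserves n E k Y cand_a" "preserves n E k Y FSkip"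
  by (auto intro!: preserves_frame simp: env_vars_def)

lemma preserves_main: "preserves n E k (\<exists>T. sol bal n E k T) (main bal)"
proof -
  have "preserves n E k (\<exists>T. sol bal n E k T) (if bal then FSkip else FFor ''c'' ''K'' (decode ;; steiner))"
    using preserves_steiner
    by (auto intro!: preserves_For preserves_Seq preserves_parts simp: env_vars_def)
  then show ?thesis unfolding main_def
    by (intro preserves_Seq preserves_check preserves_For preserves_parts) (simp_all add: env_vars_def)
qed

section \<open>Completeness of the search\<close>

lemma hit_Seq: "preserves n E k Y q \<Longrightarrow> env n E k (den p s) \<Longrightarrow> den p s ''out'' 0 = 1 \<Longrightarrow> den (p ;; q) s ''out'' 0 = 1"
  unfolding preserves_def den_simps by metis

lemma hit_For:
  assumes p: "preserves n E k Y p" and x: "x \<notin> env_vars" "x \<noteq> ''out''" and e: "env n E k s" and i: "i < s y 0"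
    and hit: "\<And>s'. env n E k s' \<Longrightarrow> s' x 0 = i \<Longrightarrow> (\<And>z. z \<notin> insert x (asg p) \<Longrightarrow> s' z = s z) \<Longrightarrow> den p s' ''out'' 0 = 1"
  shows "den (FFor x y p) s ''out'' 0 = 1"
proof -
  have P: "env n E k (den p (upd s' x 0 i))" if "env n E k s'" for s' i
    using p x(1) that by (simp add: preserves_def env_upd)
  have "env n E k (den (FFor x y p) s) \<and> den (FFor x y p) s ''out'' 0 = 1"
  proof (rule den_For_hit[where J = "env n E k" and i = i])
    show "env n E k (den p (upd s' x 0 i)) \<and> den p (upd s' x 0 i) ''out'' 0 = 1"
      if "env n E k s' \<and> s' ''out'' 0 = 1" for i s'
    proof -
      have "env n E k (upd s' x 0 i)" "upd s' x 0 i ''out'' 0 = 1" using that x by (simp_all add: env_upd)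
      then show ?thesis using p unfolding preserves_def by metis
    qed
    show "env n E k (den p (upd s' x 0 i)) \<and> den p (upd s' x 0 i) ''out'' 0 = 1"
      if "env n E k s'" "\<And>z. z \<notin> insert x (asg p) \<Longrightarrow> s' z = s z" for s'
    proof (intro conjI P that(1) hit)
      show "env n E k (upd s' x 0 i)" using that(1) x(1) by (simp add: env_upd)
      show "upd s' x 0 i z = s z" if "z \<notin> insert x (asg p)" for z
        using that \<open>\<And>z. z \<notin> insert x (asg p) \<Longrightarrow> s' z = s z\<close> by (simp add: upd_other)
    qed simp
    show "env n E k (upd s' x 0 j) \<and> upd s' x 0 j ''out'' 0 = 1" if "env n E k s' \<and> s' ''out'' 0 = 1" for s' j
      using that x by (simp add: env_upd)
  qed (use e i P in auto)
  then show ?thesis ..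
qed

lemma sol_cong:
  assumes "simple_graph ({..<n}, E)" "\<And>v. v < n \<Longrightarrow> T v = T' v"
  shows "sol bal n E k T = sol bal n E k T'"
proof -
  have "mono_edges E T = mono_edges E T'"
  proof (rule set_eqI)
    fix e
    show "e \<in> mono_edges E T \<longleftrightarrow> e \<in> mono_edges E T'"
    proof (cases "e \<in> E")
      case True
      then obtain u v where "e = {u, v}" "u < n" "v < n" using simple_graph_ends[OF assms(1), of e] by auto
      then show ?thesis using assms(2) by (simp add: mono_edges_iff)
    qed (auto simp: mono_edges_def)
  qed
  then have "component E T = component E T'" by (simp add: component_def fun_eq_iff)
  moreover have "colour_class n T = colour_class n T'" using assms(2) by (auto simp: colour_class_def fun_eq_iff)
  ultimately have "component E T = component E T'" "ncomp n E T = ncomp n E T'" by (simp_all add: ncomp_def fun_eq_iff)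
  then show ?thesis using assms(2) by (simp add: sol_def)
qed

lemma swap_colours:
  "component E (\<lambda>v. \<not> T v) = component E T" "ncomp n E (\<lambda>v. \<not> T v) b = ncomp n E T (\<not> b)"
  "sol bal n E k T \<Longrightarrow> sol bal n E k (\<lambda>v. \<not> T v)"
proof -
  have "mono_edges E (\<lambda>v. \<not> T v) = mono_edges E T" by (simp add: mono_edges_def)
  then show c: "component E (\<lambda>v. \<not> T v) = component E T" by (simp add: component_def fun_eq_iff)
  have "colour_class n (\<lambda>v. \<not> T v) b = colour_class n T (\<not> b)" for b by (auto simp: colour_class_def)
  then show nc: "ncomp n E (\<lambda>v. \<not> T v) b = ncomp n E T (\<not> b)" for b by (simp add: ncomp_def c)
  assume "sol bal n E k T"
  then show "sol bal n E k (\<lambda>v. \<not> T v)" unfolding sol_def c nc by (auto simp: add_ac)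
qed

text \<open>The counter runs through all bit strings of length \<open>l\<close>. The round that
  matters is the one whose digits spell \<open>bs\<close>, padded with zeros.\<close>

lemma decode_hit:
  assumes q: "\<And>s. env n E k s \<Longrightarrow> ext s bs \<Longrightarrow> den q s ''out'' 0 = 1" and Y: "preserves n E k Y q"
    and len: "length bs \<le> l" "l \<le> 4 * k + 1" and y: "\<And>s. env n E k s \<Longrightarrow> s y 0 = 2 ^ l" and e: "env n E k s"
  shows "den (FFor ''c'' y (decode ;; q)) s ''out'' 0 = 1"
proof -
  obtain c :: nat where c: "c < 2 ^ l" "\<forall>i<l. bit c i = (i < length bs \<and> bs ! i)"
    using ex_bits[of l "\<lambda>i. i < length bs \<and> bs ! i"] by blast
  have "(2 :: nat) ^ l \<le> 2 ^ (4 * k + 1)" using len(2) by (intro power_increasing) auto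
  then have c': "c < 2 ^ (4 * k + 1)" using c(1) by linarith
  show ?thesis
  proof (rule hit_For[where i = c])
    show "preserves n E k Y (decode ;; q)" by (intro preserves_Seq preserves_parts Y)
    fix s' assume s': "env n E k s'" "s' ''c'' 0 = c"
    have "ext (den decode s') bs"
      unfolding ext_def using den_decode[OF s'(1)] s'(2) c' c(2) len by simp
    moreover have "env n E k (den decode s')" by (rule env_den[OF s'(1)]) (auto simp: env_vars_def)
    ultimately show "den (decode ;; q) s' ''out'' 0 = 1" using q by simp
  qed (use e y c(1) in \<open>auto simp: env_vars_def\<close>)
qed

lemma main_complete:
  assumes e: "env n E k s" and col: "\<forall>v. s ''col'' v = 0" and ex: "\<exists>T. sol bal n E k T"
  shows "den (main bal) s ''out'' 0 = 1"
proof -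
  note G = env_simple[OF e]
  let ?Y = "\<exists>T. sol bal n E k T"
  let ?ab = "FFor ''b'' ''n1'' (cand_ab ;; check bal)"
  let ?a = "FFor ''a'' ''n1'' (?ab ;; cand_a ;; check bal)"
  let ?st = "if bal then FSkip else FFor ''c'' ''K'' (decode ;; steiner)"
  have pab: "preserves n E k ?Y ?ab" "preserves n E k ?Y (cand_ab ;; check bal)"
    by (intro preserves_For preserves_Seq preserves_parts preserves_check; simp add: env_vars_def)+
  have pa: "preserves n E k ?Y ?a" "preserves n E k ?Y (?ab ;; cand_a ;; check bal)"
    "preserves n E k ?Y (cand_a ;; check bal)"
    by (intro preserves_For preserves_Seq preserves_parts preserves_check pab; simp add: env_vars_def)+
  have pst: "preserves n E k ?Y ?st"
    using preserves_steiner by (auto intro!: preserves_For preserves_Seq preserves_parts simp: env_vars_def)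
  have pL: "preserves n E k ?Y (FFor ''c'' ''L'' (decode ;; ?a))"
    by (intro preserves_For preserves_Seq preserves_parts pa) (simp_all add: env_vars_def)
  define s1 where "s1 = den (check bal) s"
  have e1: "env n E k s1" using preserves_check[of n E k bal] e by (simp add: s1_def preserves_def)
  have e2: "env n E k (den (FFor ''c'' ''L'' (decode ;; ?a)) s1)" using pL e1 by (simp add: preserves_def)
  have main: "den (main bal) s = den ?st (den (FFor ''c'' ''L'' (decode ;; ?a)) s1)"
    by (simp add: main_def s1_def)
  have n1: "s' ''n1'' 0 = n + 1" if "env n E k s'" for s' using that by (simp add: env_def)
  have by_a: "den (main bal) s ''out'' 0 = 1"
    if "length bs \<le> 4 * k + 1" "\<And>s. env n E k s \<Longrightarrow> ext s bs \<Longrightarrow> den ?a s ''out'' 0 = 1" for bs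
  proof -
    have "den (FFor ''c'' ''L'' (decode ;; ?a)) s1 ''out'' 0 = 1"
      by (rule decode_hit[OF that(2) pa(1) that(1) order_refl _ e1]) (simp_all add: env_def)
    then show ?thesis using pst e2 unfolding main preserves_def by metis
  qed
  have by_ab: "den (main bal) s ''out'' 0 = 1"
    if ab: "a \<le> n" "b \<le> n" and sol: "sol bal n E k T" and len: "length bs \<le> 4 * k + 1"
      and run: "\<And>s. env n E k s \<Longrightarrow> s ''a'' 0 = a \<Longrightarrow> s ''b'' 0 = b \<Longrightarrow> ext s bs \<Longrightarrow>
        \<forall>v<n. (0 < den cand_ab s ''col'' v) = T v" for a b T bs
  proof (rule by_a[OF len])
    fix s assume s: "env n E k s" "ext s bs"
    show "den ?a s ''out'' 0 = 1"
    proof (rule hit_For[OF pa(2) _ _ s(1), where i = a])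
      fix s' assume s': "env n E k s'" "s' ''a'' 0 = a" "\<And>z. z \<notin> insert ''a'' (asg (?ab ;; cand_a ;; check bal)) \<Longrightarrow> s' z = s z"
      have g: "s' ''g'' = s ''g''" using s'(3) by simp
      have "den ?ab s' ''out'' 0 = 1"
      proof (rule hit_For[OF pab(2) _ _ s'(1), where i = b])
        fix s'' assume s'': "env n E k s''" "s'' ''b'' 0 = b" "\<And>z. z \<notin> insert ''b'' (asg (cand_ab ;; check bal)) \<Longrightarrow> s'' z = s' z"
        have "ext s'' bs" "s'' ''a'' 0 = a" using s''(3) g s(2) s'(2) by (simp_all add: ext_def)
        then have T: "\<forall>v<n. (0 < den cand_ab s'' ''col'' v) = T v" using run[of s''] s''(1,2) by simp
        have e: "env n E k (den cand_ab s'')" by (rule env_den[OF s''(1)]) (auto simp: env_vars_def)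
        have "sol bal n E k (\<lambda>v. 0 < den cand_ab s'' ''col'' v)" 
          using T by (intro sol_cong[OF G, THEN iffD1, OF _ sol]) simp
        then show "den (cand_ab ;; check bal) s'' ''out'' 0 = 1" using den_check[OF e, of bal] by simp
      qed (use ab n1[OF s'(1)] in \<open>auto simp: env_vars_def\<close>)
      moreover have "env n E k (den ?ab s')" using pab(1) s'(1) by (simp add: preserves_def)
      ultimately show "den (?ab ;; cand_a ;; check bal) s' ''out'' 0 = 1" by (intro hit_Seq[OF pa(3)])
    qed (use ab n1[OF s(1)] in \<open>auto simp: env_vars_def\<close>)
  qed
  have by_1: "den (main bal) s ''out'' 0 = 1"
    if a: "a \<le> n" and sol: "sol bal n E k T" and len: "length bs \<le> 4 * k + 1"
      and run: "\<And>s. env n E k s \<Longrightarrow> s ''a'' 0 = a \<Longrightarrow> ext s bs \<Longrightarrow> \<forall>v<n. (0 < den cand_a s ''col'' v) = T v" for a T bs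
  proof (rule by_a[OF len])
    fix s assume s: "env n E k s" "ext s bs"
    show "den ?a s ''out'' 0 = 1"
    proof (rule hit_For[OF pa(2) _ _ s(1), where i = a])
      fix s' assume s': "env n E k s'" "s' ''a'' 0 = a" "\<And>z. z \<notin> insert ''a'' (asg (?ab ;; cand_a ;; check bal)) \<Longrightarrow> s' z = s z"
      define s2 where "s2 = den ?ab s'"
      have "s2 ''g'' = s' ''g''" "s2 ''a'' = s' ''a''"
        unfolding s2_def by (rule den_frame; simp)+
      then have "ext s2 bs" "s2 ''a'' 0 = a" using s'(2,3) s(2) by (simp_all add: ext_def)
      moreover have e2: "env n E k s2" using pab(1) s'(1) by (simp add: s2_def preserves_def)
      ultimately have T: "\<forall>v<n. (0 < den cand_a s2 ''col'' v) = T v" using run[of s2] by simp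
      have e: "env n E k (den cand_a s2)" by (rule env_den[OF e2]) (auto simp: env_vars_def)
      have "sol bal n E k (\<lambda>v. 0 < den cand_a s2 ''col'' v)" 
          using T by (intro sol_cong[OF G, THEN iffD1, OF _ sol]) simp
      then show "den (?ab ;; cand_a ;; check bal) s' ''out'' 0 = 1"
        using den_check[OF e, of bal] by (simp add: s2_def[symmetric])
    qed (use a n1[OF s(1)] in \<open>auto simp: env_vars_def\<close>)
  qed
  obtain T0 where T0: "sol bal n E k T0" using ex ..
  obtain T where sol: "sol bal n E k T" and st: "ncomp n E T True \<le> ncomp n E T False"
  proof (cases "ncomp n E T0 True \<le> ncomp n E T0 False")
    case False
    then show ?thesis using that[of "\<lambda>v. \<not> T0 v"] swap_colours(3)[OF T0] by (simp add: swap_colours(2))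
  qed (use T0 that in blast)
  have n: "n \<le> k + ncomp n E T False + ncomp n E T True" using sol by (simp add: sol_def)
  consider "ncomp n E T True = 0" | "n \<le> 4 * k + 1" | "ncomp n E T True > k"
    | "ncomp n E T True \<noteq> 0" "n > 4 * k + 1" "ncomp n E T True \<le> k" by linarith
  then show ?thesis
  proof cases
    case 1
    then have "colour_class n T True = {}" by (simp add: ncomp_def)
    then have "\<And>v. v < n \<Longrightarrow> T v = (0 < s ''col'' v)" using col by (auto simp: colour_class_def)
    then have "sol bal n E k (\<lambda>v. 0 < s ''col'' v)" 
      by (intro sol_cong[OF G, THEN iffD1, OF _ sol])
    then have "s1 ''out'' 0 = 1" unfolding s1_def using den_check[OF e, of bal] by simp
    moreover have "preserves n E k ?Y (FFor ''c'' ''L'' (decode ;; ?a) ;; ?st)" by (intro preserves_Seq pL pst)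
    ultimately show ?thesis using e1 unfolding main preserves_def den_simps by metis
  next
    case 2
    \<comment> \<open>The dummy vertex \<open>n\<close> has no neighbours. With
      \<open>a = b = n\<close> nothing is forced and all \<open>n\<close> vertices are
      guessed.\<close>
    have nn: "{n, v} \<notin> E" for v using edge_less[OF G, of n v] by blast
    obtain bs where bs: "length bs \<le> card {v. v < n \<and> {n, v} \<notin> E \<and> {n, v} \<notin> E}"
      "\<And>s. env n E k s \<Longrightarrow> s ''a'' 0 = n \<Longrightarrow> s ''b'' 0 = n \<Longrightarrow> ext s bs \<Longrightarrow>
        \<forall>v<n. (0 < den cand_ab s ''col'' v) = T v"
      using cand_ab_complete[of n n n E T k] nn by blast
    have "length bs \<le> 4 * k + 1" using bs(1) 2 nn by simp
    then show ?thesis using by_ab[OF order_refl order_refl sol _ bs(2)] by blast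
  next
    case 3
    then have "k < ncomp n E T False" using st by simp
    obtain a where a: "a < n" "\<not> T a" "\<forall>v. {a, v} \<in> E \<longrightarrow> T v \<noteq> T a"
      using ex_isolated[OF G sol \<open>k < ncomp n E T False\<close>] by auto
    obtain b where b: "b < n" "T b" "\<forall>v. {b, v} \<in> E \<longrightarrow> T v \<noteq> T b"
      using ex_isolated[OF G sol 3] by auto
    obtain bs where bs: "length bs \<le> card {v. v < n \<and> {a, v} \<notin> E \<and> {b, v} \<notin> E}"
      "\<And>s. env n E k s \<Longrightarrow> s ''a'' 0 = a \<Longrightarrow> s ''b'' 0 = b \<Longrightarrow> ext s bs \<Longrightarrow>
        \<forall>v<n. (0 < den cand_ab s ''col'' v) = T v"
      using cand_ab_complete[of a n b E T k] a b by auto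
    have "length bs \<le> 4 * k + 1" using bs(1) card_undetermined[OF G sol a b] by simp
    then show ?thesis using by_ab[OF _ _ sol _ bs(2)] a(1) b(1) less_imp_le by blast
  next
    case 4
    \<comment> \<open>From \<open>n > 4 * k + 1\<close> and \<open>t \<le> k\<close> it follows that
      more than \<open>2 * k + 1\<close> components have colour 0. In particular the two numbers
      differ, so this case does not occur for balanced bicliques and the Steiner search can be
      omitted there.\<close>
    then have s: "k < ncomp n E T False" using n by linarith
    then have nb: "\<not> bal" using sol 4(3) by (auto simp: sol_def)
    show ?thesis
    proof (cases "ncomp n E T True = 1")
      case True
      obtain bs where bs: "length bs \<le> k + 1" "\<And>s. env n E k s \<Longrightarrow> ext s bs \<Longrightarrow> den steiner s ''out'' 0 = 1"
        using steiner_complete[OF G sol True] s by auto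
      have "den (FFor ''c'' ''K'' (decode ;; steiner)) (den (FFor ''c'' ''L'' (decode ;; ?a)) s1) ''out'' 0 = 1"
        by (rule decode_hit[OF bs(2) preserves_steiner bs(1) _ _ e2]) (simp_all add: env_def)
      then show ?thesis using nb unfolding main by simp
    next
      case False
      obtain a where a: "a < n" "\<not> T a" "\<forall>v. {a, v} \<in> E \<longrightarrow> T v \<noteq> T a"
        using ex_isolated[OF G sol s] by auto
      have "2 \<le> ncomp n E T True" using False 4(1) by linarith
      from cand_a_complete[OF G sol a this 4(3)] obtain bs where bs: "length bs \<le> 4 * k"
        "\<And>s. env n E k s \<Longrightarrow> s ''a'' 0 = a \<Longrightarrow> ext s bs \<Longrightarrow> \<forall>v<n. (0 < den cand_a s ''col'' v) = T v"
        by blast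
      then have "length bs \<le> 4 * k + 1" by simp
      then show ?thesis using by_1[OF _ sol _ bs(2)] a(1) less_imp_le by blast
    qed
  qed
qed

section \<open>Setting up the tables\<close>

definition setup_scalars :: fprog where
  "setup_scalars = FAssign ''n'' (Const 0) (Cell ''in'' (Const 0)) ;; FAssign ''k'' (Const 0) (Cell ''in'' (Const 1)) ;;
     FAssign ''n1'' (Const 0) (Plus (V ''n'') (Const 1)) ;; FAssign ''k1'' (Const 0) (Plus (V ''k'') (Const 1)) ;;
     FAssign ''m'' (Const 0) (Plus (Plus (Plus (V ''k'') (V ''k'')) (Plus (V ''k'') (V ''k''))) (Const 1)) ;;
     FAssign ''m1'' (Const 0) (Plus (V ''m'') (Const 1))"

text \<open>Powers are tabulated by doubling the previous entry, as multiplication is no instruction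
  of the machine. \<open>M\<close> is the length of the table of multiples of \<open>n\<close>,
  which is indexed both by vertices up to \<open>n\<close> and by masks below
  \<open>2 ^ (k + 1)\<close>.\<close>

definition setup_powers :: fprog where
  "setup_powers = FFor ''i'' ''m1'' (FCond (Less (V ''i'') (Const 1)) (FAssign ''pw'' (V ''i'') (Const 1))
       (FAssign ''pw'' (V ''i'') (Plus (Cell ''pw'' (Monus (V ''i'') (Const 1))) (Cell ''pw'' (Monus (V ''i'') (Const 1)))))) ;;
     FAssign ''L'' (Const 0) (Cell ''pw'' (V ''m'')) ;; FAssign ''K'' (Const 0) (Cell ''pw'' (V ''k1'')) ;;
     FAssign ''M'' (Const 0) (Plus (V ''n1'') (V ''K''))"

definition setup_rows :: fprog where
  "setup_rows = FFor ''i'' ''M'' (FCond (Less (V ''i'') (Const 1)) (FAssign ''mul'' (V ''i'') (Const 0))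
       (FAssign ''mul'' (V ''i'') (Plus (Cell ''mul'' (Monus (V ''i'') (Const 1))) (V ''n'')))) ;;
     FAssign ''nn'' (Const 0) (Cell ''mul'' (V ''n''))"

lemma asg_setup: "asg setup_scalars = {''n'', ''k'', ''n1'', ''k1'', ''m'', ''m1''}"
  "asg setup_powers = {''i'', ''pw'', ''L'', ''K'', ''M''}" "asg setup_rows = {''i'', ''mul'', ''nn''}"
  by (auto simp: setup_scalars_def setup_powers_def setup_rows_def)

lemma nth_concat_rows:
  "u < N \<Longrightarrow> v < n \<Longrightarrow> concat (map (\<lambda>i. map (f i) [0..<n]) [0..<N]) ! (u * n + v) = f u v"
proof (induction N)
  case (Suc N)
  have len: "length (concat (map (\<lambda>i. map (f i) [0..<n]) [0..<N])) = N * n" for N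
    by (induction N) auto
  show ?case
  proof (cases "u = N")
    case False
    then have u: "u < N" using Suc.prems by simp
    then have "Suc u * n \<le> N * n" by (intro mult_right_mono) auto
    then have "u * n + v < N * n" using Suc.prems(2) by simp
    then show ?thesis using Suc.IH[OF u Suc.prems(2)] by (simp add: nth_append len)
  qed (use Suc.prems in \<open>simp add: nth_append len\<close>)
qed simp

lemma encode_nth:
  assumes "simple_graph ({..<n}, E)" "u \<le> n" "v < n"
  shows "input_mem (encode n E k) ''in'' (2 + (u * n + v)) = of_bool ({u, v} \<in> E)"
proof -
  let ?xs = "concat (map (\<lambda>i. map (\<lambda>j. of_bool ({i, j} \<in> E) :: nat) [0..<n]) [0..<n])"
  have len: "length (concat (map (\<lambda>i. map (\<lambda>j. of_bool ({i, j} \<in> E) :: nat) [0..<n]) [0..<N])) = N * n" for N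
    by (induction N) auto
  have enc: "encode n E k = n # k # ?xs" by (simp add: encode_def)
  show ?thesis
  proof (cases "u = n")
    case True
    then have "{u, v} \<notin> E" using edge_less[OF assms(1), of u v] by blast
    then show ?thesis using True len[of n] by (simp add: input_mem_def enc)
  next
    case False
    then have u: "u < n" using assms(2) by simp
    then have "Suc u * n \<le> n * n" by (intro mult_right_mono) auto
    then have "u * n + v < n * n" using assms(3) by simp
    then show ?thesis using nth_concat_rows[OF u assms(3), of "\<lambda>i j. of_bool ({i, j} \<in> E)"] len[of n]
      by (simp add: input_mem_def enc)
  qed
qed

lemma setup_env:
  fixes E :: "nat set set" and k :: nat
  assumes G: "simple_graph ({..<n}, E)"
  defines "s1 \<equiv> den setup_scalars (input_mem (encode n E k))"
  defines "s2 \<equiv> den setup_powers s1"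
  defines "s3 \<equiv> den setup_rows s2"
  shows "env n E k s3" "s1 ''m1'' 0 = 4 * k + 2" "s2 ''M'' 0 = n + 1 + 2 ^ (k + 1)"
    "s3 ''out'' 0 = 0" "\<forall>v. s3 ''col'' v = 0"
proof -
  let ?s = "input_mem (encode n E k)"
  have s1: "s1 ''n'' 0 = n" "s1 ''k'' 0 = k" "s1 ''n1'' 0 = n + 1" "s1 ''k1'' 0 = k + 1" "s1 ''m'' 0 = 4 * k + 1"
    "s1 ''m1'' 0 = 4 * k + 2"
    by (simp_all add: s1_def setup_scalars_def input_mem_def encode_def)
  then show "s1 ''m1'' 0 = 4 * k + 2" by simp
  have fr1: "s1 z = ?s z" if "z \<notin> asg setup_scalars" for z unfolding s1_def using that by (rule den_frame)
  have fr2: "s2 z = s1 z" if "z \<notin> asg setup_powers" for z unfolding s2_def using that by (rule den_frame)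
  have fr3: "s3 z = s2 z" if "z \<notin> asg setup_rows" for z unfolding s3_def using that by (rule den_frame)
  let ?p = "FCond (Less (V ''i'') (Const 1)) (FAssign ''pw'' (V ''i'') (Const 1))
       (FAssign ''pw'' (V ''i'') (Plus (Cell ''pw'' (Monus (V ''i'') (Const 1))) (Cell ''pw'' (Monus (V ''i'') (Const 1)))))"
  define t where "t = den (FFor ''i'' ''m1'' ?p) s1"
  have pw: "\<forall>i<4 * k + 2. t ''pw'' i = 2 ^ i"
    unfolding t_def
  proof (rule den_For_induct[where I = "\<lambda>i s. \<forall>j<i. s ''pw'' j = 2 ^ j"])
    fix i and s' :: mem assume "\<forall>j<i. s' ''pw'' j = 2 ^ j"
    then show "\<forall>j<Suc i. den ?p (upd s' ''i'' 0 i) ''pw'' j = 2 ^ j"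
      by (cases i) (auto simp: less_Suc_eq)
  qed (use s1 in auto)
  have frt: "t z = s1 z" if "z \<notin> {''i'', ''pw''}" for z unfolding t_def by (rule den_frame) (use that in auto)
  have s2: "s2 = den (FAssign ''L'' (Const 0) (Cell ''pw'' (V ''m'')) ;; FAssign ''K'' (Const 0) (Cell ''pw'' (V ''k1'')) ;;
     FAssign ''M'' (Const 0) (Plus (V ''n1'') (V ''K''))) t"
    by (simp add: s2_def setup_powers_def t_def)
  have s2': "s2 ''pw'' = t ''pw''" "s2 ''L'' 0 = 2 ^ (4 * k + 1)" "s2 ''K'' 0 = 2 ^ (k + 1)"
    "s2 ''M'' 0 = n + 1 + 2 ^ (k + 1)"
    unfolding s2 using pw frt s1 by (simp_all add: upd_other)
  then show "s2 ''M'' 0 = n + 1 + 2 ^ (k + 1)" by blast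
  let ?q = "FCond (Less (V ''i'') (Const 1)) (FAssign ''mul'' (V ''i'') (Const 0))
       (FAssign ''mul'' (V ''i'') (Plus (Cell ''mul'' (Monus (V ''i'') (Const 1))) (V ''n'')))"
  define r where "r = den (FFor ''i'' ''M'' ?q) s2"
  have n2: "s2 ''n'' 0 = n" using fr2[of "''n''"] s1 by (simp add: asg_setup)
  have mul: "\<forall>i<n + 1 + 2 ^ (k + 1). r ''mul'' i = i * n"
    unfolding r_def
  proof (rule den_For_induct[where I = "\<lambda>i s. \<forall>j<i. s ''mul'' j = j * n"])
    fix i s' assume "\<forall>j<i. s' ''mul'' j = j * n" "\<And>z. z \<notin> insert ''i'' (asg ?q) \<Longrightarrow> s' z = s2 z"
    then show "\<forall>j<Suc i. den ?q (upd s' ''i'' 0 i) ''mul'' j = j * n"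
      using n2 by (cases i) (auto simp: less_Suc_eq)
  qed (use s2' in auto)
  have frr: "r z = s2 z" if "z \<notin> {''i'', ''mul''}" for z unfolding r_def by (rule den_frame) (use that in auto)
  have s3: "s3 = upd r ''nn'' 0 (r ''mul'' (r ''n'' 0))"
    by (simp add: s3_def setup_rows_def r_def)
  have "s3 ''mul'' = r ''mul''" "s3 ''nn'' 0 = n * n"
    unfolding s3 using mul frr[of "''n''"] n2 by (simp_all add: upd_other)
  moreover have "s3 z = s2 z" if "z \<in> {''n'', ''n1'', ''k'', ''k1'', ''m'', ''L'', ''K'', ''pw''}" for z
    using fr3[of z] that by (auto simp: asg_setup)
  moreover have "s2 z = s1 z" if "z \<in> {''n'', ''n1'', ''k'', ''k1'', ''m''}" for z
    using fr2[of z] that by (auto simp: asg_setup)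
  moreover have "s3 ''in'' = ?s ''in''" using fr1[of "''in''"] fr2[of "''in''"] fr3[of "''in''"] by (simp add: asg_setup)
  ultimately show "env n E k s3"
    unfolding env_def using G s1 s2' pw mul encode_nth[OF G] by simp
  show "s3 ''out'' 0 = 0" "\<forall>v. s3 ''col'' v = 0"
    using fr1[of "''out''"] fr2[of "''out''"] fr3[of "''out''"] fr1[of "''col''"] fr2[of "''col''"] fr3[of "''col''"]
    by (simp_all add: asg_setup input_mem_def)
qed

section \<open>Running time\<close>

lemmas program_defs = setup_scalars_def setup_powers_def setup_rows_def main_def check_def label_def
  lab_round_def lab_step_def count_def cross_def find_edge_def decode_def cand_ab_def cand_a_def init_p_def
  branch_def branch_step_def paint_def guess_cd_def finish_def look_def steiner_def vc_def vc_step_def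
  iso_test_def dp_init_def relax_def relax_round_def relax_step_def or_prog_def

lemma wf_main: "wf_loops setup_scalars" "wf_loops setup_powers" "wf_loops setup_rows" "wf_loops (main bal)"
  by (simp_all add: program_defs)

lemma bounds_main: "bounds setup_scalars = {}" "bounds setup_powers = {''m1''}" "bounds setup_rows = {''M''}"
  "bounds (main bal) \<subseteq> {''n'', ''n1'', ''nn'', ''m'', ''L'', ''K'', ''k1''}"
  by (auto simp: program_defs)

lemma asg_main: "asg (main bal) \<inter> {''n'', ''n1'', ''nn'', ''m'', ''L'', ''K'', ''k1''} = {}"
  by (auto simp: main_def)

text \<open>\<open>L\<close> is \<open>2 * 16 ^ k\<close>, that is, a constant times the fourth
  power of \<open>X = 2 ^ k\<close>. \<open>K\<close> and \<open>M\<close> grow like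
  \<open>X\<close> itself, \<open>M\<close> with an additional term linear in
  \<open>n\<close>.\<close>

definition exp_weight :: "string \<Rightarrow> nat" where
  "exp_weight y = (if y = ''L'' then 4 else if y = ''K'' \<or> y = ''M'' then 1 else 0)"

text \<open>The loop over \<open>L\<close> contains only polynomial loops. The Steiner search nests
  three loops over \<open>K\<close>: one for the guessed cover and two for the pair of
  masks.\<close>

lemma weight_main: "weight exp_weight setup_scalars \<le> 4" "weight exp_weight setup_powers \<le> 4"
  "weight exp_weight setup_rows \<le> 4" "weight exp_weight (main bal) \<le> 4"
  by (simp_all add: exp_weight_def program_defs)

lemma exec_bounded:
  assumes wf: "wf_loops p" "bounds p \<inter> asg p = {}" and w: "weight exp_weight p \<le> 4" and D: "loop_depth p \<le> D"
  shows "\<exists>C. \<forall>s P X. P \<ge> 1 \<longrightarrow> X \<ge> 1 \<longrightarrow> (\<forall>y\<in>bounds p. s y 0 \<le> P * X ^ exp_weight y) \<longrightarrow>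
    (\<exists>t. exec (compile p) s t (den p s) \<and> t \<le> C * P ^ D * X ^ 4)"
proof -
  obtain C where C: "\<And>P X e. P \<ge> 1 \<Longrightarrow> X \<ge> 1 \<Longrightarrow> \<forall>y\<in>bounds p. e y \<le> P * X ^ exp_weight y \<Longrightarrow>
     tcost p e \<le> C * P ^ loop_depth p * X ^ weight exp_weight p"
    using tcost_bound[of p exp_weight] by blast
  have "\<exists>t. exec (compile p) s t (den p s) \<and> t \<le> C * P ^ D * X ^ 4"
    if *: "P \<ge> 1" "X \<ge> 1" "\<forall>y\<in>bounds p. s y 0 \<le> P * X ^ exp_weight y" for s P X
  proof -
    obtain t where t: "exec (compile p) s t (den p s)" "t \<le> tcost p (\<lambda>y. s y 0)"
      using exec_compile[OF wf, of s "\<lambda>y. s y 0"] by blast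
    have "tcost p (\<lambda>y. s y 0) \<le> C * P ^ loop_depth p * X ^ weight exp_weight p" using * by (intro C)
    also have "\<dots> \<le> C * P ^ D * X ^ 4" using * w D by (intro mult_mono power_increasing) auto
    finally show ?thesis using t by (meson le_trans)
  qed
  then show ?thesis by blast
qed

lemma size_encode: "n + 2 \<le> input_size (encode n E k)"
proof -
  have "length xs \<le> input_size xs" for xs by (induction xs) (auto simp: input_size_def)
  moreover have "length (concat (map (\<lambda>i. map (\<lambda>j. of_bool ({i, j} \<in> E) :: nat) [0..<n]) [0..<N])) = N * n" for N
    by (induction N) auto
  then have "length (encode n E k) = 2 + n * n" by (simp add: encode_def)
  moreover have "n \<le> n * n" by (cases n) auto
  ultimately show ?thesis by (metis add.commute add_le_mono le_refl le_trans)
qed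

text \<open>By Bernoulli's inequality a linear function of \<open>k\<close> is at most a constant
  times \<open>(1 + d) ^ k\<close>, and its \<open>D\<close>-th power at most a constant times
  \<open>((1 + d) ^ D) ^ k\<close>.\<close>

lemma poly_times_16_power:
  assumes "0 < D"
  shows "\<exists>C. \<forall>k. (4 * real k + 4) ^ D * 16 ^ k \<le> C * 25.904 ^ k"
proof -
  define q where "q = (25.904 / 16 :: real)"
  \<comment> \<open>Chosen so that \<open>(1 + d) ^ D\<close> is exactly the ratio of the two
    bases.\<close>
  define d where "d = root D q - 1"
  have q: "q > 1" by (simp add: q_def)
  then have d: "d > 0" using assms by (simp add: d_def real_root_gt_1_iff)
  have dq: "(1 + d) ^ D = q" using assms q by (simp add: d_def real_root_pow_pos2)
  have "(4 * real k + 4) ^ D * 16 ^ k \<le> ((4 / d) ^ D * q) * 25.904 ^ k" for k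
  proof -
    have "1 + real (Suc k) * d \<le> (1 + d) ^ Suc k" using d by (intro Bernoulli_inequality) simp
    then have "real (Suc k) * d \<le> (1 + d) ^ Suc k" by linarith
    then have "4 * real k + 4 \<le> 4 / d * (1 + d) ^ Suc k" using d by (simp add: field_simps)
    then have "(4 * real k + 4) ^ D \<le> (4 / d * (1 + d) ^ Suc k) ^ D" by (intro power_mono) simp_all
    also have "\<dots> = (4 / d) ^ D * ((1 + d) ^ D) ^ Suc k"
      by (simp only: power_mult_distrib power_mult[symmetric] mult.commute)
    also have "\<dots> = ((4 / d) ^ D * q) * q ^ k" by (simp add: dq)
    finally have "(4 * real k + 4) ^ D * 16 ^ k \<le> ((4 / d) ^ D * q) * q ^ k * 16 ^ k" by simp
    also have "\<dots> = ((4 / d) ^ D * q) * (q * 16) ^ k" by (simp only: power_mult_distrib mult.assoc)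
    finally show ?thesis by (simp add: q_def)
  qed
  then show ?thesis by blast
qed

lemma solvable:
  assumes P: "\<And>n E k. simple_graph ({..<n}, E) \<Longrightarrow> Q ({..<n}, E) k \<longleftrightarrow> (\<exists>T. sol bal n E k T)"
  shows "solvable_in_Ostar Q (\<lambda>k. 25.904 ^ k)"
proof -
  \<comment> \<open>\<open>Suc\<close> makes \<open>D\<close> positive, as
    \<open>poly_times_16_power\<close> takes a \<open>D\<close>-th root.\<close>
  define D where "D = Suc (max (max (loop_depth setup_scalars) (loop_depth setup_powers)) (max (loop_depth setup_rows) (loop_depth (main bal))))"
  have D: "loop_depth setup_scalars \<le> D" "loop_depth setup_powers \<le> D" "loop_depth setup_rows \<le> D" "loop_depth (main bal) \<le> D"
    by (auto simp: D_def)
  have disj: "bounds setup_scalars \<inter> asg setup_scalars = {}" "bounds setup_powers \<inter> asg setup_powers = {}"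
    "bounds setup_rows \<inter> asg setup_rows = {}"
    by (simp_all add: bounds_main asg_setup)
  have disj4: "bounds (main bal) \<inter> asg (main bal) = {}"
    using bounds_main(4)[of bal] asg_main[of bal] by blast
  obtain C1 where C1: "\<And>s P X. P \<ge> 1 \<Longrightarrow> X \<ge> 1 \<Longrightarrow> \<forall>y\<in>bounds setup_scalars. s y 0 \<le> P * X ^ exp_weight y \<Longrightarrow>
    \<exists>t. exec (compile setup_scalars) s t (den setup_scalars s) \<and> t \<le> C1 * P ^ D * X ^ 4"
    using exec_bounded[OF wf_main(1) disj(1) weight_main(1) D(1)] by blast
  obtain C2 where C2: "\<And>s P X. P \<ge> 1 \<Longrightarrow> X \<ge> 1 \<Longrightarrow> \<forall>y\<in>bounds setup_powers. s y 0 \<le> P * X ^ exp_weight y \<Longrightarrow>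
    \<exists>t. exec (compile setup_powers) s t (den setup_powers s) \<and> t \<le> C2 * P ^ D * X ^ 4"
    using exec_bounded[OF wf_main(2) disj(2) weight_main(2) D(2)] by blast
  obtain C3 where C3: "\<And>s P X. P \<ge> 1 \<Longrightarrow> X \<ge> 1 \<Longrightarrow> \<forall>y\<in>bounds setup_rows. s y 0 \<le> P * X ^ exp_weight y \<Longrightarrow>
    \<exists>t. exec (compile setup_rows) s t (den setup_rows s) \<and> t \<le> C3 * P ^ D * X ^ 4"
    using exec_bounded[OF wf_main(3) disj(3) weight_main(3) D(3)] by blast
  obtain C4 where C4: "\<And>s P X. P \<ge> 1 \<Longrightarrow> X \<ge> 1 \<Longrightarrow> \<forall>y\<in>bounds (main bal). s y 0 \<le> P * X ^ exp_weight y \<Longrightarrow>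
    \<exists>t. exec (compile (main bal)) s t (den (main bal) s) \<and> t \<le> C4 * P ^ D * X ^ 4"
    using exec_bounded[OF wf_main(4) disj4 weight_main(4) D(4)] by blast
  obtain C0 where C0: "\<And>k. (4 * real k + 4) ^ D * 16 ^ k \<le> C0 * 25.904 ^ k"
    using poly_times_16_power[of D] by (auto simp: D_def)
  define C where "C = real (C1 + C2 + C3 + C4) * C0"
  define prog where "prog = Seq (compile setup_scalars) (Seq (compile setup_powers) (Seq (compile setup_rows) (compile (main bal))))"
  have "\<exists>t s. exec prog (input_mem (encode n E k)) t s \<and> s ''out'' 0 = of_bool (Q ({..<n}, E) k) \<and>
     real t \<le> C * 25.904 ^ k * real (input_size (encode n E k)) ^ (2 * D)"
    if G: "simple_graph ({..<n}, E)" for n E k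
  proof -
    define s0 where "s0 = input_mem (encode n E k)"
    define s1 where "s1 = den setup_scalars s0"
    define s2 where "s2 = den setup_powers s1"
    define s3 where "s3 = den setup_rows s2"
    define s4 where "s4 = den (main bal) s3"
    \<comment> \<open>\<open>B\<close> dominates the polynomial part of every loop bound. Its
      factors have different fates: \<open>n + 2\<close> is at most the input size, whereas
      \<open>4 * k + 4\<close> is absorbed by the exponential.\<close>
    define B X where "B = (n + 2) * (n + 2) * (4 * k + 4)" and "X = (2 :: nat) ^ k"
    note env = setup_env[OF G, of k, folded s0_def, folded s1_def, folded s2_def, folded s3_def]
    have X: "X \<ge> 1" by (simp add: X_def)
    have B: "n * n \<le> B" "n + 1 \<le> B" "n \<le> B" "4 * k + 2 \<le> B" "4 * k + 1 \<le> B" "k + 1 \<le> B" "n + 3 \<le> B" "2 \<le> B" "1 \<le> B"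
      by (simp_all add: B_def algebra_simps)
    have e: "s3 ''n'' 0 = n" "s3 ''n1'' 0 = n + 1" "s3 ''nn'' 0 = n * n" "s3 ''m'' 0 = 4 * k + 1"
      "s3 ''L'' 0 = 2 * X ^ 4" "s3 ''K'' 0 = 2 * X" "s3 ''k1'' 0 = k + 1"
      using env(1) by (simp_all add: env_def X_def power_mult[symmetric] mult.commute)
    obtain t1 where t1: "exec (compile setup_scalars) s0 t1 s1" "t1 \<le> C1 * B ^ D * X ^ 4"
      using C1[of B X s0, OF B(9) X] by (auto simp: bounds_main s1_def)
    obtain t2 where t2: "exec (compile setup_powers) s1 t2 s2" "t2 \<le> C2 * B ^ D * X ^ 4"
      using C2[of B X s1, OF B(9) X] env(2) B(4) by (auto simp: bounds_main s2_def exp_weight_def)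
    have "s2 ''M'' 0 \<le> B * X"
    proof -
      have "n + 1 + 2 * X \<le> (n + 1) * X + 2 * X" 
        using add_le_mono1[OF mult_le_mono2[OF X, of "n + 1"], of "2 * X"] by (simp only: mult_1_right)
      also have "\<dots> = (n + 3) * X" by (simp add: algebra_simps)
      also have "\<dots> \<le> B * X" using B(7) by (rule mult_right_mono) simp
      finally show ?thesis using env(3) by (simp add: X_def)
    qed
    then obtain t3 where t3: "exec (compile setup_rows) s2 t3 s3" "t3 \<le> C3 * B ^ D * X ^ 4"
      using C3[of B X s2, OF B(9) X] by (auto simp: bounds_main s3_def exp_weight_def)
    have "s3 y 0 \<le> B * X ^ exp_weight y" if "y \<in> bounds (main bal)" for y
      using bounds_main(4)[of bal] that e B by (auto simp: exp_weight_def)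
    then obtain t4 where t4: "exec (compile (main bal)) s3 t4 s4" "t4 \<le> C4 * B ^ D * X ^ 4"
      using C4[of B X s3, OF B(9) X] by (auto simp: s4_def)
    define t where "t = t1 + (t2 + (t3 + t4))"
    have "exec prog s0 t s4"
      unfolding prog_def t_def by (intro exec.Seq[OF t1(1)] exec.Seq[OF t2(1)] exec.Seq[OF t3(1)] t4(1))
    moreover have "s4 ''out'' 0 = of_bool (Q ({..<n}, E) k)"
    proof (cases "\<exists>T. sol bal n E k T")
      case True
      then show ?thesis using main_complete[OF env(1,5) True] P[OF G] by (simp add: s4_def)
    next
      case False
      then have "den (main bal) s3 ''out'' 0 = s3 ''out'' 0"
        using preserves_main[of n E k bal] env(1) unfolding preserves_def by blast
      then show ?thesis using env(4) P[OF G] False by (simp add: s4_def)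
    qed
    moreover have "real t \<le> C * 25.904 ^ k * real (input_size (encode n E k)) ^ (2 * D)"
    proof -
      let ?N = "real (input_size (encode n E k))"
      have N: "real (n + 2) \<le> ?N" by (rule of_nat_mono[OF size_encode])
      have "t \<le> (C1 + C2 + C3 + C4) * (B ^ D * X ^ 4)"
        using t1(2) t2(2) t3(2) t4(2) by (simp add: t_def algebra_simps)
      then have "real t \<le> real ((C1 + C2 + C3 + C4) * (B ^ D * X ^ 4))" by (rule of_nat_mono)
      also have "\<dots> = real (C1 + C2 + C3 + C4) * (real B ^ D * real X ^ 4)" by simp
      also have "real X ^ 4 = 16 ^ k" by (simp add: X_def power_mult[symmetric] mult.commute[of k] power_mult)
      also have "real B ^ D = (real (n + 2) ^ 2) ^ D * (4 * real k + 4) ^ D"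
      proof -
        have "real B = real (n + 2) ^ 2 * (4 * real k + 4)"
          by (simp add: B_def power2_eq_square algebra_simps)
        then show ?thesis by (simp only: power_mult_distrib)
      qed
      also have "(real (n + 2) ^ 2) ^ D = real (n + 2) ^ (2 * D)" by (rule power_mult[symmetric])
      also have "real (C1 + C2 + C3 + C4) * (real (n + 2) ^ (2 * D) * (4 * real k + 4) ^ D * 16 ^ k)
        \<le> real (C1 + C2 + C3 + C4) * (?N ^ (2 * D) * (C0 * 25.904 ^ k))"
        unfolding mult.assoc[of "real (n + 2) ^ (2 * D)"]
        using N by (intro mult_left_mono mult_mono[OF _ C0] power_mono) auto
      also have "\<dots> = C * 25.904 ^ k * ?N ^ (2 * D)" by (simp add: C_def)
      finally show ?thesis .
    qed
    ultimately show ?thesis unfolding s0_def by blast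
  qed
  then show ?thesis unfolding solvable_in_Ostar_def by blast
qed

theorem theorem2:
  "solvable_in_Ostar biclique_contraction (\<lambda>k. 25.904 ^ k) \<and>
   solvable_in_Ostar balanced_biclique_contraction (\<lambda>k. 25.904 ^ k)"
proof
  show "solvable_in_Ostar biclique_contraction (\<lambda>k. 25.904 ^ k)"
    by (rule solvable[where bal = False]) (rule contraction_iff_sol)
  show "solvable_in_Ostar balanced_biclique_contraction (\<lambda>k. 25.904 ^ k)"
    by (rule solvable[where bal = True]) (rule contraction_iff_sol)
qed

end
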